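(* Let $V\in\mathbb{C}[q_1,\dots,q_n]$ be a homogeneous potential of degree $k>2$ of the form $V=V_0^2V_1$, where $V_0$ is a non-constant polynomial. If there exists $d\in\mathbb{C}^n$ such that $$V_0(d)=0,\qquad V_1(d)\neq 0,\qquad \sum_{i=1}^n\left(\frac{\partial V_0}{\partial q_i}(d)\right)^2\neq 0,$$ then $V$ is not integrable with rational first integrals.
   Context: For a polynomial potential $V$ consider the complex Hamiltonian system with $H=\frac12\sum_{i=1}^n p_i^2+V(q)$, $(q,p)\in\mathbb{C}^{2n}$, i.e. $\dot q=p$, $\dot p=-V'(q)$, where $V'=\operatorname{grad}V$. The potential $V$ is called integrable with rational first integrals if this system is integrable in the Liouville sense with rational first integrals: there exist $n$ functionally independent, pairwise Poisson-commuting first integrals (including $H$) that are rational functions of $(q,p)$. *)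

theory Defs
  imports "HOL-Analysis.Analysis" "HOL-Library.Poly_Mapping"
begin

text \<open>
  Polynomials over the complex numbers in variables indexed by \<open>'v\<close>: finitely supported maps
  from monomials (exponent vectors) to coefficients, with the ring structure of
  \<^theory>\<open>HOL-Library.Poly_Mapping\<close>. The constant polynomial \<open>c\<close> is
  \<open>Poly_Mapping.single 0 c\<close>.
\<close>
type_synonym 'v cpoly = "('v \<Rightarrow>\<^sub>0 nat) \<Rightarrow>\<^sub>0 complex"

definition constant_poly :: "'v cpoly \<Rightarrow> bool" where
  "constant_poly P \<longleftrightarrow> (\<exists>c. P = Poly_Mapping.single 0 c)"

definition homogeneous_poly :: "nat \<Rightarrow> 'v::finite cpoly \<Rightarrow> bool" where
  "homogeneous_poly k P \<longleftrightarrow>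
     (\<forall>m \<in> Poly_Mapping.keys P. (\<Sum>v\<in>UNIV. Poly_Mapping.lookup m v) = k)"

definition eval_poly :: "'v::finite cpoly \<Rightarrow> complex ^ 'v \<Rightarrow> complex" where
  "eval_poly P x = (\<Sum>m \<in> Poly_Mapping.keys P.
     Poly_Mapping.lookup P m * (\<Prod>v\<in>UNIV. (x $ v) ^ Poly_Mapping.lookup m v))"

text \<open>
  The complex partial derivative at \<open>x\<close> with respect to the variable \<open>v\<close>. It is only used at
  points near which the function is given by a polynomial or by a quotient of polynomials with
  nonvanishing denominator, so the derivative exists.
\<close>
definition partial :: "'v \<Rightarrow> (complex ^ 'v \<Rightarrow> complex) \<Rightarrow> complex ^ 'v \<Rightarrow> complex" where
  "partial v F x = deriv (\<lambda>z. F (\<chi> w. if w = v then z else x $ w)) (x $ v)"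

text \<open>
  Points of the phase space of dimension \<open>2n\<close> are vectors indexed by \<open>'n + 'n\<close>, where
  \<open>n\<close> is the cardinality of \<open>'n\<close>: the coordinate \<open>Inl i\<close> is \<open>q\<^sub>i\<close> and \<open>Inr i\<close> is \<open>p\<^sub>i\<close>.
\<close>
definition position :: "complex ^ ('n + 'n) \<Rightarrow> complex ^ 'n" where
  "position x = (\<chi> i. x $ Inl i)"

definition hamiltonian :: "'n::finite cpoly \<Rightarrow> complex ^ ('n + 'n) \<Rightarrow> complex" where
  "hamiltonian V x = (1 / 2) * (\<Sum>i\<in>UNIV. (x $ Inr i)\<^sup>2) + eval_poly V (position x)"

definition hamiltonian_field :: "'n::finite cpoly \<Rightarrow> complex ^ ('n + 'n) \<Rightarrow> complex ^ ('n + 'n)" where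
  "hamiltonian_field V x =
     (\<chi> v. case v of Inl i \<Rightarrow> x $ Inr i | Inr i \<Rightarrow> - partial i (eval_poly V) (position x))"

definition poisson_bracket ::
  "(complex ^ ('n + 'n) \<Rightarrow> complex) \<Rightarrow> (complex ^ ('n + 'n) \<Rightarrow> complex) \<Rightarrow>
     complex ^ ('n::finite + 'n) \<Rightarrow> complex" where
  "poisson_bracket F G x =
     (\<Sum>i\<in>UNIV. partial (Inl i) F x * partial (Inr i) G x - partial (Inr i) F x * partial (Inl i) G x)"

definition rational_on :: "(complex ^ 'v) set \<Rightarrow> (complex ^ 'v::finite \<Rightarrow> complex) \<Rightarrow> bool" where
  "rational_on U F \<longleftrightarrow>
     (\<exists>P Q. \<forall>x\<in>U. eval_poly Q x \<noteq> 0 \<and> F x = eval_poly P x / eval_poly Q x)"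

text \<open>The derivative of \<open>F\<close> along the vector field \<open>q' = p\<close>, \<open>p' = - grad V (q)\<close> vanishes on \<open>U\<close>.\<close>
definition first_integral_on ::
  "'n::finite cpoly \<Rightarrow> (complex ^ ('n + 'n)) set \<Rightarrow> (complex ^ ('n + 'n) \<Rightarrow> complex) \<Rightarrow> bool" where
  "first_integral_on V U F \<longleftrightarrow>
     (\<forall>x\<in>U. (\<Sum>v\<in>UNIV. partial v F x * hamiltonian_field V x $ v) = 0)"

text \<open>The differentials of the family \<open>F\<close> are linearly independent at every point of \<open>U\<close>.\<close>
definition functionally_independent_on ::
  "(complex ^ 'v) set \<Rightarrow> ('i::finite \<Rightarrow> complex ^ 'v \<Rightarrow> complex) \<Rightarrow> bool" where
  "functionally_independent_on U F \<longleftrightarrow>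
     (\<forall>x\<in>U. \<forall>c :: 'i \<Rightarrow> complex.
        (\<forall>v. (\<Sum>i\<in>UNIV. c i * partial v (F i) x) = 0) \<longrightarrow> (\<forall>i. c i = 0))"

text \<open>
  Rational functions are only defined off the zero set of a denominator, and functional
  independence is a generic condition; hence an open dense set \<open>U\<close> on which all the integrals
  are defined and their differentials are independent. Values of the functions outside \<open>U\<close>
  play no role.
\<close>
definition integrable_with_rational_first_integrals :: "'n::finite cpoly \<Rightarrow> bool" where
  "integrable_with_rational_first_integrals V \<longleftrightarrow>
     (\<exists>(U :: (complex ^ ('n + 'n)) set) (F :: 'n \<Rightarrow> complex ^ ('n + 'n) \<Rightarrow> complex).
        open U \<and> closure U = UNIV \<and>
        (\<forall>i. rational_on U (F i)) \<and>
        (\<forall>i. first_integral_on V U (F i)) \<and>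
        (\<exists>i. \<forall>x\<in>U. F i x = hamiltonian V x) \<and>
        (\<forall>i j. \<forall>x\<in>U. poisson_bracket (F i) (F j) x = 0) \<and>
        functionally_independent_on U F)"

end

theory Submission
  imports Defs "HOL-Computational_Algebra.Polynomial_Factorial" "HOL-Computational_Algebra.Field_as_Ring"
begin

text \<open>
  Put \<open>g = grad V\<^sub>0(d)\<close> and \<open>m = k - 2\<close>. Since \<open>V = V\<^sub>0\<^sup>2 V\<^sub>1\<close>, the force vanishes along the line through \<open>d\<close>, so
  \<open>q = t d\<close> is a solution, and along it \<open>V''\<close> is \<open>2 V\<^sub>1(d) t\<^sup>m g g\<^sup>T\<close>. The linearized system is thus a free motion
  on the orthogonal complement of \<open>g\<close>, together with \<open>x'' = - \<lambda> t\<^sup>m x\<close> in the direction of \<open>g\<close>, where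
  \<open>\<lambda> = 2 V\<^sub>1(d) (g, g)\<close> is nonzero. As \<open>m > 0\<close>, the associated Riccati equation has no nonconstant Darboux polynomial;
  this replaces the fact that its differential Galois group is \<open>SL\<^sub>2\<close>.

  Commuting first integrals \<open>F\<^sub>1, \<dots>, F\<^sub>n\<close> give the \<open>n\<close>-form \<open>\<Omega> = dF\<^sub>1 \<and> \<dots> \<and> dF\<^sub>n\<close>, which is closed, invariant, nonzero,
  and isotropic for the Poisson structure. All four properties pass to its lowest-order part \<open>\<Omega>\<^sub>0\<close> along the line, so no
  independence of leading terms of the integrals themselves (Ziglin's lemma) is needed. The component of \<open>\<Omega>\<^sub>0\<close> on \<open>dx \<and> dy\<close>
  is an invariant scalar, hence constant in \<open>(x, y)\<close>, and the components of degree one in \<open>dx, dy\<close> are multiples of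
  \<open>x dy - y dx\<close>. Isotropy then kills the former, and closedness the latter. What remains is a Lagrangian subspace
  contained in a symplectic space of dimension \<open>2n - 2\<close>, which is absurd.
\<close>

section \<open>Darboux polynomials of the Riccati equation\<close>

text \<open>The system x' = y, y' = - \<lambda> t^m x is studied in the chart x = \<delta>, y =
  \<delta> z, where a function homogeneous of degree e in (x, y) is \<delta>^e times a function of
  z, and z obeys the Riccati equation. So a lowest-order part is taken twice, along the line and
  then in \<delta>, and each invariant becomes a weight e with a rational function of z over C[t].
  Scalars can only have weight 0, and covectors only weight 1. This gap is what lets isotropy act:
  it writes the square of a component on dx dy through products of components on dx or dy alone, and
  these vanish to higher order. The condition m > 0 cannot be dropped from this scheme: for m = 0
  the oscillator energy y^2 + \<lambda> x^2 is an invariant, and z^2 + \<lambda> is a Darboux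
  polynomial. The integrals may have poles along the whole line. Hence the form is carried as a
  polynomial numerator \<open>Om\<close> and denominator \<open>G\<close>, and every differential
  identity is cross-multiplied so that it survives expansion along the line.\<close>

locale derivation =
  fixes d :: "'a::comm_ring_1 \<Rightarrow> 'a"
  assumes add: "d (a + b) = d a + d b"
    and mult: "d (a * b) = d a * b + a * d b"
begin

lemma zero [simp]: "d 0 = 0"
  using add [of 0 0] by simp

lemma one [simp]: "d 1 = 0"
  using mult [of 1 1] by simp

lemma sum: "d (sum f A) = (\<Sum>x\<in>A. d (f x))"
  by (induction A rule: infinite_finite_induct) (simp_all add: add)

lemma power_const: "d a = 0 \<Longrightarrow> d (a ^ n) = 0"
  by (induction n) (simp_all add: mult)

lemma mult_right: "derivation (\<lambda>a. c * d a)"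
  by unfold_locales (simp_all add: add mult algebra_simps)

lemma map_poly: "derivation (map_poly d)"
proof
  show "map_poly d (p + q) = map_poly d p + map_poly d q" for p q
    by (rule poly_eqI) (simp add: coeff_map_poly add)
  show "map_poly d (p * q) = map_poly d p * q + p * map_poly d q" for p q
    by (rule poly_eqI)
      (simp add: coeff_map_poly coeff_mult sum mult sum.distrib)
qed

lemma map_poly_smult: "map_poly d (smult c p) = smult (d c) p + smult c (map_poly d p)"
  by (rule poly_eqI) (simp add: coeff_map_poly mult)

end

lemma derivation_plus: "derivation d \<Longrightarrow> derivation e \<Longrightarrow> derivation (\<lambda>a. d a + e a)"
  by (simp add: derivation_def algebra_simps)

lemma derivation_pderiv: "derivation (pderiv :: 'a::idom poly \<Rightarrow> 'a poly)"
  by unfold_locales (simp_all add: pderiv_add pderiv_mult algebra_simps)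

text \<open>Differentiation along z' = - (lam t^m + z^2), the equation of z = y / x when x' = y and
  y' = - lam t^m x. The outer polynomial variable is z, the inner one t.\<close>

definition riccati :: "complex \<Rightarrow> nat \<Rightarrow> complex poly poly \<Rightarrow> complex poly poly" where
  "riccati lam m Q = map_poly pderiv Q - [:monom lam m, 0, 1:] * pderiv Q"

lemma derivation_riccati: "derivation (riccati lam m)"
proof -
  interpret p: derivation "pderiv :: complex poly \<Rightarrow> _" by (rule derivation_pderiv)
  have "derivation (\<lambda>Q. map_poly pderiv Q + (- [:monom lam m, 0, 1:]) * pderiv Q)"
    by (intro derivation_plus p.map_poly derivation.mult_right derivation_pderiv)
  then show ?thesis unfolding riccati_def [abs_def] by (metis (no_types, lifting) ext minus_mult_left diff_conv_add_uminus)
qed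

lemma coeff_riccati_0: "coeff (riccati lam m Q) 0 = pderiv (coeff Q 0) - monom lam m * coeff Q 1"
  by (simp add: riccati_def coeff_map_poly coeff_pderiv)

lemma coeff_riccati_Suc:
  "coeff (riccati lam m Q) (Suc j) = pderiv (coeff Q (Suc j))
     - monom lam m * (of_nat (j + 2) * coeff Q (j + 2)) - of_nat j * coeff Q j"
  by (cases j) (simp_all add: riccati_def coeff_map_poly coeff_pderiv)

lemma riccati_const [simp]: "riccati lam m [:[:c:]:] = 0"
  by (rule poly_eqI) (simp add: riccati_def coeff_map_poly map_poly_pCons)

section \<open>Asymptotics at infinity of Darboux polynomials\<close>

text \<open>For z = (w + 1) / (w - 1), \<open>f j\<close> is z^j cleared of its denominator. The
  first operator is then 2 z d/dz, and the second is (1 - z^2) d/dz + l z. The point of the change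
  of variable is that the second one becomes diagonal on the powers of w, with eigenvalue 2 r - l on
  w^r.\<close>

lemma binomial_pair_identities:
  fixes l j :: nat
  assumes "j \<le> l"
  defines "f \<equiv> \<lambda>j. [:1, 1:] ^ j * [:- 1, 1:] ^ (l - j) :: 'a::idom poly"
  shows "[:of_nat l, of_nat l:] * f j - [:- 1, 0, 1:] * pderiv (f j) = of_nat (2 * j) * f j"
    and "[:0, 2:] * pderiv (f j) - of_nat l * f j = of_nat j * f (j - 1) + of_nat (l - j) * f (j + 1)"
proof -
  obtain i where l: "l = j + i" using assms(1) le_Suc_ex by blast
  have pd: "pderiv (q ^ n) * q = of_nat n * q ^ n" if "pderiv q = 1" for q :: "'a poly" and n
    using that by (cases n) (simp_all add: pderiv_power_Suc of_nat_poly del: of_nat_Suc power_Suc, simp add: mult.commute)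
  have pd1: "pderiv ([:1, 1::'a:] ^ n) * [:1, 1:] = of_nat n * [:1, 1:] ^ n" for n
    by (rule pd) (simp add: pderiv_pCons)
  have pd2: "pderiv ([:- 1, 1::'a:] ^ n) * [:- 1, 1:] = of_nat n * [:- 1, 1:] ^ n" for n
    by (rule pd) (simp add: pderiv_pCons)
  define u where "u = [:1, 1::'a:]"
  define v where "v = [:- 1, 1::'a:]"
  have uv: "[:- 1, 0, 1:] = u * v" "[:0, 2:] = u + v" "[:of_nat l, of_nat l:] = of_nat l * u"
    "u = v + 2"
    by (simp_all add: u_def v_def of_nat_poly flip: numeral_poly)
      (simp add: numeral_poly)
  have f: "f j = u ^ j * v ^ i" by (simp add: f_def l u_def v_def)
  define a where "a = pderiv (u ^ j)"
  define b where "b = pderiv (v ^ i)"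
  have a: "a * u = of_nat j * u ^ j" using pd1 [of j] by (simp add: a_def u_def)
  have b: "b * v = of_nat i * v ^ i" using pd2 [of i] by (simp add: b_def v_def)
  have d: "pderiv (f j) = a * v ^ i + u ^ j * b"
    by (simp add: f pderiv_mult a_def b_def algebra_simps)
  have "u * v * pderiv (f j) = (a * u) * v * v ^ i + u * u ^ j * (b * v)"
    by (simp add: d algebra_simps)
  also have "\<dots> = (of_nat j * v + of_nat i * u) * f j"
    by (simp add: a b f algebra_simps)
  finally have e: "u * v * pderiv (f j) = (of_nat j * v + of_nat i * u) * f j" .
  have "[:of_nat l, of_nat l:] * f j - [:- 1, 0, 1:] * pderiv (f j) =
      (of_nat l * u - (of_nat j * v + of_nat i * u)) * f j"
    unfolding uv(1,3) e by (simp add: algebra_simps)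
  also have "of_nat l * u - (of_nat j * v + of_nat i * u) = of_nat (2 * j)"
    unfolding uv(4) by (simp add: l algebra_simps)
  finally show "[:of_nat l, of_nat l:] * f j - [:- 1, 0, 1:] * pderiv (f j) = of_nat (2 * j) * f j" .
  have f1: "of_nat j * f (j - 1) * u = of_nat j * f j * v" 
    by (cases j) (simp_all add: f_def l u_def v_def algebra_simps)
  have f2: "of_nat i * f (j + 1) * v = of_nat i * f j * u"
  proof (cases i)
    case (Suc k)
    have "l - (j + 1) = k" by (simp add: l Suc)
    then have "f (j + 1) = u ^ (j + 1) * v ^ k" by (simp add: f_def u_def v_def)
    then show ?thesis by (simp add: f Suc algebra_simps)
  qed simp
  \<comment> \<open>Multiplication by \<open>u * v\<close> absorbs the shifted exponents, also at
    \<open>j = 0\<close> and \<open>j = l\<close>, where the neighbour is missing and its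
    coefficient is 0.\<close>
  have uv0: "u * v \<noteq> 0" by (simp add: u_def v_def)
  have "(([:0, 2:] * pderiv (f j) - of_nat l * f j) - (of_nat j * f (j - 1) + of_nat i * f (j + 1))) * (u * v)
      = (u + v) * (u * v * pderiv (f j)) - of_nat l * f j * u * v
        - (of_nat j * f (j - 1) * u) * v - (of_nat i * f (j + 1) * v) * u"
    unfolding uv(2) by (simp add: algebra_simps)
  also have "\<dots> = 0"
    unfolding e f1 f2 by (simp add: l algebra_simps)
  finally have "([:0, 2:] * pderiv (f j) - of_nat l * f j) - (of_nat j * f (j - 1) + of_nat i * f (j + 1)) = 0"
    using uv0 mult_eq_0_iff by blast
  then show "[:0, 2:] * pderiv (f j) - of_nat l * f j = of_nat j * f (j - 1) + of_nat (l - j) * f (j + 1)"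
    by (simp add: l)
qed

lemma coeff_pCons_mult_pderiv:
  fixes p :: "complex poly poly"
  shows "coeff ([:- 1, 0, 1:] * pderiv p) r
    = (of_nat (r - 1)) * (if r = 0 then 0 else coeff p (r - 1)) - of_nat (Suc r) * coeff p (Suc r)"
proof (cases r)
  case (Suc i)
  then show ?thesis by (cases i) (simp_all add: coeff_pderiv coeff_pCons algebra_simps)
qed (simp add: coeff_pderiv)

text \<open>Here \<open>c r\<close> is the coefficient of w^r, a polynomial in \<tau>. Among the
  coefficients of maximal degree \<open>M\<close>, the terms divisible by \<tau>^2 must cancel by
  themselves, which fixes 2 r - l and so singles out one index. What remains there is 2 \<tau> c' =
  m l c up to lower degree, an Euler equation with exponent m l / 2.\<close>

lemma poly_asymptotic_exponent:
  fixes c :: "nat \<Rightarrow> complex poly"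
  assumes fin: "\<And>r. r > l \<Longrightarrow> c r = 0"
    and nz: "c r0 \<noteq> 0"
    and mu: "mu \<noteq> 0"
    and eq: "\<And>r. 2 * (monom 1 1 * pderiv (c r))
        - of_nat m * (of_nat l * c r + of_nat l * (if r = 0 then 0 else c (r - 1))
            - (of_nat (r - 1) * (if r = 0 then 0 else c (r - 1)) - of_nat (Suc r) * c (Suc r)))
        + 2 * monom mu (m + 2) * ((2 * of_nat r - of_nat l) * c r) = 2 * (monom 1 2 * h) * c r"
  shows "\<exists>M. 2 * M = m * l \<and> coeff (\<Sum>i\<le>l. c i) M \<noteq> 0"
proof -
  define I where "I = {r. c r \<noteq> 0}"
  have I: "finite I" "I \<noteq> {}"
  proof -
    have "I \<subseteq> {..l}" using fin by (force simp: I_def not_less [symmetric])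
    then show "finite I" by (rule finite_subset) simp
    show "I \<noteq> {}" using nz by (auto simp: I_def)
  qed
  define M where "M = Max ((\<lambda>r. degree (c r)) ` I)"
  have M: "degree (c r) \<le> M" for r
    by (cases "c r = 0") (auto simp: M_def I_def [symmetric] I intro!: Max_ge, simp add: I_def)
  obtain r where r: "c r \<noteq> 0" "degree (c r) = M"
  proof -
    have "M \<in> (\<lambda>r. degree (c r)) ` I" unfolding M_def by (rule Max_in) (use I in auto)
    then show thesis using that by (auto simp: I_def)
  qed
  have deg1: "degree (monom 1 1 * pderiv p) \<le> M" if "degree p \<le> M" for p :: "complex poly"
  proof (rule degree_le, intro allI impI)
    fix i assume "M < i"
    then show "coeff (monom 1 1 * pderiv p) i = 0"
      using that by (cases i) (simp_all add: coeff_monom_mult coeff_pderiv coeff_eq_0)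
  qed
  have degn: "degree (of_nat n * p) \<le> M" if "degree p \<le> M" for n and p :: "complex poly"
    using degree_mult_le [of "of_nat n" p] that by simp
  \<comment> \<open>A nonzero difference \<open>y\<close> would give a product of degree at least
    \<open>M + 2\<close>, while all other terms of the equation at \<open>r\<close> have degree at
    most \<open>M\<close>.\<close>
  have key: "monom 1 2 * h = monom mu (m + 2) * (2 * of_nat r - of_nat l)"
    if "c r \<noteq> 0" "degree (c r) = M" for r
  proof (rule ccontr)
    assume ne: "\<not> ?thesis"
    define y where "y = h - monom mu m * (2 * of_nat r - of_nat l)"
    have y: "2 * (monom 1 2 * y) * c r = 2 * (monom 1 1 * pderiv (c r))
        - of_nat m * (of_nat l * c r + of_nat l * (if r = 0 then 0 else c (r - 1))
            - (of_nat (r - 1) * (if r = 0 then 0 else c (r - 1)) - of_nat (Suc r) * c (Suc r)))"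
    proof -
      have ring: "2 * (u * (h - v * x)) * w = a - b"
        if "a - b + 2 * (u * v) * (x * w) = 2 * (u * h) * w" for a b u v x w :: "complex poly"
        using that by (simp add: algebra_simps)
      have "monom mu (m + 2) = monom 1 2 * monom mu m" by (simp add: mult_monom add.commute)
      then show ?thesis unfolding y_def by (intro ring) (use eq [of r] in simp)
    qed
    have "y \<noteq> 0"
    proof
      assume "y = 0"
      then have "h = monom mu m * (2 * of_nat r - of_nat l)" by (simp add: y_def)
      then have "monom 1 2 * h = (monom 1 2 * monom mu m) * (2 * of_nat r - of_nat l)"
        by (simp only: mult.assoc)
      with ne show False by (simp add: mult_monom add.commute)
    qed
    then have "degree (2 * (monom 1 2 * y) * c r) = 2 + degree y + M"
      using that by (simp add: degree_mult_eq degree_monom_eq monom_eq_0_iff flip: numeral_poly)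
    moreover have "degree (2 * (monom 1 1 * pderiv (c r))
        - of_nat m * (of_nat l * c r + of_nat l * (if r = 0 then 0 else c (r - 1))
            - (of_nat (r - 1) * (if r = 0 then 0 else c (r - 1)) - of_nat (Suc r) * c (Suc r)))) \<le> M"
    proof -
      have "degree (of_nat 2 * (monom 1 1 * pderiv (c r))) \<le> M" by (intro degn deg1 M)
      then show ?thesis
        by (intro degree_diff_le degree_add_le degn) (use M in auto)
    qed
    ultimately show False unfolding y by linarith
  qed
  have uniq: "coeff (c j) M = 0" if "j \<noteq> r" for j
  proof (rule ccontr)
    assume "coeff (c j) M \<noteq> 0"
    then have "c j \<noteq> 0" "degree (c j) = M" using M [of j] le_degree [of "c j" M] by auto
    have "monom mu (m + 2) * (2 * (of_nat r - of_nat j))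
        = monom mu (m + 2) * (2 * of_nat r - of_nat l) - monom mu (m + 2) * (2 * of_nat j - of_nat l)"
      by (simp only: right_diff_distrib) simp
    also have "\<dots> = 0"
      using key [OF \<open>c j \<noteq> 0\<close> \<open>degree (c j) = M\<close>] key [OF r] by simp
    finally have "monom mu (m + 2) * (2 * (of_nat r - of_nat j)) = 0" .
    then have "(of_nat r :: complex poly) = of_nat j" using mu by (auto simp: monom_eq_0_iff)
    with that show False by (metis of_nat_eq_iff)
  qed
  have lead: "coeff (c r) M \<noteq> 0" using r by auto
  have "coeff (\<Sum>i\<le>l. c i) M = coeff (c r) M"
  proof -
    have "r \<le> l" using fin r(1) not_less by blast
    then show ?thesis
      by (simp add: coeff_sum sum.remove [of "{..l}" r] uniq)
  qed
  moreover have "2 * M = m * l"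
  proof -
    have "2 * (monom 1 1 * pderiv (c r)) - of_nat m * (of_nat l * c r + of_nat l * (if r = 0 then 0 else c (r - 1))
            - (of_nat (r - 1) * (if r = 0 then 0 else c (r - 1)) - of_nat (Suc r) * c (Suc r))) = 0" (is "?L = 0")
    proof -
      have "a = 0" if "a + 2 * u * (x * w) = 2 * (u * x) * w" for a u x w :: "complex poly"
        using that by (simp add: mult.assoc)
      then show ?thesis using eq [of r] unfolding key [OF r] .
    qed
    moreover have "coeff ?L M = (2 * of_nat M - of_nat (m * l)) * coeff (c r) M"
    proof -
      have cT: "coeff (monom 1 1 * pderiv p) M = of_nat M * coeff p M" for p :: "complex poly"
        by (cases M) (simp_all add: coeff_monom_mult coeff_pderiv)
      have c1: "coeff (if r = 0 then 0 else c (r - 1)) M = 0" using uniq [of "r - 1"] by simp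
      have c2: "coeff (c (Suc r)) M = 0" using uniq [of "Suc r"] by simp
      have cn: "coeff (of_nat n * p) M = of_nat n * coeff p M" for n and p :: "complex poly"
        by (simp add: of_nat_poly)
      show ?thesis
        using cn [of 2] by (simp only: coeff_diff coeff_add cn c1 c2 cT of_nat_numeral) (simp add: algebra_simps)
    qed
    ultimately have "2 * of_nat M - of_nat (m * l) = (0::complex)" using lead by simp
    then have "of_nat (2 * M) = (of_nat (m * l) :: complex)" by simp
    then show ?thesis by (metis of_nat_eq_iff)
  qed
  ultimately show ?thesis using lead by auto
qed


lemma sum_contiguous_weights:
  fixes b :: "nat \<Rightarrow> 'a::comm_ring_1 poly" and f :: "nat \<Rightarrow> 'a poly poly"
  assumes "b (Suc l) = 0"
  shows "(\<Sum>j\<le>l. smult (b j) (of_nat j * f (j - 1) + of_nat (l - j) * f (j + 1)))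
    = (\<Sum>i\<le>l. smult (of_nat (Suc i) * b (Suc i) + (if i = 0 then 0 else of_nat (l - (i - 1)) * b (i - 1))) (f i))"
proof -
  have "(\<Sum>j\<le>l. smult (of_nat j * b j) (f (j - 1))) = (\<Sum>j\<le>Suc l. smult (of_nat j * b j) (f (j - 1)))"
    by (simp add: assms)
  also have "\<dots> = (\<Sum>i\<le>l. smult (of_nat (Suc i) * b (Suc i)) (f i))"
    by (subst sum.atMost_Suc_shift) simp
  finally have 1: "(\<Sum>j\<le>l. smult (of_nat j * b j) (f (j - 1))) = (\<Sum>i\<le>l. smult (of_nat (Suc i) * b (Suc i)) (f i))" .
  have 2: "(\<Sum>j\<le>l. smult (of_nat (l - j) * b j) (f (j + 1)))
      = (\<Sum>i\<le>l. smult (if i = 0 then 0 else of_nat (l - (i - 1)) * b (i - 1)) (f i))"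
  proof (cases l)
    case (Suc k)
    show ?thesis unfolding Suc
      by (subst sum.atMost_Suc, subst sum.atMost_Suc_shift) simp
  qed simp
  show ?thesis
    unfolding smult_add_left sum.distrib 1 [symmetric] 2 [symmetric]
    by (simp add: smult_add_right sum.distrib of_nat_poly mult.commute)
qed

lemma of_nat_mult_poly_poly: "of_nat n * (p :: 'a::comm_ring_1 poly poly) = smult (of_nat n) p"
  by (simp add: of_nat_poly)

lemma smult_sum_right: "smult c (sum f A) = (\<Sum>x\<in>A. smult c (f x))"
  by (induction A rule: infinite_finite_induct) (simp_all add: smult_add_right)

text \<open>
  Leading weights at infinity, for \<open>t\<close> of weight 1 and \<open>z\<close> of weight \<open>m / 2\<close>: with \<open>t = \<tau>\<^sup>2\<close> and
  \<open>z = \<mu> \<tau>\<^sup>m (w + 1) / (w - 1)\<close>, \<open>\<mu>\<^sup>2 = - \<lambda>\<close>, the dominant part of the equation becomes diagonal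
  in the powers of \<open>w\<close>.
\<close>
lemma riccati_darboux_const:
  assumes dvd: "Q dvd riccati lam m Q" and Q: "Q \<noteq> 0" and lam: "lam \<noteq> 0" and m: "m \<ge> 1"
  shows "\<exists>c. c \<noteq> 0 \<and> Q = [:[:c:]:]"
proof -
  define l where "l = degree Q"
  define a where "a = coeff Q"
  obtain g where g: "riccati lam m Q = g * Q" using dvd by (metis dvdE mult.commute)
  have al: "a l \<noteq> 0" using Q by (simp add: a_def l_def)
  have a0: "a j = 0" if "j > l" for j using that by (simp add: a_def l_def coeff_eq_0)
  have "degree g \<le> 1"
  proof (cases "g = 0")
    case False
    have "degree (riccati lam m Q) \<le> Suc l"
    proof (rule degree_le, intro allI impI)
      fix i assume "Suc l < i"
      then show "coeff (riccati lam m Q) i = 0"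
        using a0 by (cases i) (auto simp: coeff_riccati_Suc a_def)
    qed
    then show ?thesis using False Q by (simp add: g degree_mult_eq l_def)
  qed simp
  then obtain g0 g1 where g01: "g = [:g0, g1:]"
    by (metis degree_eq_zeroE degree_pCons_eq_if le_zero_eq pCons_cases pCons_0_0 Suc_le_mono One_nat_def)
  have coeffS: "coeff (g * Q) (Suc j) = g0 * a (Suc j) + g1 * a j" for j
    by (simp add: g01 a_def)
  have "coeff (riccati lam m Q) (Suc l) = g1 * a l"
    by (simp only: g coeffS) (simp add: a0)
  \<comment> \<open>Top coefficient in z: the term - z^2 d/dz sends a z^l to - l a z^(l + 1), so the
    cofactor is g0 - l z.\<close>
  then have "(g1 + of_nat l) * a l = 0"
    using a0 [of "Suc l"] a0 [of "l + 2"] by (simp add: coeff_riccati_Suc a_def [symmetric] algebra_simps)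
  then have g1: "g1 = - of_nat l" using al by (simp add: eq_neg_iff_add_eq_0)
  have rec: "pderiv (a (Suc j)) - monom lam m * (of_nat (j + 2) * a (j + 2)) - of_nat j * a j
      = g0 * a (Suc j) - of_nat l * a j" for j
    using coeff_riccati_Suc [of lam m Q j] coeffS [of j] by (simp add: g g1 a_def [symmetric])
  have rec0: "pderiv (a 0) - monom lam m * a 1 = g0 * a 0"
    using coeff_riccati_0 [of lam m Q] by (simp add: g g01 a_def [symmetric])
  have "l = 0"
  proof -
    obtain mu where mu2: "mu\<^sup>2 = - lam" by (metis power2_csqrt)
    then have mu: "mu \<noteq> 0" using lam by auto
    \<comment> \<open>\<open>s\<close> substitutes t = \<tau>^2, so that z of weight m / 2 gets an
      integral exponent. \<open>b j\<close> is then the coefficient of ((w + 1) / (w - 1))^j, and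
      \<open>T * pderiv\<close> is \<tau> d/d\<tau>, twice t d/dt.\<close>
    define s where "s p = pcompose p (monom 1 2)" for p :: "complex poly"
    define b where "b j = s (a j) * monom (mu ^ j) (m * j)" for j
    define N where "N = monom mu (m + 2)"
    define H where "H = s g0"
    define T where "T = monom (1::complex) 1"
    have s_add: "s (p + q) = s p + s q" and s_mult: "s (p * q) = s p * s q"
      and s_diff: "s (p - q) = s p - s q" for p q
      by (simp_all add: s_def pcompose_add pcompose_mult pcompose_diff)
    have s_nat: "s (of_nat n) = of_nat n" for n
      by (simp add: s_def of_nat_poly pcompose_const)
    have s_monom: "s (monom c n) = monom c (2 * n)" for c n
      by (induction n) (simp_all add: s_def monom_Suc pcompose_pCons mult_monom monom_0 pcompose_const
          flip: monom_Suc, simp add: monom_Suc pcompose_pCons mult_monom)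
    have theta: "T * pderiv (b j) = 2 * (monom 1 2 * (s (pderiv (a j)) * monom (mu ^ j) (m * j)))
        + of_nat (m * j) * b j" for j
    proof -
      have 1: "pderiv (s p) * T = 2 * (monom 1 2 * s (pderiv p))" for p
        by (simp add: s_def pderiv_pcompose pderiv_monom T_def mult_monom mult.assoc)
          (simp add: numeral_poly smult_monom numeral_2_eq_2)
      have 2: "T * pderiv (monom c n) = of_nat n * monom c n" for c n
        by (cases n) (simp_all add: T_def pderiv_monom mult_monom of_nat_poly smult_monom)
      have "T * pderiv (b j) = (pderiv (s (a j)) * T) * monom (mu ^ j) (m * j) + s (a j) * (T * pderiv (monom (mu ^ j) (m * j)))"
        by (simp add: b_def pderiv_mult algebra_simps)
      then show ?thesis unfolding 1 2 by (simp add: b_def algebra_simps)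
    qed
    have brec: "T * pderiv (b i) - of_nat (m * i) * b i
        + 2 * N * (of_nat (Suc i) * b (Suc i) + (if i = 0 then 0 else of_nat (l - (i - 1)) * b (i - 1)))
        = 2 * (monom 1 2 * H) * b i" if "i \<le> l" for i
    proof (cases i)
      case 0
      have "s (pderiv (a 0)) - monom lam (2 * m) * s (a 1) = H * s (a 0)"
        using arg_cong [OF rec0, of s] by (simp add: s_diff s_mult s_monom H_def)
      then have e: "s (pderiv (a 0)) = H * s (a 0) + monom lam (2 * m) * s (a 1)"
        by (simp add: algebra_simps)
      have "N * b 1 = - (monom 1 2 * (monom lam (2 * m) * s (a 1)))"
      proof -
        have "monom mu (m + 2) * monom mu m = - (monom 1 2 * monom lam (2 * m))"
          using mu2 by (simp add: mult_monom minus_monom power2_eq_square mult_2 add.commute add.left_commute)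
        then have "(monom mu (m + 2) * monom mu m) * s (a 1) = - (monom 1 2 * monom lam (2 * m)) * s (a 1)"
          by (rule arg_cong)
        moreover have "b 1 = s (a 1) * monom mu m" by (simp add: b_def)
        ultimately show ?thesis by (simp only: N_def mult_minus_left mult_minus_right mult_ac)
      qed
      note nb1 = this
      have "T * pderiv (b 0) = 2 * (monom 1 2 * s (pderiv (a 0)))" unfolding theta by simp
      also have "\<dots> = 2 * (monom 1 2 * H) * b 0 - 2 * (N * b 1)"
        unfolding e nb1 by (simp add: b_def algebra_simps)
      finally show ?thesis by (simp add: 0 algebra_simps)
    next
      case (Suc j)
      have e0: "s (pderiv (a (Suc j))) - monom lam (2 * m) * (of_nat (j + 2) * s (a (j + 2))) - of_nat j * s (a j)
          = H * s (a (Suc j)) - of_nat l * s (a j)"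
        using arg_cong [OF rec [of j], of s] by (simp only: s_diff s_mult s_monom s_nat H_def)
      have ring2: "x = w + y - (n - k) * z" if "x - y - k * z = w - n * z"
        for x y z w n k :: "complex poly"
        using that by (simp add: algebra_simps)
      have lj: "of_nat (l - j) = (of_nat l - of_nat j :: complex poly)"
        using that Suc by (simp add: of_nat_diff)
      have e: "s (pderiv (a (Suc j))) = H * s (a (Suc j))
          + monom lam (2 * m) * (of_nat (j + 2) * s (a (j + 2))) - of_nat (l - j) * s (a j)"
        unfolding lj by (rule ring2) (rule e0)
      define u where "u = monom (1::complex) 2"
      define v where "v = monom (mu ^ Suc j) (m * Suc j)"
      have 1: "N * b (j + 2) = - (u * (monom lam (2 * m) * (s (a (j + 2)) * v)))"
      proof -
        have "monom mu (m + 2) * monom (mu ^ (j + 2)) (m * (j + 2)) = - (u * monom lam (2 * m) * v)"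
        proof -
          have c: "mu * mu ^ (j + 2) = - (1 * lam * mu ^ Suc j)"
          proof -
            have "mu * mu ^ (j + 2) = mu\<^sup>2 * mu ^ Suc j" by (simp add: power2_eq_square)
            then show ?thesis by (simp add: mu2)
          qed
          have n: "m + 2 + m * (j + 2) = 2 + 2 * m + m * Suc j" by simp
          show ?thesis unfolding u_def v_def mult_monom c n by (simp only: minus_monom)
        qed
        then have "(monom mu (m + 2) * monom (mu ^ (j + 2)) (m * (j + 2))) * s (a (j + 2))
            = - (u * monom lam (2 * m) * v) * s (a (j + 2))"
          by (rule arg_cong)
        moreover have "b (j + 2) = s (a (j + 2)) * monom (mu ^ (j + 2)) (m * (j + 2))" by (simp add: b_def)
        ultimately show ?thesis by (simp only: N_def mult_minus_left mult_minus_right mult_ac)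
      qed
      have 2: "N * b j = u * (s (a j) * v)"
      proof -
        have "monom mu (m + 2) * monom (mu ^ j) (m * j) = u * v"
          by (simp add: u_def v_def mult_monom)
        then have "s (a j) * (monom mu (m + 2) * monom (mu ^ j) (m * j)) = s (a j) * (u * v)"
          by (rule arg_cong)
        then show ?thesis by (simp only: N_def b_def mult_ac)
      qed
      have "T * pderiv (b i) - of_nat (m * i) * b i = 2 * (u * (s (pderiv (a (Suc j))) * v))"
        unfolding Suc theta by (simp add: u_def v_def)
      also have "\<dots> = 2 * (u * H) * b i - 2 * (of_nat (j + 2) * (N * b (j + 2))) - 2 * (of_nat (l - j) * (N * b j))"
      proof -
        have "2 * (u * ((h * w + y - n * z) * x)) = 2 * (u * h) * (w * x) - 2 * (- (u * (y * x))) - 2 * (n * (u * (z * x)))"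
          for h w y n z x :: "complex poly"
          by (simp add: algebra_simps)
        from this [of H "s (a (Suc j))" _ _ _ v]
        show ?thesis
          unfolding e 1 2 Suc b_def [of "Suc j"] v_def [symmetric]
          by (simp add: algebra_simps)
      qed
      finally have 3: "T * pderiv (b i) - of_nat (m * i) * b i
        = 2 * (u * H) * b i - 2 * (of_nat (j + 2) * (N * b (j + 2))) - 2 * (of_nat (l - j) * (N * b j))" .
      have "x - 2 * (n * (N * y)) - 2 * (k * (N * z)) + 2 * N * (n * y + k * z) = x"
        for x n y k z :: "complex poly" by (simp add: algebra_simps)
      then show ?thesis unfolding 3 by (simp add: Suc u_def del: of_nat_Suc of_nat_add)
    qed
    define f where "f j = ([:1, 1:] ^ j * [:- 1, 1:] ^ (l - j) :: complex poly poly)" for j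
    \<comment> \<open>\<open>p\<close> is (w - 1)^l times the transformed Q; its coefficients with
      respect to w are the ones to which the asymptotic argument applies.\<close>
    define p where "p = (\<Sum>j\<le>l. smult (b j) (f j))"
    define Th where "Th = map_poly (\<lambda>x. T * pderiv x)"
    interpret pd: derivation "pderiv :: complex poly \<Rightarrow> _" by (rule derivation_pderiv)
    interpret T: derivation "\<lambda>x. T * pderiv x" by (rule pd.mult_right)
    interpret Th: derivation Th unfolding Th_def by (rule T.map_poly)
    have Thf: "Th (f j) = 0" for j
    proof -
      have "Th [:1, 1:] = 0" "Th [:- 1, 1:] = 0"
        by (simp_all add: Th_def map_poly_pCons pderiv_minus)
      then show ?thesis by (simp add: f_def Th.mult Th.power_const)
    qed
    have Thp: "Th p = (\<Sum>j\<le>l. smult (T * pderiv (b j)) (f j))"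
      by (simp add: p_def Th.sum, rule sum.cong) (simp_all add: Th_def T.map_poly_smult Thf [unfolded Th_def])
    have pdp: "pderiv p = (\<Sum>j\<le>l. smult (b j) (pderiv (f j)))"
      by (simp add: p_def derivation.sum [OF derivation_pderiv] pderiv_smult)
    have A: "smult (of_nat m) ([:of_nat l, of_nat l:] * p - [:- 1, 0, 1:] * pderiv p)
        = (\<Sum>j\<le>l. smult (2 * (of_nat (m * j) * b j)) (f j))"
    proof -
      have "[:of_nat l, of_nat l:] * p - [:- 1, 0, 1:] * pderiv p
          = (\<Sum>j\<le>l. smult (b j) ([:of_nat l, of_nat l:] * f j - [:- 1, 0, 1:] * pderiv (f j)))"
        unfolding p_def pdp [unfolded p_def] sum_distrib_left sum_subtractf [symmetric]
        by (rule sum.cong) (simp_all only: mult_smult_right smult_diff_right)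
      also have "\<dots> = (\<Sum>j\<le>l. smult (b j) (of_nat (2 * j) * f j))"
        by (rule sum.cong) (simp_all only: f_def binomial_pair_identities atMost_iff)
      finally show ?thesis
        by (simp only: smult_sum_right of_nat_mult_poly_poly smult_smult) (simp add: algebra_simps)
    qed
    have bS: "b (Suc l) = 0" by (simp add: b_def s_def a0)
    have B: "[:0, 2:] * pderiv p - of_nat l * p
        = (\<Sum>i\<le>l. smult (of_nat (Suc i) * b (Suc i) + (if i = 0 then 0 else of_nat (l - (i - 1)) * b (i - 1))) (f i))"
    proof -
      have "[:0, 2:] * pderiv p - of_nat l * p
          = (\<Sum>j\<le>l. smult (b j) ([:0, 2:] * pderiv (f j) - of_nat l * f j))"
        unfolding p_def pdp [unfolded p_def] sum_distrib_left sum_subtractf [symmetric]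
        by (rule sum.cong) (simp_all only: mult_smult_right smult_diff_right)
      also have "\<dots> = (\<Sum>j\<le>l. smult (b j) (of_nat j * f (j - 1) + of_nat (l - j) * f (j + 1)))"
        by (rule sum.cong) (simp_all only: f_def binomial_pair_identities atMost_iff)
      finally show ?thesis by (simp only: sum_contiguous_weights [of b l f, OF bS])
    qed
    have E: "smult 2 (Th p) - smult (of_nat m) ([:of_nat l, of_nat l:] * p - [:- 1, 0, 1:] * pderiv p)
        + smult (2 * (2 * N)) ([:0, 2:] * pderiv p - of_nat l * p) = smult (2 * (2 * (monom 1 2 * H))) p"
    proof -
      have "smult (2 * (2 * (monom 1 2 * H))) p
          = (\<Sum>j\<le>l. smult (2 * (2 * (monom 1 2 * H)) * b j) (f j))"
        by (simp only: p_def smult_sum_right smult_smult)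
      also have "\<dots> = (\<Sum>i\<le>l. smult (2 * (T * pderiv (b i)) - 2 * (of_nat (m * i) * b i)
          + 2 * (2 * N) * (of_nat (Suc i) * b (Suc i) + (if i = 0 then 0 else of_nat (l - (i - 1)) * b (i - 1)))) (f i))"
      proof (rule sum.cong)
        fix i assume "i \<in> {..l}"
        have "2 * (2 * u) * w = 2 * x - 2 * y + 2 * (2 * N) * z" if "x - y + 2 * N * z = 2 * u * w"
          for u w x y z :: "complex poly"
          using arg_cong [OF that, of "\<lambda>x. 2 * x"] by (simp add: algebra_simps)
        from this [OF brec]
        show "smult (2 * (2 * (monom 1 2 * H)) * b i) (f i) = smult (2 * (T * pderiv (b i)) - 2 * (of_nat (m * i) * b i)
          + 2 * (2 * N) * (of_nat (Suc i) * b (Suc i) + (if i = 0 then 0 else of_nat (l - (i - 1)) * b (i - 1)))) (f i)"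
          using \<open>i \<in> {..l}\<close> by (simp only: atMost_iff)
      qed simp
      finally show ?thesis
        unfolding Thp A B smult_sum_right smult_smult
        by (simp only: smult_add_left smult_diff_left sum.distrib sum_subtractf)
    qed
    have degp: "degree p \<le> l" unfolding p_def
    proof (rule degree_sum_le)
      fix j assume "j \<in> {..l}"
      then have "degree (f j) \<le> j + (l - j)" unfolding f_def
        by (intro order_trans [OF degree_mult_le] add_mono order_trans [OF degree_power_le]) auto
      then show "degree (smult (b j) (f j)) \<le> l"
        using \<open>j \<in> {..l}\<close> degree_smult_le [of "b j" "f j"] by simp
    qed simp
    \<comment> \<open>At w = 1 only \<open>f l\<close> survives, so the coefficients of
      \<open>p\<close> add up to \<open>b l * 2 ^ l\<close>, a multiple of \<tau>^(m l).\<close>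
    have "poly p 1 = (\<Sum>j\<le>l. b j * (2 ^ j * 0 ^ (l - j)))"
      by (simp add: p_def f_def poly_sum)
    also have "\<dots> = (\<Sum>j\<le>l. if j = l then b j * 2 ^ j else 0)"
      by (rule sum.cong) auto
    also have "\<dots> = b l * 2 ^ l" by simp
    finally have p1: "poly p 1 = b l * 2 ^ l" .
    have "poly p 1 = (\<Sum>i\<le>degree p. coeff p i)" by (simp add: poly_altdef)
    also have "\<dots> = (\<Sum>i\<le>l. coeff p i)"
      using degp by (intro sum.mono_neutral_left) (auto simp: coeff_eq_0)
    finally have sumc: "(\<Sum>i\<le>l. coeff p i) = b l * 2 ^ l" using p1 by simp
    have "s (a l) \<noteq> 0" using al by (simp add: s_def pcompose_eq_0_iff degree_monom_eq)
    then have "b l * 2 ^ l \<noteq> 0" using mu by (simp add: b_def monom_eq_0_iff)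
    then obtain r0 where r0: "coeff p r0 \<noteq> 0" using sumc by (metis sum.neutral)
    have "\<exists>M. 2 * M = m * l \<and> coeff (\<Sum>i\<le>l. coeff p i) M \<noteq> 0"
    proof (rule poly_asymptotic_exponent)
      show "coeff p r = 0" if "l < r" for r using that degp by (simp add: coeff_eq_0)
      show "coeff p r0 \<noteq> 0" by (rule r0)
      show "2 * mu \<noteq> 0" using mu by simp
      fix r
      have 1: "coeff ([:of_nat l, of_nat l:] * p) r
          = of_nat l * coeff p r + of_nat l * (if r = 0 then 0 else coeff p (r - 1))"
        by (cases r) simp_all
      have 2: "coeff ([:0, 2:] * pderiv p) r = 2 * of_nat r * coeff p r"
        by (cases r) (simp_all add: coeff_pderiv)
      have 3: "coeff (of_nat l * p) r = of_nat l * coeff p r"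
        by (simp add: of_nat_mult_poly_poly)
      have 4: "coeff (Th p) r = T * pderiv (coeff p r)"
        by (simp add: Th_def coeff_map_poly)
      have 5: "monom (2 * mu) (m + 2) = 2 * N"
        by (simp add: N_def numeral_poly smult_monom)
      have "2 * (T * pderiv (coeff p r)) - of_nat m * (of_nat l * coeff p r + of_nat l * (if r = 0 then 0 else coeff p (r - 1))
            - (of_nat (r - 1) * (if r = 0 then 0 else coeff p (r - 1)) - of_nat (Suc r) * coeff p (Suc r)))
          + 2 * (2 * N) * (2 * of_nat r * coeff p r - of_nat l * coeff p r) = 2 * (2 * (monom 1 2 * H)) * coeff p r"
        using arg_cong [OF E, of "\<lambda>q. coeff q r"]
        by (simp only: coeff_add coeff_diff coeff_smult 1 2 3 4 coeff_pCons_mult_pderiv)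
      then show "2 * (monom 1 1 * pderiv (coeff p r)) - of_nat m * (of_nat l * coeff p r + of_nat l * (if r = 0 then 0 else coeff p (r - 1))
            - (of_nat (r - 1) * (if r = 0 then 0 else coeff p (r - 1)) - of_nat (Suc r) * coeff p (Suc r)))
          + 2 * monom (2 * mu) (m + 2) * ((2 * of_nat r - of_nat l) * coeff p r)
          = 2 * (monom 1 2 * (2 * H)) * coeff p r"
        unfolding 5 T_def left_diff_distrib by (simp only: mult_ac)
    qed
    then obtain M where M: "2 * M = m * l" "coeff (b l * 2 ^ l) M \<noteq> 0"
      unfolding sumc by blast
    have "b l * 2 ^ l = monom (mu ^ l) (m * l) * (s (a l) * 2 ^ l)"
      by (simp only: b_def mult_ac)
    \<comment> \<open>The power m l / 2 occurs in a multiple of \<tau>^(m l); this is possible only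
      for m l = 0.\<close>
    then have "m * l \<le> M" using M(2) by (metis coeff_monom_mult not_less)
    then have "m * l = 0" using M(1) by linarith
    then show ?thesis using m by simp
  qed
  then have Qa: "Q = [:a 0:]" by (metis a_def degree_0_id l_def)
  have "a 1 = 0" using a0 [of 1] \<open>l = 0\<close> by simp
  then have pa: "pderiv (a 0) = g0 * a 0" using rec0 by simp
  have "a 0 \<noteq> 0" using al \<open>l = 0\<close> by simp
  have "degree (a 0) = 0"
  proof (rule ccontr)
    assume d: "degree (a 0) \<noteq> 0"
    then have "pderiv (a 0) \<noteq> 0" by (simp add: pderiv_eq_0_iff)
    then have "g0 \<noteq> 0" using pa by auto
    then have "degree (pderiv (a 0)) \<ge> degree (a 0)"
      using \<open>a 0 \<noteq> 0\<close> by (simp add: pa degree_mult_eq)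
    then show False using d by (simp add: degree_pderiv)
  qed
  then obtain c where "a 0 = [:c:]" by (metis degree_eq_zeroE)
  then show ?thesis using Qa Q by auto
qed

section \<open>Rational invariants of the Riccati equation\<close>

lemma (in derivation) wronskian_cancel:
  "(h * q) * d (h * p) - (h * p) * d (h * q) = h\<^sup>2 * (q * d p - p * d q)"
  by (simp add: mult algebra_simps power2_eq_square)

text \<open>The hypothesis says that P / Q has derivative X / Q, without the double pole expected
  along Q = 0. With P and Q coprime this forces Q to divide its own derivative, so Q is a Darboux
  polynomial.\<close>

lemma riccati_coprime_const:
  assumes eq: "Q * riccati lam m P - P * riccati lam m Q = Q * X"
    and "coprime P Q" "Q \<noteq> 0" "lam \<noteq> 0" "m \<ge> 1"
  shows "\<exists>c. c \<noteq> 0 \<and> Q = [:[:c:]:]"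
proof (rule riccati_darboux_const)
  have "P * riccati lam m Q = Q * (riccati lam m P - X)"
    using eq by (simp add: algebra_simps)
  then have "Q dvd P * riccati lam m Q" by simp
  then show "Q dvd riccati lam m Q"
    using \<open>coprime P Q\<close> by (simp add: coprime_dvd_mult_right_iff coprime_commute)
qed fact+

text \<open>Since x' = z x, the equation says that x^e P / Q is invariant. In lowest terms numerator
  and denominator are both Darboux polynomials, hence constants, and nothing is left to balance the
  term with \<open>e\<close>.\<close>

lemma riccati_invariant_const:
  assumes eq: "Q * riccati lam m P - P * riccati lam m Q + of_int e * ([:0, 1:] * P * Q) = 0"
    and P: "P \<noteq> 0" and Q: "Q \<noteq> 0" and lam: "lam \<noteq> 0" and m: "m \<ge> 1"
  shows "e = 0 \<and> (\<exists>c. c \<noteq> 0 \<and> P = [:[:c:]:] * Q)"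
proof -
  interpret D: derivation "riccati lam m" by (rule derivation_riccati)
  define h where "h = gcd P Q"
  have h: "h \<noteq> 0" using P by (simp add: h_def)
  then obtain p q where "P = p * h" "Q = q * h" and cop: "coprime p q"
    using gcd_coprime_exists [of P Q] unfolding h_def by blast
  then have pq: "P = h * p" "Q = h * q" by simp_all
  then have p: "p \<noteq> 0" and q: "q \<noteq> 0" using P Q by auto
  have "h\<^sup>2 * (q * riccati lam m p - p * riccati lam m q + of_int e * ([:0, 1:] * p * q)) = 0"
  proof -
    have "h\<^sup>2 * x + k * (w * (h * p) * (h * q)) = h\<^sup>2 * (x + k * (w * p * q))" for x k w
      by (simp add: algebra_simps power2_eq_square)
    then show ?thesis using eq unfolding pq D.wronskian_cancel by metis
  qed
  then have r: "q * riccati lam m p - p * riccati lam m q + of_int e * ([:0, 1:] * p * q) = 0"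
    using h by simp
  have "q * riccati lam m p - p * riccati lam m q = q * (- of_int e * ([:0, 1:] * p))"
    
  proof -
    have "x - y = q * (- k * (w * p))" if "x - y + k * (w * p * q) = 0" for x y k w
      using that by (simp add: algebra_simps add_eq_0_iff)
    then show ?thesis using r by blast
  qed
  from riccati_coprime_const [OF this cop q lam m] obtain c where c: "c \<noteq> 0" "q = [:[:c:]:]" by blast
  have "p * riccati lam m q - q * riccati lam m p = p * (of_int e * ([:0, 1:] * q))"
    
  proof -
    have "y - x = p * (k * (w * q))" if "x - y + k * (w * p * q) = 0" for x y k w
      using that by (simp add: algebra_simps add_eq_0_iff)
    then show ?thesis using r by blast
  qed
  from riccati_coprime_const [OF this _ p lam m] obtain c' where c': "c' \<noteq> 0" "p = [:[:c':]:]"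
    using cop coprime_commute by blast
  have "riccati lam m p = 0" "riccati lam m q = 0" unfolding c c' by (rule riccati_const)+
  then have "of_int e * ([:0, 1:] * p * q) = 0" using r by simp
  then have "(of_int e :: complex poly poly) = 0" using p q by simp
  then have "e = 0" by simp
  moreover have "P = [:[:c' / c:]:] * Q" using c(1) by (simp add: pq c(2) c'(2))
  ultimately show ?thesis using c(1) c'(1) by (metis divide_eq_0_iff)
qed

text \<open>
  The hypotheses say that \<open>a / g\<close> and \<open>b / g\<close>, multiplied by \<open>x\<^sup>e\<close>, are the components of an invariant
  covector; \<open>a + z b\<close> is its pairing with the Euler field.
\<close>
lemma riccati_invariant_covector:
  fixes a b g :: "complex poly poly"
  assumes e1: "g * riccati lam m b - b * riccati lam m g + of_int e * ([:0, 1:] * b * g) = - (a * g)"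
    and e2: "g * riccati lam m a - a * riccati lam m g + of_int e * ([:0, 1:] * a * g) = [:monom lam m:] * b * g"
    and g: "g \<noteq> 0" and ab: "a \<noteq> 0 \<or> b \<noteq> 0" and lam: "lam \<noteq> 0" and m: "m \<ge> 1"
  shows "e = 1 \<and> a = - ([:0, 1:] * b) \<and> (\<exists>c. c \<noteq> 0 \<and> b = [:[:c:]:] * g)"
proof -
  interpret D: derivation "riccati lam m" by (rule derivation_riccati)
  define z where "z = ([:0, 1:] :: complex poly poly)"
  define L where "L = [:monom lam m:]"
  define D where "D = riccati lam m"
  have Dz: "D z = - (L + z * z)"
    by (simp add: D_def riccati_def z_def L_def map_poly_pCons pderiv_pCons)
  have D_add: "D (x + y) = D x + D y" and D_mult: "D (x * y) = D x * y + x * D y" for x y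
    by (simp_all add: D_def D.add D.mult)
  \<comment> \<open>The Euler field commutes with a linear flow, so its pairing with an invariant
    covector is an invariant scalar, here of weight \<open>e + 1\<close>.\<close>
  define B where "B = a + z * b"
  have B: "g * D B - B * D g + of_int (e + 1) * (z * B * g) = 0"
  proof -
    have "g * D B - B * D g + of_int (e + 1) * (z * B * g)
      = (g * D a - a * D g + of_int e * (z * a * g)) + z * (g * D b - b * D g + of_int e * (z * b * g))
        + g * b * D z + z * (a + z * b) * g"
      by (simp add: B_def D_add D_mult algebra_simps)
    also have "\<dots> = 0"
      unfolding e1 [folded D_def z_def] e2 [folded D_def z_def L_def] Dz by (simp add: B_def algebra_simps)
    finally show ?thesis .
  qed
  have B0: "B = 0"
  proof (rule ccontr)
    assume "B \<noteq> 0"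
    note inv = riccati_invariant_const [OF B [unfolded D_def z_def] this g lam m]
    then have e: "e = - 1" by linarith
    obtain c where c: "c \<noteq> 0" and Bc: "B = [:[:c:]:] * g" using inv by blast
    define k where "k = [:[:c:]:]"
    have k: "k \<noteq> 0" using c by (simp add: k_def)
    have a: "a = k * g - z * b" using Bc by (simp add: B_def k_def algebra_simps)
    \<comment> \<open>With e = - 1 and B = k g, the quotient b / g satisfies the inhomogeneous
      equation D (b / g) = 2 z b / g - k; its denominator is again a Darboux polynomial.\<close>
    have w: "g * D b - b * D g = 2 * z * b * g - k * g * g"
    proof -
      have "x = 2 * z * b * g - k * g * g" if "x + of_int (- 1) * (z * b * g) = - ((k * g - z * b) * g)" for x
        using that by (simp add: algebra_simps)
      then show ?thesis using e1 unfolding D_def [symmetric] z_def [symmetric] e a by blast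
    qed
    have "b \<noteq> 0"
    proof
      assume b: "b = 0"
      then have "k * g * g = 0" using w by (simp add: D_def)
      then show False using k g by simp
    qed
    define h where "h = gcd b g"
    have h: "h \<noteq> 0" using g by (simp add: h_def)
    then obtain b' g' where "b = b' * h" "g = g' * h" and cop: "coprime b' g'"
      using gcd_coprime_exists [of b g] unfolding h_def by blast
    then have bg: "b = h * b'" "g = h * g'" by simp_all
    then have b': "b' \<noteq> 0" and g': "g' \<noteq> 0" using \<open>b \<noteq> 0\<close> g by auto
    have "h\<^sup>2 * (g' * D b' - b' * D g') = h\<^sup>2 * (g' * (2 * z * b' - k * g'))"
    proof -
      have "2 * z * (h * b') * (h * g') - k * (h * g') * (h * g') = h\<^sup>2 * (g' * (2 * z * b' - k * g'))"
        by (simp add: algebra_simps power2_eq_square)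
      then show ?thesis using w [unfolded D_def] unfolding bg D_def D.wronskian_cancel by (simp only:)
    qed
    then have w': "g' * D b' - b' * D g' = g' * (2 * z * b' - k * g')" using h by simp
    from riccati_coprime_const [OF w' [unfolded D_def] cop g' lam m]
    obtain c' where c': "c' \<noteq> 0" "g' = [:[:c':]:]" by blast
    have "D g' = 0" unfolding c' D_def by (rule riccati_const)
    then have "g' * D b' = g' * (2 * z * b' - k * g')" using w' by simp
    then have "D b' = 2 * z * b' - k * g'" using g' by simp
    \<comment> \<open>Compare the coefficients of z^(N + 1), N the degree of \<open>b'\<close>: the
      derivation yields - N times the leading coefficient and the right-hand side 2 times it, so N +
      2 would vanish.\<close>
    then have "coeff (D b') (Suc (degree b')) = coeff (2 * z * b' - k * g') (Suc (degree b'))" by simp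
    moreover have "coeff (D b') (Suc (degree b')) = - of_nat (degree b') * coeff b' (degree b')"
      by (simp add: D_def coeff_riccati_Suc coeff_eq_0)
    moreover have "coeff (2 * z * b' - k * g') (Suc (degree b')) = 2 * coeff b' (degree b')"
      by (simp add: z_def k_def c' numeral_poly)
    ultimately have "- of_nat (degree b') * lead_coeff b' = 2 * lead_coeff b'" by (simp only:)
    then have "(of_nat (degree b') + 2) * lead_coeff b' = 0"
      unfolding distrib_right by (metis add.commute add.right_inverse mult_minus_left)
    moreover have "of_nat (degree b') + 2 = (of_nat (degree b' + 2) :: complex poly)" by simp
    moreover have "(of_nat (degree b' + 2) :: complex poly) \<noteq> 0" by (simp only: of_nat_eq_0_iff)
    ultimately show False using b' by (metis leading_coeff_0_iff mult_eq_0_iff)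
  qed
  then have a: "a = - (z * b)" unfolding B_def by (rule eq_neg_iff_add_eq_0 [THEN iffD2])
  then have b: "b \<noteq> 0" using ab by auto
  have "g * D b - b * D g + of_int (e - 1) * (z * b * g) = 0"
  proof -
    have "x + of_int (e - 1) * (z * b * g) = 0" if "x + of_int e * (z * b * g) = - (- (z * b) * g)" for x
      using that by (simp add: algebra_simps)
    then show ?thesis using e1 unfolding D_def [symmetric] z_def [symmetric] a by blast
  qed
  note inv = riccati_invariant_const [OF this [unfolded D_def z_def] b g lam m]
  then have "e = 1" by linarith
  then show ?thesis using inv a unfolding z_def by blast
qed

section \<open>Polynomial functions and their expansions\<close>

text \<open>Polynomials as functions: this fits the analytic \<open>partial\<close>, allows
  identities to be checked at points and extended by density, and provides an induction that avoids
  monomials.\<close>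

inductive polyfun :: "(complex ^ 'v::finite \<Rightarrow> complex) \<Rightarrow> bool" where
  polyfun_const [intro]: "polyfun (\<lambda>x. c)"
| polyfun_coord [intro]: "polyfun (\<lambda>x. x $ v)"
| polyfun_add [intro]: "polyfun f \<Longrightarrow> polyfun g \<Longrightarrow> polyfun (\<lambda>x. f x + g x)"
| polyfun_mult [intro]: "polyfun f \<Longrightarrow> polyfun g \<Longrightarrow> polyfun (\<lambda>x. f x * g x)"

lemma polyfun_cmult [intro]: "polyfun f \<Longrightarrow> polyfun (\<lambda>x. c * f x)"
  by (intro polyfun_mult polyfun_const)

lemma polyfun_uminus [intro]: "polyfun f \<Longrightarrow> polyfun (\<lambda>x. - f x)"
  using polyfun_cmult [of f "- 1"] by simp

lemma polyfun_diff [intro]: "polyfun f \<Longrightarrow> polyfun g \<Longrightarrow> polyfun (\<lambda>x. f x - g x)"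
  using polyfun_add [of f "\<lambda>x. - g x"] by (simp add: polyfun_uminus)

lemma polyfun_sum [intro]: "(\<And>i. i \<in> A \<Longrightarrow> polyfun (f i)) \<Longrightarrow> polyfun (\<lambda>x. \<Sum>i\<in>A. f i x)"
  by (induction A rule: infinite_finite_induct) (auto simp: polyfun_const)

lemma polyfun_prod [intro]: "(\<And>i. i \<in> A \<Longrightarrow> polyfun (f i)) \<Longrightarrow> polyfun (\<lambda>x. \<Prod>i\<in>A. f i x)"
  by (induction A rule: infinite_finite_induct) (auto simp: polyfun_const)

lemma polyfun_power [intro]: "polyfun f \<Longrightarrow> polyfun (\<lambda>x. f x ^ n)"
  by (induction n) (auto simp: polyfun_const)

lemma polyfun_eval_poly [intro]: "polyfun (eval_poly P)"
  unfolding eval_poly_def [abs_def]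
  by (intro polyfun_sum polyfun_mult polyfun_const polyfun_prod polyfun_power polyfun_coord)

lemma polyfun_compose:
  "polyfun f \<Longrightarrow> (\<And>v. polyfun (\<lambda>x. c x $ v)) \<Longrightarrow> polyfun (\<lambda>x. f (c x))"
  by (induction f rule: polyfun.induct) auto

text \<open>The chain rule along curves is part of the notion, so that one induction delivers both
  polynomial partial derivatives and the chain rule.\<close>

definition gradient :: "(complex ^ 'v::finite \<Rightarrow> complex) \<Rightarrow> ('v \<Rightarrow> complex ^ 'v \<Rightarrow> complex) \<Rightarrow> bool" where
  "gradient f h \<longleftrightarrow> (\<forall>v. polyfun (h v)) \<and> (\<forall>c c' s. (\<forall>v. ((\<lambda>s. c s $ v) has_field_derivative c' v) (at s))
    \<longrightarrow> ((\<lambda>s. f (c s)) has_field_derivative (\<Sum>v\<in>UNIV. h v (c s) * c' v)) (at s))"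

lemma gradientD:
  fixes f :: "complex ^ 'v::finite \<Rightarrow> complex" and c :: "complex \<Rightarrow> complex ^ 'v"
  assumes "gradient f h"
  shows "polyfun (h v)"
    and "\<forall>v. ((\<lambda>s. c s $ v) has_field_derivative c' v) (at s)
      \<Longrightarrow> ((\<lambda>s. f (c s)) has_field_derivative (\<Sum>v\<in>UNIV. h v (c s) * c' v)) (at s)"
  using assms unfolding gradient_def by blast+

lemma gradientI:
  fixes f :: "complex ^ 'v::finite \<Rightarrow> complex"
  assumes "\<And>v. polyfun (h v)"
    and "\<And>(c :: complex \<Rightarrow> complex ^ 'v) c' s. (\<And>v. ((\<lambda>s. c s $ v) has_field_derivative c' v) (at s))
      \<Longrightarrow> ((\<lambda>s. f (c s)) has_field_derivative (\<Sum>v\<in>UNIV. h v (c s) * c' v)) (at s)"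
  shows "gradient f h"
  using assms unfolding gradient_def by blast

lemma polyfun_gradient:
  fixes f :: "complex ^ 'v::finite \<Rightarrow> complex"
  assumes "polyfun f"
  shows "\<exists>h. gradient f h"
  using assms
proof (induction f)
  case (polyfun_const k)
  have "gradient (\<lambda>x :: complex ^ 'v. k) (\<lambda>v x. 0)" by (rule gradientI) auto
  then show ?case by blast
next
  case (polyfun_coord u)
  have "gradient (\<lambda>x :: complex ^ 'v. x $ u) (\<lambda>v x. if v = u then 1 else 0)"
  proof (rule gradientI)
    fix c :: "complex \<Rightarrow> complex ^ 'v" and c' s assume "\<And>v. ((\<lambda>s. c s $ v) has_field_derivative c' v) (at s)"
    moreover have "(\<Sum>v\<in>UNIV. (if v = u then 1 else 0) * c' v) = c' u"
      by (subst sum.remove [of _ u]) auto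
    ultimately show "((\<lambda>s. c s $ u) has_field_derivative (\<Sum>v\<in>UNIV. (if v = u then 1 else 0) * c' v)) (at s)"
      by simp
  qed auto
  then show ?case by blast
next
  case (polyfun_add f g)
  then obtain hf hg where f: "gradient f hf" and g: "gradient g hg" by blast
  have "gradient (\<lambda>x. f x + g x) (\<lambda>v x. hf v x + hg v x)"
  proof (rule gradientI)
    fix c :: "complex \<Rightarrow> complex ^ 'v" and c' s assume c: "\<And>v. ((\<lambda>s. c s $ v) has_field_derivative c' v) (at s)"
    have "((\<lambda>s. f (c s)) has_field_derivative (\<Sum>v\<in>UNIV. hf v (c s) * c' v)) (at s)"
      and "((\<lambda>s. g (c s)) has_field_derivative (\<Sum>v\<in>UNIV. hg v (c s) * c' v)) (at s)"
      using c by (intro gradientD(2) f g; blast)+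
    from DERIV_add [OF this]
    show "((\<lambda>s. f (c s) + g (c s)) has_field_derivative (\<Sum>v\<in>UNIV. (hf v (c s) + hg v (c s)) * c' v)) (at s)"
      by (simp add: distrib_right sum.distrib)
  qed (intro polyfun.polyfun_add gradientD(1) [OF f] gradientD(1) [OF g])
  then show ?case by blast
next
  case (polyfun_mult f g)
  then obtain hf hg where f: "gradient f hf" and g: "gradient g hg" by blast
  have "gradient (\<lambda>x. f x * g x) (\<lambda>v x. hf v x * g x + hg v x * f x)"
  proof (rule gradientI)
    fix c :: "complex \<Rightarrow> complex ^ 'v" and c' s assume c: "\<And>v. ((\<lambda>s. c s $ v) has_field_derivative c' v) (at s)"
    have "((\<lambda>s. f (c s)) has_field_derivative (\<Sum>v\<in>UNIV. hf v (c s) * c' v)) (at s)"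
      and "((\<lambda>s. g (c s)) has_field_derivative (\<Sum>v\<in>UNIV. hg v (c s) * c' v)) (at s)"
      using c by (intro gradientD(2) f g; blast)+
    from DERIV_mult [OF this]
    show "((\<lambda>s. f (c s) * g (c s)) has_field_derivative
        (\<Sum>v\<in>UNIV. (hf v (c s) * g (c s) + hg v (c s) * f (c s)) * c' v)) (at s)"
      by (simp add: algebra_simps sum.distrib sum_distrib_left)
  qed (intro polyfun.polyfun_add polyfun.polyfun_mult gradientD(1) [OF f] gradientD(1) [OF g] polyfun_mult.hyps)
  then show ?case by blast
qed

lemma has_derivative_coord_curve:
  "((\<lambda>z. (\<chi> w. if w = v then z else x $ w) $ u) has_field_derivative (if u = v then 1 else 0)) (at s)"
  by (cases "u = v") auto

lemma coord_curve_at: "(\<chi> w. if w = v then x $ v else x $ w) = x"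
  by (simp add: vec_eq_iff)

lemma partial_eqI:
  assumes "((\<lambda>z. f (\<chi> w. if w = v then z else x $ w)) has_field_derivative D) (at (x $ v))"
  shows "partial v f x = D"
  using assms by (simp add: partial_def DERIV_imp_deriv)

lemma polyfun_partial_chain:
  fixes f :: "complex ^ 'v::finite \<Rightarrow> complex" and c :: "complex \<Rightarrow> complex ^ 'v"
  assumes "polyfun f"
  shows "polyfun (partial v f)"
    and "(\<And>v. ((\<lambda>s. c s $ v) has_field_derivative c' v) (at s))
    \<Longrightarrow> ((\<lambda>s. f (c s)) has_field_derivative (\<Sum>v\<in>UNIV. partial v f (c s) * c' v)) (at s)"
proof -
  obtain h where h: "gradient f h" using polyfun_gradient [OF assms] by blast
  have p: "partial v f = h v" for v
  proof
    fix x
    show "partial v f x = h v x"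
      using gradientD(2) [OF h, of "\<lambda>z. \<chi> w. if w = v then z else x $ w" "\<lambda>u. if u = v then 1 else 0" "x $ v"]
        has_derivative_coord_curve
      by (intro partial_eqI) (simp add: coord_curve_at if_distrib [of "\<lambda>x. _ * x"] cong: if_cong)
  qed
  show "polyfun (partial v f)" using gradientD(1) [OF h] p by simp
  show "((\<lambda>s. f (c s)) has_field_derivative (\<Sum>v\<in>UNIV. partial v f (c s) * c' v)) (at s)"
    if "\<And>v. ((\<lambda>s. c s $ v) has_field_derivative c' v) (at s)"
    using gradientD(2) [OF h, of c c' s] that p by simp
qed

lemmas polyfun_partial [intro] = polyfun_partial_chain(1)
lemmas polyfun_chain = polyfun_partial_chain(2)

lemma partial_const [simp]: "partial v (\<lambda>x. c) x = 0"
  by (rule partial_eqI) simp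

lemma partial_coord: "partial v (\<lambda>x. x $ u) x = (if u = v then 1 else 0)"
  by (rule partial_eqI) (rule has_derivative_coord_curve)

lemma polyfun_partial_derivative:
  "polyfun f \<Longrightarrow> ((\<lambda>z. f (\<chi> w. if w = v then z else x $ w)) has_field_derivative partial v f x) (at (x $ v))"
  using polyfun_chain [OF _ has_derivative_coord_curve, of f v x "x $ v"]
  by (simp add: coord_curve_at if_distrib [of "\<lambda>x. _ * x"] cong: if_cong)

lemma partial_add:
  "polyfun f \<Longrightarrow> polyfun g \<Longrightarrow> partial v (\<lambda>x. f x + g x) x = partial v f x + partial v g x"
  by (intro partial_eqI DERIV_add polyfun_partial_derivative)

lemma partial_mult:
  assumes "polyfun f" "polyfun g"
  shows "partial v (\<lambda>x. f x * g x) x = partial v f x * g x + f x * partial v g x"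
proof (rule partial_eqI)
  show "((\<lambda>z. f (\<chi> w. if w = v then z else x $ w) * g (\<chi> w. if w = v then z else x $ w))
      has_field_derivative partial v f x * g x + f x * partial v g x) (at (x $ v))"
    using DERIV_mult [OF polyfun_partial_derivative [OF assms(1)] polyfun_partial_derivative [OF assms(2)], of v x]
    by (simp add: coord_curve_at mult.commute)
qed

lemma partial_cmult: "polyfun f \<Longrightarrow> partial v (\<lambda>x. c * f x) x = c * partial v f x"
  by (simp add: partial_mult polyfun_const)

lemma partial_diff:
  "polyfun f \<Longrightarrow> polyfun g \<Longrightarrow> partial v (\<lambda>x. f x - g x) x = partial v f x - partial v g x"
  by (intro partial_eqI DERIV_diff polyfun_partial_derivative)

lemma partial_sum:
  "(\<And>i. i \<in> A \<Longrightarrow> polyfun (f i)) \<Longrightarrow> partial v (\<lambda>x. \<Sum>i\<in>A. f i x) x = (\<Sum>i\<in>A. partial v (f i) x)"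
  by (intro partial_eqI DERIV_sum) (rule polyfun_partial_derivative)

lemma partial_commute: "polyfun f \<Longrightarrow> partial u (partial v f) x = partial v (partial u f) x"
proof (induction f arbitrary: x rule: polyfun.induct)
  case (polyfun_const c)
  have "partial w (\<lambda>x::complex^'a. c) = (\<lambda>x. 0)" for w by (rule ext) simp
  then show ?case by simp
next
  case (polyfun_coord k)
  have "partial w (\<lambda>x::complex^'a. x $ k) = (\<lambda>x. if k = w then 1 else 0)" for w
    by (rule ext) (simp add: partial_coord)
  then show ?case by simp
next
  case (polyfun_add f g)
  have "partial w (\<lambda>x. f x + g x) = (\<lambda>x. partial w f x + partial w g x)" for w
    by (rule ext) (simp add: partial_add polyfun_add)
  then show ?case using polyfun_add by (simp add: partial_add polyfun_partial)
next
  case (polyfun_mult f g)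
  have "partial w (\<lambda>x. f x * g x) = (\<lambda>x. partial w f x * g x + f x * partial w g x)" for w
    by (rule ext) (simp add: partial_mult polyfun_mult)
  then show ?case using polyfun_mult
    by (simp add: partial_add partial_mult polyfun_partial polyfun.intros)
qed

lemma continuous_on_polyfun: "polyfun f \<Longrightarrow> continuous_on A f"
  by (induction f rule: polyfun.induct) (auto intro!: continuous_intros)

text \<open>Carries identities from the open dense domain of the integrals to all of phase space, in
  particular to the line, which need not meet that domain.\<close>

lemma polyfun_eq_on_dense:
  assumes "polyfun f" "polyfun g" "closure U = UNIV" "\<And>x. x \<in> U \<Longrightarrow> f x = g x"
  shows "f x = g x"
proof -
  have "closed {x. f x = g x}"
    by (intro closed_Collect_eq continuous_on_polyfun assms)
  then have "closure U \<subseteq> {x. f x = g x}" using assms(4) by (intro closure_minimal) auto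
  then show ?thesis using assms(3) by auto
qed

section \<open>Restriction to lines and expansion transverse to a line\<close>

lemma polyfun_line:
  assumes "polyfun f"
  shows "\<exists>p. \<forall>s. poly p s = f (X + s *s w)"
  using assms
proof (induction f)
  case (polyfun_const c)
  show ?case by (rule exI [of _ "[:c:]"]) simp
next
  case (polyfun_coord v)
  show ?case by (rule exI [of _ "[:X $ v, w $ v:]"]) simp
next
  case (polyfun_add f g)
  then obtain p q where "\<forall>s. poly p s = f (X + s *s w)" "\<forall>s. poly q s = g (X + s *s w)" by auto
  then show ?case by (intro exI [of _ "p + q"]) simp
next
  case (polyfun_mult f g)
  then obtain p q where "\<forall>s. poly p s = f (X + s *s w)" "\<forall>s. poly q s = g (X + s *s w)" by auto
  then show ?case by (intro exI [of _ "p * q"]) simp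
qed

definition lpoly :: "(complex ^ 'v::finite \<Rightarrow> complex) \<Rightarrow> complex ^ 'v \<Rightarrow> complex ^ 'v \<Rightarrow> complex poly" where
  "lpoly f X w = (THE p. \<forall>s. poly p s = f (X + s *s w))"

lemma lpoly_eqI: "(\<And>s. poly p s = f (X + s *s w)) \<Longrightarrow> lpoly f X w = p"
  unfolding lpoly_def by (rule the_equality) (auto simp: poly_eq_poly_eq_iff [symmetric] fun_eq_iff)

lemma poly_lpoly: "polyfun f \<Longrightarrow> poly (lpoly f X w) s = f (X + s *s w)"
  using polyfun_line [of f X w] lpoly_eqI by metis

lemma lpoly_const [simp]: "lpoly (\<lambda>x. c) X w = [:c:]"
  by (rule lpoly_eqI) simp

lemma lpoly_coord: "lpoly (\<lambda>x. x $ v) X w = [:X $ v, w $ v:]"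
  by (rule lpoly_eqI) simp

lemma lpoly_add: "polyfun f \<Longrightarrow> polyfun g \<Longrightarrow> lpoly (\<lambda>x. f x + g x) X w = lpoly f X w + lpoly g X w"
  by (rule lpoly_eqI) (simp add: poly_lpoly)

lemma lpoly_diff: "polyfun f \<Longrightarrow> polyfun g \<Longrightarrow> lpoly (\<lambda>x. f x - g x) X w = lpoly f X w - lpoly g X w"
  by (rule lpoly_eqI) (simp add: poly_lpoly)

lemma lpoly_mult: "polyfun f \<Longrightarrow> polyfun g \<Longrightarrow> lpoly (\<lambda>x. f x * g x) X w = lpoly f X w * lpoly g X w"
  by (rule lpoly_eqI) (simp add: poly_lpoly)

lemma lpoly_cmult: "polyfun f \<Longrightarrow> lpoly (\<lambda>x. c * f x) X w = smult c (lpoly f X w)"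
  by (rule lpoly_eqI) (simp add: poly_lpoly)

lemma lpoly_uminus: "polyfun f \<Longrightarrow> lpoly (\<lambda>x. - f x) X w = - lpoly f X w"
  by (rule lpoly_eqI) (simp add: poly_lpoly)

lemma lpoly_sum:
  "(\<And>i. i \<in> A \<Longrightarrow> polyfun (f i)) \<Longrightarrow> lpoly (\<lambda>x. \<Sum>i\<in>A. f i x) X w = (\<Sum>i\<in>A. lpoly (f i) X w)"
  by (rule lpoly_eqI) (simp add: poly_lpoly poly_sum)

text \<open>No zero divisors: on the line joining \<open>x\<close> and \<open>y\<close> both factors
  are polynomials in one variable, and the second is not zero.\<close>

lemma polyfun_mult_eq_0:
  assumes "polyfun f" "polyfun g" "\<And>x. f x * g x = 0" "g y \<noteq> 0"
  shows "f x = 0"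
proof -
  have "lpoly f x (y - x) * lpoly g x (y - x) = 0"
    by (rule poly_eq_poly_eq_iff [THEN iffD1]) (auto simp: poly_lpoly assms)
  moreover have "poly (lpoly g x (y - x)) 1 \<noteq> 0"
    using assms by (simp add: poly_lpoly)
  ultimately have "lpoly f x (y - x) = 0" by auto
  then show ?thesis using poly_lpoly [OF assms(1), of x "y - x" 0] by simp
qed

lemma coeff_mult_lowest:
  fixes p q :: "'a::comm_semiring_0 poly"
  assumes "\<And>i. i < m \<Longrightarrow> coeff p i = 0" "\<And>i. i < n \<Longrightarrow> coeff q i = 0"
  shows "coeff (p * q) (m + n) = coeff p m * coeff q n"
    and "i < m + n \<Longrightarrow> coeff (p * q) i = 0"
proof -
  have "coeff (p * q) (m + n) = (\<Sum>i\<le>m + n. if i = m then coeff p m * coeff q n else 0)"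
    unfolding coeff_mult
  proof (rule sum.cong)
    fix i assume "i \<in> {..m + n}"
    then show "coeff p i * coeff q (m + n - i) = (if i = m then coeff p m * coeff q n else 0)"
      using assms(1) [of i] assms(2) [of "m + n - i"] by (cases i m rule: linorder_cases) auto
  qed simp
  then show "coeff (p * q) (m + n) = coeff p m * coeff q n" by simp
  show "coeff (p * q) i = 0" if "i < m + n"
    unfolding coeff_mult
  proof (rule sum.neutral, rule ballI)
    fix k assume "k \<in> {..i}"
    then show "coeff p k * coeff q (i - k) = 0"
      using assms(1) [of k] assms(2) [of "i - k"] that by (cases "k < m") auto
  qed
qed

definition offset :: "complex ^ 'v::finite option \<Rightarrow> complex ^ 'v" where
  "offset z = (\<chi> v. z $ Some v)"

text \<open>
  Expansion along the line \<open>t \<mapsto> X0 + t X1\<close>: the coefficient of \<open>\<epsilon>\<^sup>j\<close> in \<open>f (X0 + t X1 + \<epsilon> w)\<close>, as a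
  function of \<open>t\<close> (the coordinate \<open>None\<close>) and \<open>w\<close> (the coordinates \<open>Some v\<close>).
\<close>
definition expansion :: "complex ^ 'v::finite \<Rightarrow> complex ^ 'v \<Rightarrow> (complex ^ 'v \<Rightarrow> complex) \<Rightarrow>
    complex ^ 'v option \<Rightarrow> complex poly" where
  "expansion X0 X1 f z = lpoly f (X0 + z $ None *s X1) (offset z)"

lemma expansion_const [simp]: "expansion X0 X1 (\<lambda>x. c) z = [:c:]"
  by (simp add: expansion_def)

lemma expansion_coord:
  "expansion X0 X1 (\<lambda>x. x $ v) z = [:X0 $ v + z $ None * X1 $ v, z $ Some v:]"
  by (simp add: expansion_def lpoly_coord offset_def)

lemma expansion_add:
  "polyfun f \<Longrightarrow> polyfun g \<Longrightarrow> expansion X0 X1 (\<lambda>x. f x + g x) z = expansion X0 X1 f z + expansion X0 X1 g z"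
  by (simp add: expansion_def lpoly_add)

lemma expansion_diff:
  "polyfun f \<Longrightarrow> polyfun g \<Longrightarrow> expansion X0 X1 (\<lambda>x. f x - g x) z = expansion X0 X1 f z - expansion X0 X1 g z"
  by (simp add: expansion_def lpoly_diff)

lemma expansion_mult:
  "polyfun f \<Longrightarrow> polyfun g \<Longrightarrow> expansion X0 X1 (\<lambda>x. f x * g x) z = expansion X0 X1 f z * expansion X0 X1 g z"
  by (simp add: expansion_def lpoly_mult)

lemma expansion_cmult:
  "polyfun f \<Longrightarrow> expansion X0 X1 (\<lambda>x. c * f x) z = smult c (expansion X0 X1 f z)"
  by (simp add: expansion_def lpoly_cmult)

lemma expansion_uminus:
  "polyfun f \<Longrightarrow> expansion X0 X1 (\<lambda>x. - f x) z = - expansion X0 X1 f z"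
  by (simp add: expansion_def lpoly_uminus)

lemma expansion_sum:
  "(\<And>i. i \<in> A \<Longrightarrow> polyfun (f i)) \<Longrightarrow>
    expansion X0 X1 (\<lambda>x. \<Sum>i\<in>A. f i x) z = (\<Sum>i\<in>A. expansion X0 X1 (f i) z)"
  by (simp add: expansion_def lpoly_sum)

lemma polyfun_coeff_expansion [intro]: "polyfun f \<Longrightarrow> polyfun (\<lambda>z. coeff (expansion X0 X1 f z) j)"
proof (induction f arbitrary: j rule: polyfun.induct)
  case (polyfun_coord v)
  show ?case
  proof (cases j)
    case 0
    then show ?thesis by (simp add: expansion_coord) (intro polyfun.intros)
  next
    case (Suc i)
    then show ?thesis by (cases i) (auto simp: expansion_coord polyfun_const)
  qed
next
  case (polyfun_mult f g)
  then show ?case by (simp add: expansion_mult coeff_mult) (intro polyfun_sum polyfun.polyfun_mult)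
qed (auto simp: expansion_add polyfun_const)

text \<open>The time t moves the base point in direction \<open>X1\<close>, while a coordinate of w
  enters only multiplied by \<epsilon>; this is the shift by \<open>pCons 0\<close>.\<close>

definition expansion_deriv :: "complex ^ 'v::finite \<Rightarrow> complex ^ 'v \<Rightarrow> (complex ^ 'v \<Rightarrow> complex) \<Rightarrow>
    'v option \<Rightarrow> complex ^ 'v option \<Rightarrow> complex poly" where
  "expansion_deriv X0 X1 f u z = (case u of
      None \<Rightarrow> (\<Sum>v\<in>UNIV. smult (X1 $ v) (expansion X0 X1 (partial v f) z))
    | Some v \<Rightarrow> pCons 0 (expansion X0 X1 (partial v f) z))"

lemma partial_expansion:
  "polyfun f \<Longrightarrow> partial u (\<lambda>z. coeff (expansion X0 X1 f z) j) z = coeff (expansion_deriv X0 X1 f u z) j"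
proof (induction f arbitrary: j rule: polyfun.induct)
  case (polyfun_const c)
  have "partial v (\<lambda>x :: complex ^ 'a. c) = (\<lambda>x. 0)" for v by (rule ext) simp
  then show ?case by (simp add: expansion_deriv_def split: option.split)
next
  case (polyfun_coord v)
  have p: "partial w (\<lambda>x. x $ v) = (\<lambda>x. if v = w then 1 else 0)" for w
    by (rule ext) (simp add: partial_coord)
  have r: "expansion_deriv X0 X1 (\<lambda>x. x $ v) u z
      = (case u of None \<Rightarrow> [:X1 $ v:] | Some w \<Rightarrow> if v = w then [:0, 1:] else 0)"
  proof (cases u)
    case None
    have "(\<Sum>va\<in>UNIV. smult (X1 $ va) (expansion X0 X1 (partial va (\<lambda>x. x $ v)) z))
        = (\<Sum>va\<in>UNIV. if va = v then [:X1 $ v:] else 0)"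
      by (rule sum.cong) (auto simp: p)
    then show ?thesis by (simp add: None expansion_deriv_def)
  qed (simp add: expansion_deriv_def p)
  show ?case
  proof (cases j)
    case 0
    have "partial u (\<lambda>z. X0 $ v + z $ None * X1 $ v) z = (if u = None then X1 $ v else 0)"
    proof -
      have "partial u (\<lambda>z :: complex ^ 'a option. z $ None * X1 $ v) z = (if u = None then X1 $ v else 0)"
        by (subst partial_mult) (auto simp: partial_coord polyfun.polyfun_const polyfun.polyfun_coord)
      then show ?thesis
        by (subst partial_add) (auto intro: polyfun.intros)
    qed
    then show ?thesis unfolding 0 r by (auto simp: expansion_coord split: option.split)
  next
    case (Suc i)
    show ?thesis unfolding Suc r
      by (cases i) (auto simp: expansion_coord partial_coord split: option.split)
  qed
next
  case (polyfun_add f g)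
  have p: "partial w (\<lambda>x. f x + g x) = (\<lambda>x. partial w f x + partial w g x)" for w
    by (rule ext) (simp add: partial_add polyfun_add)
  have "expansion_deriv X0 X1 (\<lambda>x. f x + g x) u z = expansion_deriv X0 X1 f u z + expansion_deriv X0 X1 g u z"
    by (simp add: expansion_deriv_def p expansion_add polyfun_add polyfun_partial smult_add_right
        sum.distrib split: option.split)
  then show ?case
    using polyfun_add by (simp add: expansion_add partial_add polyfun_coeff_expansion)
next
  case (polyfun_mult f g)
  have p: "partial w (\<lambda>x. f x * g x) = (\<lambda>x. partial w f x * g x + f x * partial w g x)" for w
    by (rule ext) (simp add: partial_mult polyfun_mult)
  have d: "expansion_deriv X0 X1 (\<lambda>x. f x * g x) u z
      = expansion_deriv X0 X1 f u z * expansion X0 X1 g z + expansion X0 X1 f z * expansion_deriv X0 X1 g u z"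
    by (simp add: expansion_deriv_def p expansion_add expansion_mult polyfun_mult polyfun.polyfun_mult
        polyfun_partial smult_add_right sum.distrib sum_distrib_left sum_distrib_right
        split: option.split)
  show ?case
    unfolding d using polyfun_mult
    by (simp add: expansion_mult coeff_mult partial_sum partial_mult polyfun_coeff_expansion
        polyfun.polyfun_mult sum.distrib)
qed

lemma partial_expansion_None: "polyfun f \<Longrightarrow> partial None (\<lambda>z. coeff (expansion X0 X1 f z) j) z
    = (\<Sum>v\<in>UNIV. X1 $ v * coeff (expansion X0 X1 (partial v f) z) j)"
  by (simp add: partial_expansion expansion_deriv_def coeff_sum)

lemma partial_expansion_Some: "polyfun f \<Longrightarrow> partial (Some v) (\<lambda>z. coeff (expansion X0 X1 f z) j) z
    = coeff (pCons 0 (expansion X0 X1 (partial v f) z)) j"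
  by (simp add: partial_expansion expansion_deriv_def)

text \<open>If f has order at least \<open>e\<close> in \<epsilon>, its partial derivatives have
  order at least \<open>e - 1\<close>. Up to \<epsilon>^e, therefore, only the constant part of the
  field, which gives d/dt, and its linear part, which gives the variational equation, can
  contribute.\<close>

lemma coeff_expansion_field:
  assumes f: "polyfun f" and low: "\<And>i z. i < e \<Longrightarrow> coeff (expansion X0 X1 f z) i = 0"
    and X: "\<And>v. polyfun (X v)" "\<And>v. coeff (expansion X0 X1 (X v) z) 0 = X1 $ v"
    and "j \<le> e"
  shows "coeff (expansion X0 X1 (\<lambda>x. \<Sum>v\<in>UNIV. partial v f x * X v x) z) j
    = partial None (\<lambda>z. coeff (expansion X0 X1 f z) j) z
      + (\<Sum>v\<in>UNIV. coeff (expansion X0 X1 (X v) z) 1 * partial (Some v) (\<lambda>z. coeff (expansion X0 X1 f z) j) z)"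
proof -
  have z: "coeff (expansion X0 X1 (partial v f) z) i = 0" if "i + 1 < e" for i v
  proof -
    have "(\<lambda>z. coeff (expansion X0 X1 f z) (Suc i)) = (\<lambda>z. 0)" using low that by (intro ext) simp
    then show ?thesis using partial_expansion_Some [OF f, of v X0 X1 "Suc i" z] by simp
  qed
  have c: "coeff (p * q) j = coeff q 0 * coeff p j + coeff q 1 * coeff (pCons 0 p) j"
    if "\<And>i. i + 1 < e \<Longrightarrow> coeff p i = 0" for p q :: "complex poly"
  proof (cases j)
    case (Suc i)
    have "coeff (p * q) j = (\<Sum>k\<le>Suc i. coeff p k * coeff q (Suc i - k))" by (simp add: coeff_mult Suc)
    also have "\<dots> = coeff p (Suc i) * coeff q 0 + (\<Sum>k\<le>i. coeff p k * coeff q (Suc i - k))" by simp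
    also have "(\<Sum>k\<le>i. coeff p k * coeff q (Suc i - k)) = (\<Sum>k\<le>i. if k = i then coeff p i * coeff q 1 else 0)"
    proof (rule sum.cong)
      fix k assume "k \<in> {..i}"
      then show "coeff p k * coeff q (Suc i - k) = (if k = i then coeff p i * coeff q 1 else 0)"
        using that [of k] \<open>j \<le> e\<close> Suc by (cases "k = i") auto
    qed simp
    finally show ?thesis by (simp add: Suc algebra_simps)
  qed (simp add: coeff_mult)
  show ?thesis
    unfolding partial_expansion_None [OF f] partial_expansion_Some [OF f] sum.distrib [symmetric]
    using f X(1) by (simp add: expansion_sum expansion_mult polyfun_mult polyfun_partial coeff_sum c z X(2))
qed

section \<open>Substitution of polynomials in three variables\<close>

definition ev3 :: "complex poly poly poly \<Rightarrow> complex \<Rightarrow> complex \<Rightarrow> complex \<Rightarrow> complex" where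
  "ev3 p t z s = poly (poly (poly p [:[:s:]:]) [:z:]) t"

lemma ev3_add [simp]: "ev3 (p + q) t z s = ev3 p t z s + ev3 q t z s"
  and ev3_mult [simp]: "ev3 (p * q) t z s = ev3 p t z s * ev3 q t z s"
  and ev3_const [simp]: "ev3 [:[:[:k:]:]:] t z s = k"
  by (simp_all add: ev3_def)

lemma poly_eq_0_if_const_roots:
  fixes p :: "'a::idom poly" and f :: "complex \<Rightarrow> 'a"
  assumes "inj f" "\<And>x. poly p (f x) = 0"
  shows "p = 0"
proof (rule ccontr)
  assume "p \<noteq> 0"
  then have "finite {x. poly p x = 0}" by (rule poly_roots_finite)
  then have "finite (range f)" by (rule finite_subset [rotated]) (use assms in auto)
  then have "finite (UNIV :: complex set)" using assms(1) by (rule finite_imageD)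
  then show False by (simp add: infinite_UNIV_char_0)
qed

lemma ev3_eq_0:
  assumes "\<And>t z s. ev3 p t z s = 0"
  shows "p = 0"
proof (rule poly_eq_0_if_const_roots)
  show "inj (\<lambda>s::complex. [:[:s:]:])" by (auto intro!: injI)
  fix s
  show "poly p [:[:s:]:] = 0"
  proof (rule poly_eq_0_if_const_roots)
    show "inj (\<lambda>z::complex. [:z:])" by (auto intro!: injI)
    fix z
    show "poly (poly p [:[:s:]:]) [:z:] = 0"
      by (rule poly_eq_0_if_const_roots [of "\<lambda>x. x"]) (use assms in \<open>auto simp: ev3_def\<close>)
  qed
qed

lemma ev3_diff: "ev3 (p - q) t z s = ev3 p t z s - ev3 q t z s"
  by (simp add: ev3_def)

lemma ev3_eqI: "(\<And>t z s. ev3 p t z s = ev3 q t z s) \<Longrightarrow> p = q"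
  using ev3_eq_0 [of "p - q"] by (simp add: ev3_diff)

definition ev3_point :: "('v::finite \<Rightarrow> complex poly poly poly) \<Rightarrow> complex \<Rightarrow> complex \<Rightarrow> complex \<Rightarrow> complex ^ 'v" where
  "ev3_point c t z s = (\<chi> v. ev3 (c v) t z s)"

text \<open>The composite of a polynomial function with a three-parameter family, as an element of a
  polynomial ring (t innermost, then z, then s). Divisibility and lowest coefficients become
  available there.\<close>

definition sub3 :: "('v::finite \<Rightarrow> complex poly poly poly) \<Rightarrow> (complex ^ 'v \<Rightarrow> complex) \<Rightarrow> complex poly poly poly" where
  "sub3 c h = (THE p. \<forall>t z s. ev3 p t z s = h (ev3_point c t z s))"

lemma sub3_eqI: "(\<And>t z s. ev3 p t z s = h (ev3_point c t z s)) \<Longrightarrow> sub3 c h = p"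
  unfolding sub3_def by (rule the_equality) (auto intro: ev3_eqI)

lemma ev3_sub3: "polyfun h \<Longrightarrow> ev3 (sub3 c h) t z s = h (ev3_point c t z s)"
proof -
  assume "polyfun h"
  then have "\<exists>p. \<forall>t z s. ev3 p t z s = h (ev3_point c t z s)"
  proof (induction h)
    case (polyfun_const k)
    show ?case by (rule exI [of _ "[:[:[:k:]:]:]"]) simp
  next
    case (polyfun_coord v)
    show ?case by (rule exI [of _ "c v"]) (simp add: ev3_point_def)
  next
    case (polyfun_add f g)
    then show ?case by (metis ev3_add)
  next
    case (polyfun_mult f g)
    then show ?case by (metis ev3_mult)
  qed
  then show ?thesis using sub3_eqI by metis
qed

lemma sub3_const [simp]: "sub3 c (\<lambda>x. k) = [:[:[:k:]:]:]"
  by (rule sub3_eqI) simp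

lemma sub3_coord [simp]: "sub3 c (\<lambda>x. x $ v) = c v"
  by (rule sub3_eqI) (simp add: ev3_point_def)

lemma sub3_add: "polyfun f \<Longrightarrow> polyfun g \<Longrightarrow> sub3 c (\<lambda>x. f x + g x) = sub3 c f + sub3 c g"
  by (rule sub3_eqI) (simp add: ev3_sub3)

lemma sub3_mult: "polyfun f \<Longrightarrow> polyfun g \<Longrightarrow> sub3 c (\<lambda>x. f x * g x) = sub3 c f * sub3 c g"
  by (rule sub3_eqI) (simp add: ev3_sub3)

lemma sub3_diff: "polyfun f \<Longrightarrow> polyfun g \<Longrightarrow> sub3 c (\<lambda>x. f x - g x) = sub3 c f - sub3 c g"
  by (rule sub3_eqI) (simp add: ev3_sub3 ev3_diff)

lemma sub3_uminus: "polyfun f \<Longrightarrow> sub3 c (\<lambda>x. - f x) = - sub3 c f"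
  using sub3_diff [of "\<lambda>x. 0" f] by (simp add: polyfun_const)

lemma sub3_sum: "(\<And>i. i \<in> A \<Longrightarrow> polyfun (f i)) \<Longrightarrow> sub3 c (\<lambda>x. \<Sum>i\<in>A. f i x) = (\<Sum>i\<in>A. sub3 c (f i))"
  by (induction A rule: infinite_finite_induct) (simp_all add: sub3_add polyfun_sum)

text \<open>Translates vector fields on phase space into derivations of the polynomial ring: any
  derivation that kills the constants obeys the chain rule.\<close>

lemma chain_sub3:
  assumes D: "derivation D" and D_const: "\<And>k. D [:[:[:k:]:]:] = 0" and "polyfun h"
  shows "D (sub3 c h) = (\<Sum>v\<in>UNIV. sub3 c (partial v h) * D (c v))"
  using \<open>polyfun h\<close>
proof (induction h)
  interpret derivation D by (rule D)
  {
    case (polyfun_const k)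
    have "partial v (\<lambda>x :: complex ^ 'a. k) = (\<lambda>x. 0)" for v by (rule ext) simp
    then show ?case by (simp add: D_const)
  next
    case (polyfun_coord u)
    have "partial v (\<lambda>x :: complex ^ 'a. x $ u) = (\<lambda>x. if u = v then 1 else 0)" for v
      by (rule ext) (simp add: partial_coord)
    moreover have "(\<Sum>v\<in>UNIV. sub3 c (\<lambda>x. if u = v then 1 else 0) * D (c v))
        = (\<Sum>v\<in>UNIV. if v = u then D (c u) else 0)"
    proof (rule sum.cong)
      have "smult [:[:1::complex:]:] q = q" for q by (metis one_pCons smult_1_left)
      then show "sub3 c (\<lambda>x. if u = v then 1 else 0) * D (c v) = (if v = u then D (c u) else 0)" for v
        by (cases "u = v") simp_all
    qed simp
    ultimately show ?case by simp
  next
    case (polyfun_add f g)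
    have "partial v (\<lambda>x. f x + g x) = (\<lambda>x. partial v f x + partial v g x)" for v
      by (rule ext) (simp add: partial_add polyfun_add)
    then show ?case using polyfun_add
      by (simp add: sub3_add add polyfun_partial distrib_right sum.distrib)
  next
    case (polyfun_mult f g)
    have "partial v (\<lambda>x. f x * g x) = (\<lambda>x. partial v f x * g x + f x * partial v g x)" for v
      by (rule ext) (simp add: partial_mult polyfun_mult)
    then show ?case using polyfun_mult
      by (simp add: sub3_add sub3_mult mult polyfun_partial polyfun.polyfun_mult
          algebra_simps sum.distrib sum_distrib_left)
  }
qed

text \<open>The derivation with t' = 1, z' as in \<open>riccati\<close> and \<delta>' = z \<delta>,
  where \<delta> is the outermost variable: the system x' = y, y' = - lam t^m x in the chart x =
  \<delta>, y = \<delta> z.\<close>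

definition euler_riccati :: "complex \<Rightarrow> nat \<Rightarrow> complex poly poly poly \<Rightarrow> complex poly poly poly" where
  "euler_riccati lam m p = map_poly (riccati lam m) p + [:0, [:0, 1:]:] * pderiv p"

lemma derivation_euler_riccati: "derivation (euler_riccati lam m)"
  unfolding euler_riccati_def [abs_def]
  by (intro derivation_plus derivation.map_poly derivation_riccati derivation.mult_right derivation_pderiv)

lemma coeff_euler_riccati:
  "coeff (euler_riccati lam m p) i = riccati lam m (coeff p i) + of_nat i * ([:0, 1:] * coeff p i)"
proof -
  interpret derivation "riccati lam m" by (rule derivation_riccati)
  show ?thesis
    by (cases i) (simp_all add: euler_riccati_def coeff_map_poly coeff_pderiv of_nat_poly)
qed

text \<open>In the coordinates \<open>x = \<delta>\<close>, \<open>y = \<delta> z\<close>, this is \<open>\<delta> \<partial>/\<partial>x\<close>, and \<open>\<partial>/\<partial>z\<close> is \<open>\<delta> \<partial>/\<partial>y\<close>.\<close>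
definition delta_dx :: "complex poly poly poly \<Rightarrow> complex poly poly poly" where
  "delta_dx p = [:0, 1:] * pderiv p + (- [:[:0, 1:]:]) * map_poly pderiv p"

lemma derivation_delta_dx: "derivation delta_dx"
  unfolding delta_dx_def [abs_def]
  by (intro derivation_plus derivation.map_poly derivation.mult_right derivation_pderiv)

lemma coeff_delta_dx: "coeff (delta_dx p) i = of_nat i * coeff p i - [:0, 1:] * pderiv (coeff p i)"
  by (cases i) (simp_all add: delta_dx_def coeff_map_poly coeff_pderiv of_nat_poly)

lemma derivation_dz: "derivation (map_poly pderiv :: complex poly poly poly \<Rightarrow> _)"
  by (intro derivation.map_poly derivation_pderiv)

section \<open>The form built from the differentials of the first integrals\<close>

text \<open>A determinant as a function of its family of rows, so that multilinearity can be stated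
  with function update.\<close>

definition rdet :: "('n::finite \<Rightarrow> complex ^ 'n) \<Rightarrow> complex" where
  "rdet f = det (\<chi> j. f j)"

lemma rdet_upd: "rdet (f(a := x)) = det (\<chi> j. if j = a then x else f j)"
  unfolding rdet_def by (rule arg_cong [of _ _ det]) (simp add: vec_eq_iff)

lemma rdet_add: "rdet (f(a := x + y)) = rdet (f(a := x)) + rdet (f(a := y))"
  unfolding rdet_upd by (rule det_row_add)

lemma rdet_scale: "rdet (f(a := c *s x)) = c * rdet (f(a := x))"
  unfolding rdet_upd by (rule det_row_mul)

lemma rdet_minus: "rdet (f(a := - x)) = - rdet (f(a := x))"
  using rdet_scale [of f a "- 1" x] by simp

lemma rdet_zero: "rdet (f(a := 0)) = 0"
  using rdet_scale [of f a 0 0] by simp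

lemma rdet_sum: "rdet (f(a := \<Sum>i\<in>S. x i)) = (\<Sum>i\<in>S. rdet (f(a := x i)))"
  by (induction S rule: infinite_finite_induct)
    (simp_all only: sum.infinite sum.empty sum.insert rdet_zero rdet_add not_False_eq_True)

lemma rdet_eq: "f a = f b \<Longrightarrow> a \<noteq> b \<Longrightarrow> rdet f = 0"
  unfolding rdet_def by (rule det_identical_rows [of a b]) (simp_all add: row_def)

lemma rdet_swap:
  assumes "a \<noteq> b"
  shows "rdet (f(a := x, b := y)) = - rdet (f(a := y, b := x))"
proof -
  have "0 = rdet (f(a := x + y, b := x + y))" using assms by (intro rdet_eq [symmetric, of _ a b]) auto
  also have "\<dots> = rdet (f(a := x + y, b := x)) + rdet (f(a := x + y, b := y))" by (rule rdet_add)
  also have "rdet (f(a := x + y, b := x)) = rdet (f(a := x, b := x)) + rdet (f(a := y, b := x))"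
    using assms by (simp add: fun_upd_twist [of a b] rdet_add)
  also have "rdet (f(a := x + y, b := y)) = rdet (f(a := x, b := y)) + rdet (f(a := y, b := y))"
    using assms by (simp add: fun_upd_twist [of a b] rdet_add)
  also have "rdet (f(a := x, b := x)) = 0" using assms by (intro rdet_eq [of _ a b]) auto
  also have "rdet (f(a := y, b := y)) = 0" using assms by (intro rdet_eq [of _ a b]) auto
  finally show ?thesis
    by (simp only: add_0_left add_0_right eq_neg_iff_add_eq_0 add.commute)
qed

lemma rdet_expand: "rdet (f(a := x)) = (\<Sum>i\<in>UNIV. x $ i * rdet (f(a := axis i 1)))"
proof -
  have "x = (\<Sum>i\<in>UNIV. x $ i *s axis i 1)" by (simp add: basis_expansion)
  then have "rdet (f(a := x)) = rdet (f(a := \<Sum>i\<in>UNIV. x $ i *s axis i 1))" by simp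
  then show ?thesis by (simp only: rdet_sum rdet_scale)
qed

text \<open>The combinatorial core of \<open>d (dF\<^sub>1 \<and> \<dots> \<and> dF\<^sub>n) = 0\<close>; \<open>T\<close> stands for the Hessians.\<close>
lemma rdet_closed:
  fixes r :: "'e \<Rightarrow> complex ^ 'n::finite" and T :: "'e \<Rightarrow> 'e \<Rightarrow> complex ^ 'n" and v :: "'n \<Rightarrow> 'e"
  assumes sym: "\<And>u w. T u w = T w u"
  defines "N \<equiv> \<lambda>u v. \<Sum>j\<in>UNIV. rdet ((\<lambda>i. r (v i))(j := T u (v j)))"
  shows "N x (v(a := y)) - N y (v(a := x)) = (\<Sum>b\<in>UNIV - {a}. N (v b) (v(a := y, b := x)))"
proof -
  define g where "g = (\<lambda>i. r (v i))"
  have up: "(\<lambda>i. r ((v(a := y)) i)) = g(a := r y)" for y by (auto simp: g_def)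
  have up2: "(\<lambda>i. r ((v(a := y, b := x)) i)) = g(a := r y, b := r x)" for x y b by (auto simp: g_def)
  have N1: "N x (v(a := y)) = rdet (g(a := T x y)) + (\<Sum>b\<in>UNIV - {a}. rdet (g(a := r y, b := T x (v b))))" for x y
    unfolding N_def up by (subst sum.remove [of _ a]) (auto intro!: sum.cong)
  define h where "h b c = rdet (g(a := r y, b := r x, c := T (v b) (v c)))" for b c
  have N2: "N (v b) (v(a := y, b := x)) = rdet (g(a := T (v b) y, b := r x)) + rdet (g(a := r y, b := T (v b) x))
      + (\<Sum>c\<in>UNIV - {a} - {b}. h b c)" if "b \<in> UNIV - {a}" for b
  proof -
    have "(\<Sum>j\<in>UNIV - {a}. rdet ((g(a := r y, b := r x))(j := T (v b) ((v(a := y, b := x)) j))))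
        = rdet (g(a := r y, b := T (v b) x)) + (\<Sum>c\<in>UNIV - {a} - {b}. h b c)"
      using that by (subst sum.remove [of _ b]) (auto intro!: sum.cong simp: h_def)
    moreover have "(g(a := r y, b := r x))(a := T (v b) ((v(a := y, b := x)) a)) = g(a := T (v b) y, b := r x)"
      using that by (auto simp: fun_eq_iff)
    ultimately show ?thesis
      unfolding N_def up2 by (subst sum.remove [of _ a]) auto
  qed
  \<comment> \<open>Terms whose second derivative avoids the slots of both \<open>x\<close> and
    \<open>y\<close> cancel in pairs: exchanging \<open>b\<close> and \<open>c\<close> swaps two
    rows and leaves the symmetric \<open>T\<close> alone.\<close>
  have "(\<Sum>b\<in>UNIV - {a}. \<Sum>c\<in>UNIV - {a} - {b}. h b c) = 0"
  proof -
    have sw: "h b c = - h c b" if "b \<in> UNIV - {a}" "c \<in> UNIV - {a} - {b}" for b c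
      using that unfolding h_def by (subst rdet_swap) (auto simp: sym fun_upd_twist [of b c])
    let ?P = "SIGMA b:UNIV - {a}. UNIV - {a} - {b}"
    have "(\<Sum>(b, c)\<in>?P. h b c) = (\<Sum>(b, c)\<in>?P. h c b)"
      by (rule sum.reindex_bij_witness [of _ prod.swap prod.swap]) auto
    also have "\<dots> = (\<Sum>(b, c)\<in>?P. - h b c)"
      by (rule sum.cong) (use sw in force)+
    also have "\<dots> = - (\<Sum>(b, c)\<in>?P. h b c)"
      by (simp add: sum_negf case_prod_beta)
    finally have "(\<Sum>(b, c)\<in>?P. h b c) = 0" by simp
    then show ?thesis by (simp add: sum.Sigma)
  qed
  then have "(\<Sum>b\<in>UNIV - {a}. N (v b) (v(a := y, b := x)))
      = (\<Sum>b\<in>UNIV - {a}. rdet (g(a := T (v b) y, b := r x)) + rdet (g(a := r y, b := T (v b) x)))"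
    by (simp add: N2 sum.distrib)
  also have "\<dots> = (\<Sum>b\<in>UNIV - {a}. rdet (g(a := r y, b := T x (v b))) - rdet (g(a := r x, b := T y (v b))))"
  proof (rule sum.cong)
    fix b assume "b \<in> UNIV - {a}"
    then have "rdet (g(a := T (v b) y, b := r x)) = - rdet (g(a := r x, b := T (v b) y))"
      by (intro rdet_swap) auto
    then show "rdet (g(a := T (v b) y, b := r x)) + rdet (g(a := r y, b := T (v b) x))
        = rdet (g(a := r y, b := T x (v b))) - rdet (g(a := r x, b := T y (v b)))"
      by (simp add: sym [of "v b"])
  qed simp
  finally show ?thesis unfolding N1 by (simp add: sum_subtractf sym [of x y])
qed

section \<open>Derivatives of products and determinants\<close>

lemma partial_prod:
  assumes "finite A" "\<And>i. i \<in> A \<Longrightarrow> polyfun (f i)"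
  shows "partial v (\<lambda>x. \<Prod>i\<in>A. f i x) x = (\<Sum>i\<in>A. partial v (f i) x * (\<Prod>k\<in>A - {i}. f k x))"
  using assms
proof (induction A rule: finite_induct)
  case (insert a A)
  have "(\<Sum>i\<in>A. partial v (f i) x * (\<Prod>k\<in>insert a A - {i}. f k x))
      = (\<Sum>i\<in>A. f a x * (partial v (f i) x * (\<Prod>k\<in>A - {i}. f k x)))"
  proof (rule sum.cong)
    fix i assume "i \<in> A"
    then have "insert a A - {i} = insert a (A - {i})" using insert by auto
    then show "partial v (f i) x * (\<Prod>k\<in>insert a A - {i}. f k x)
        = f a x * (partial v (f i) x * (\<Prod>k\<in>A - {i}. f k x))"
      using insert by simp
  qed simp
  then show ?case
    using insert by (simp add: partial_mult polyfun_prod sum_distrib_left)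
qed simp

definition dirderiv :: "complex ^ 'v::finite \<Rightarrow> (complex ^ 'v \<Rightarrow> complex) \<Rightarrow> complex ^ 'v \<Rightarrow> complex" where
  "dirderiv u f x = (\<Sum>k\<in>UNIV. u $ k * partial k f x)"

lemma polyfun_dirderiv [intro]: "polyfun f \<Longrightarrow> polyfun (dirderiv u f)"
  unfolding dirderiv_def [abs_def] by (intro polyfun_sum polyfun_cmult polyfun_partial)

lemma dirderiv_prod:
  assumes "finite A" "\<And>i. i \<in> A \<Longrightarrow> polyfun (f i)"
  shows "dirderiv u (\<lambda>x. \<Prod>i\<in>A. f i x) x = (\<Sum>i\<in>A. dirderiv u (f i) x * (\<Prod>k\<in>A - {i}. f k x))"
proof -
  have "partial k (\<lambda>x. \<Prod>i\<in>A. f i x) x = (\<Sum>i\<in>A. partial k (f i) x * (\<Prod>k\<in>A - {i}. f k x))" for k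
    by (rule partial_prod) (use assms in auto)
  then show ?thesis
    unfolding dirderiv_def by (simp add: sum_distrib_left sum_distrib_right mult.assoc sum.swap [of _ A])
qed

lemma dirderiv_sum:
  "(\<And>i. i \<in> A \<Longrightarrow> polyfun (f i)) \<Longrightarrow> dirderiv u (\<lambda>x. \<Sum>i\<in>A. f i x) x = (\<Sum>i\<in>A. dirderiv u (f i) x)"
  unfolding dirderiv_def by (simp add: partial_sum sum_distrib_left sum.swap [of _ A])

lemma dirderiv_cmult: "polyfun f \<Longrightarrow> dirderiv u (\<lambda>x. c * f x) x = c * dirderiv u f x"
  unfolding dirderiv_def by (simp add: partial_cmult sum_distrib_left algebra_simps)

lemma dirderiv_mult:
  "polyfun f \<Longrightarrow> polyfun g \<Longrightarrow> dirderiv u (\<lambda>x. f x * g x) x = dirderiv u f x * g x + f x * dirderiv u g x"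
  unfolding dirderiv_def
  by (simp add: partial_mult sum_distrib_left sum_distrib_right sum.distrib algebra_simps)

lemma rdet_def': "rdet f = (\<Sum>p | p permutes UNIV. of_int (sign p) * (\<Prod>i\<in>UNIV. f i $ p i))"
  by (simp add: rdet_def det_def)

lemma polyfun_rdet [intro]:
  "(\<And>j i. polyfun (\<lambda>x. A x j $ i)) \<Longrightarrow> polyfun (\<lambda>x. rdet (A x))"
  unfolding rdet_def' by (intro polyfun_sum polyfun_cmult polyfun_prod)

text \<open>Leibniz rule over the rows, twisted by a diagonal connection: subtracting
  \<open>kappa i\<close> in column \<open>i\<close> costs the trace. It will be used with
  \<open>kappa i\<close> the logarithmic derivative of the squared i-th denominator, which
  differentiates \<open>Om / G\<close> without forming the quotient.\<close>

lemma dirderiv_rdet: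
  fixes A :: "complex ^ 'v::finite \<Rightarrow> 'n::finite \<Rightarrow> complex ^ 'n"
  assumes A: "\<And>j i. polyfun (\<lambda>x. A x j $ i)"
  shows "dirderiv u (\<lambda>x. rdet (A x)) x - (\<Sum>i\<in>UNIV. kappa i) * rdet (A x)
    = (\<Sum>j\<in>UNIV. rdet ((A x)(j := \<chi> i. dirderiv u (\<lambda>x. A x j $ i) x - kappa i * A x j $ i)))"
proof -
  have "dirderiv u (\<lambda>x. rdet (A x)) x = (\<Sum>p | p permutes UNIV. of_int (sign p) *
      (\<Sum>j\<in>UNIV. dirderiv u (\<lambda>x. A x j $ p j) x * (\<Prod>k\<in>UNIV - {j}. A x k $ p k)))"
    unfolding rdet_def'
    by (subst dirderiv_sum, intro polyfun_cmult polyfun_prod A, rule sum.cong, simp,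
        subst dirderiv_cmult, intro polyfun_prod A, subst dirderiv_prod, simp, rule A, simp)
  moreover have "(\<Sum>i\<in>UNIV. kappa i) * rdet (A x) = (\<Sum>p | p permutes UNIV. of_int (sign p) *
      (\<Sum>j\<in>UNIV. kappa (p j) * A x j $ p j * (\<Prod>k\<in>UNIV - {j}. A x k $ p k)))"
  proof -
    have "(\<Sum>i\<in>UNIV. kappa i) * (\<Prod>i\<in>UNIV. A x i $ p i)
        = (\<Sum>j\<in>UNIV. kappa (p j) * A x j $ p j * (\<Prod>k\<in>UNIV - {j}. A x k $ p k))" if "p permutes UNIV" for p
    proof -
      have "(\<Sum>i\<in>UNIV. kappa i) = (\<Sum>j\<in>UNIV. kappa (p j))"
        using that by (metis sum.permute o_def sum.cong)
      moreover have "(\<Prod>i\<in>UNIV. A x i $ p i) = A x j $ p j * (\<Prod>k\<in>UNIV - {j}. A x k $ p k)" for j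
        by (rule prod.remove) auto
      ultimately show ?thesis by (simp add: sum_distrib_right mult.assoc)
    qed
    then have "(\<Sum>i\<in>UNIV. kappa i) * (of_int (sign p) * (\<Prod>i\<in>UNIV. A x i $ p i)) = of_int (sign p) *
      (\<Sum>j\<in>UNIV. kappa (p j) * A x j $ p j * (\<Prod>k\<in>UNIV - {j}. A x k $ p k))" if "p permutes UNIV" for p
      using that by (simp only: mult.left_commute [of "\<Sum>i\<in>UNIV. kappa i"])
    then show ?thesis
      unfolding rdet_def' sum_distrib_left [of "\<Sum>i\<in>UNIV. kappa i"] by (intro sum.cong) auto
  qed
  moreover have "(\<Sum>j\<in>UNIV. rdet ((A x)(j := \<chi> i. dirderiv u (\<lambda>x. A x j $ i) x - kappa i * A x j $ i)))
      = (\<Sum>p | p permutes UNIV. of_int (sign p) *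
        (\<Sum>j\<in>UNIV. (dirderiv u (\<lambda>x. A x j $ p j) x - kappa (p j) * A x j $ p j) * (\<Prod>k\<in>UNIV - {j}. A x k $ p k)))"
    unfolding rdet_def' sum_distrib_left
    by (subst sum.swap, intro sum.cong refl, subst prod.remove [of UNIV], auto intro!: prod.cong simp: mult.assoc)
  ultimately show ?thesis
    by (simp add: sum_subtractf left_diff_distrib right_diff_distrib)
qed

section \<open>Construction of the form from the first integrals\<close>

definition linearization :: "('v \<Rightarrow> complex ^ 'v \<Rightarrow> complex) \<Rightarrow> complex ^ 'v \<Rightarrow> complex ^ 'v \<Rightarrow> complex ^ 'v::finite" where
  "linearization X x u = (\<chi> l. dirderiv u (X l) x)"

text \<open>
  \<open>Om / G\<close> is the \<open>n\<close>-form \<open>dF\<^sub>1 \<and> \<dots> \<and> dF\<^sub>n\<close> of commuting first integrals of the vector field \<open>X\<close>: it is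
  invariant under the flow, closed, and its rows span an isotropic space.
\<close>
locale invariant_form =
  fixes Om :: "('n::finite \<Rightarrow> complex ^ ('n + 'n)) \<Rightarrow> complex ^ ('n + 'n) \<Rightarrow> complex"
    and G :: "complex ^ ('n + 'n) \<Rightarrow> complex"
    and X :: "'n + 'n \<Rightarrow> complex ^ ('n + 'n) \<Rightarrow> complex"
  assumes polyfun_Om: "polyfun (Om v)"
    and polyfun_G: "polyfun G"
    and polyfun_X: "polyfun (X k)"
    and Om_add: "Om (v(a := u + w)) x = Om (v(a := u)) x + Om (v(a := w)) x"
    and Om_scale: "Om (v(a := c *s u)) x = c * Om (v(a := u)) x"
    and Om_alternating: "v a = v b \<Longrightarrow> a \<noteq> b \<Longrightarrow> Om v x = 0"
    and G_nonzero: "\<exists>x. G x \<noteq> 0"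
    and Om_nonzero: "\<exists>v x. Om v x \<noteq> 0"
    and Om_invariant: "G x * dirderiv (\<chi> k. X k x) (Om v) x - Om v x * dirderiv (\<chi> k. X k x) G x
        + G x * (\<Sum>j\<in>UNIV. Om (v(j := linearization X x (v j))) x) = 0"
    and Om_closed: "(G x * dirderiv u (Om (v(a := w))) x - Om (v(a := w)) x * dirderiv u G x)
        - (G x * dirderiv w (Om (v(a := u))) x - Om (v(a := u)) x * dirderiv w G x)
        = (\<Sum>b\<in>UNIV - {a}. G x * dirderiv (v b) (Om (v(a := w, b := u))) x
            - Om (v(a := w, b := u)) x * dirderiv (v b) G x)"
    and Om_isotropic: "(\<Sum>k\<in>UNIV. Om (v(a := axis (Inl k) 1)) x * Om (v'(b := axis (Inr k) 1)) x
        - Om (v(a := axis (Inr k) 1)) x * Om (v'(b := axis (Inl k) 1)) x) = 0"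

lemma partial_rational:
  fixes F :: "complex ^ 'v::finite \<Rightarrow> complex"
  assumes "open U" "x \<in> U" "polyfun p" "polyfun q" "\<And>x. x \<in> U \<Longrightarrow> q x \<noteq> 0 \<and> F x = p x / q x"
  shows "partial k F x = (q x * partial k p x - p x * partial k q x) / (q x)\<^sup>2"
proof (rule partial_eqI)
  define c where "c z = (\<chi> w. if w = k then z else x $ w)" for z
  have cx: "c (x $ k) = x" by (simp add: c_def vec_eq_iff)
  have "open (c -` U)"
  proof (rule open_vimage [OF \<open>open U\<close>])
    have "continuous_on UNIV (\<lambda>z. if w = k then z else x $ w)" for w
      by (cases "w = k") simp_all
    then show "continuous_on UNIV c" unfolding c_def by (rule continuous_on_vec_lambda)
  qed
  note op = this
  have d: "((\<lambda>z. p (c z) / q (c z)) has_field_derivative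
      (partial k p x * q (c (x $ k)) - p (c (x $ k)) * partial k q x) / (q (c (x $ k)) * q (c (x $ k)))) (at (x $ k))"
    unfolding c_def
    by (rule DERIV_divide; (rule polyfun_partial_derivative | fold c_def)) (use assms cx in auto)
  have "((\<lambda>z. F (c z)) has_field_derivative
      (partial k p x * q (c (x $ k)) - p (c (x $ k)) * partial k q x) / (q (c (x $ k)) * q (c (x $ k)))) (at (x $ k))"
    by (rule has_field_derivative_transform_within_open [OF d op]) (use assms cx in auto)
  then show "((\<lambda>z. F (\<chi> w. if w = k then z else x $ w)) has_field_derivative
      (q x * partial k p x - p x * partial k q x) / (q x)\<^sup>2) (at (x $ k))"
    unfolding cx by (simp add: c_def power2_eq_square mult.commute)
qed

lemma polyfun_position: "polyfun f \<Longrightarrow> polyfun (\<lambda>x :: complex ^ ('n::finite + 'n). f (position x))"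
  by (rule polyfun_compose) (auto simp: position_def)

lemma polyfun_hamiltonian_field: "polyfun (\<lambda>x. hamiltonian_field V x $ k)"
  by (cases k) (auto simp: hamiltonian_field_def intro!: polyfun_uminus polyfun_position polyfun_partial)

lemma integrable_imp_invariant_form:
  fixes V :: "'n::finite cpoly"
  assumes "integrable_with_rational_first_integrals V"
  shows "\<exists>Om G. invariant_form Om G (\<lambda>k x. hamiltonian_field V x $ k)"
proof -
  obtain U and F :: "'n \<Rightarrow> complex ^ ('n + 'n) \<Rightarrow> complex" where
    U: "open U" "closure U = UNIV" and rat: "\<And>i. rational_on U (F i)"
    and fi: "\<And>i. first_integral_on V U (F i)"
    and br: "\<And>i j x. x \<in> U \<Longrightarrow> poisson_bracket (F i) (F j) x = 0"
    and ind: "functionally_independent_on U F"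
    using assms unfolding integrable_with_rational_first_integrals_def by blast
  obtain P Q where PQ: "\<And>i x. x \<in> U \<Longrightarrow> eval_poly (Q i) x \<noteq> 0 \<and> F i x = eval_poly (P i) x / eval_poly (Q i) x"
    using rat unfolding rational_on_def by metis
  define p where "p i = eval_poly (P i)" for i
  define q where "q i = eval_poly (Q i)" for i
  have pq: "polyfun (p i)" "polyfun (q i)" for i by (auto simp: p_def q_def)
  have q0: "q i x \<noteq> 0" if "x \<in> U" for i x using PQ that by (simp add: q_def)
  define X where "X k x = hamiltonian_field V x $ k" for k x
  have polyX: "polyfun (X k)" for k unfolding X_def [abs_def] by (rule polyfun_hamiltonian_field)
  \<comment> \<open>\<open>R i k\<close> is q_i^2 times the k-th partial derivative of F_i, and
    \<open>r x u\<close> collects the values q_i^2 dF_i(u); both are polynomial on all of phase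
    space.\<close>
  define R where "R i k x = q i x * partial k (p i) x - p i x * partial k (q i) x" for i k x
  have polyR: "polyfun (R i k)" for i k
    unfolding R_def [abs_def] by (intro polyfun_diff polyfun_mult pq polyfun_partial)
  have pF: "partial k (F i) x = R i k x / (q i x)\<^sup>2" if "x \<in> U" for i k x
    unfolding R_def by (rule partial_rational [OF U(1) that pq]) (use PQ in \<open>simp add: p_def q_def\<close>)
  define r where "r x u = (\<chi> i. \<Sum>k\<in>UNIV. u $ k * R i k x)" for x u
  have polyr: "polyfun (\<lambda>x. r x u $ i)" for u i
    unfolding r_def vec_lambda_beta by (intro polyfun_sum polyfun_cmult polyR)
  have r_add: "r x (u + w) = r x u + r x w" and r_scale: "r x (c *s u) = c *s r x u"
    and r_minus: "r x (- u) = - r x u" for x u w c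
    by (simp_all add: r_def vec_eq_iff distrib_right sum.distrib sum_distrib_left mult.assoc sum_negf)
  have rX: "(\<Sum>k\<in>UNIV. X k x * R i k x) = 0" for i x
  proof (rule polyfun_eq_on_dense [OF _ _ U(2)])
    fix x assume x: "x \<in> U"
    have "(\<Sum>k\<in>UNIV. X k x * R i k x) = (q i x)\<^sup>2 * (\<Sum>k\<in>UNIV. partial k (F i) x * hamiltonian_field V x $ k)"
      using q0 [OF x, of i] by (simp add: pF [OF x] X_def sum_distrib_left mult.commute)
    then show "(\<Sum>k\<in>UNIV. X k x * R i k x) = 0"
      using fi x by (simp add: first_integral_on_def)
  qed (auto intro!: polyfun_sum polyfun_mult polyX polyR polyfun_const)
  have iso: "(\<Sum>k\<in>UNIV. R i (Inl k) x * R j (Inr k) x - R i (Inr k) x * R j (Inl k) x) = 0" for i j x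
  proof (rule polyfun_eq_on_dense [OF _ _ U(2)])
    fix x assume x: "x \<in> U"
    have "(\<Sum>k\<in>UNIV. R i (Inl k) x * R j (Inr k) x - R i (Inr k) x * R j (Inl k) x)
        = ((q i x)\<^sup>2 * (q j x)\<^sup>2) * poisson_bracket (F i) (F j) x"
      unfolding poisson_bracket_def sum_distrib_left
      using q0 [OF x, of i] q0 [OF x, of j] by (intro sum.cong) (simp_all add: pF [OF x] field_simps)
    then show "(\<Sum>k\<in>UNIV. R i (Inl k) x * R j (Inr k) x - R i (Inr k) x * R j (Inl k) x) = 0"
      using br x by simp
  qed (auto intro!: polyfun_sum polyfun_diff polyfun_mult polyR polyfun_const)
  define Om where "Om v x = rdet (\<lambda>j. r x (v j))" for v x
  define G where "G x = (\<Prod>i\<in>UNIV. (q i x)\<^sup>2)" for x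
  have Om_upd: "Om (v(a := u)) x = rdet ((\<lambda>j. r x (v j))(a := r x u))" for v a u x
    unfolding Om_def by (rule arg_cong [of _ _ rdet]) auto
  have polyOm: "polyfun (Om v)" for v
    unfolding Om_def [abs_def] by (intro polyfun_rdet polyr)
  have polyG: "polyfun G"
    unfolding G_def [abs_def] by (intro polyfun_prod polyfun_power pq)
  obtain x0 where x0: "x0 \<in> U" using U(2) by (metis closure_empty UNIV_not_empty ex_in_conv)
  define K where "K x u i = 2 * dirderiv u (q i) x / q i x" for x u i
  have dG: "dirderiv u G x = (\<Sum>i\<in>UNIV. K x u i) * G x" if x: "x \<in> U" for x u
  proof -
    have "dirderiv u (\<lambda>x. (q i x)\<^sup>2) x = K x u i * (q i x)\<^sup>2" for i
      unfolding power2_eq_square using q0 [OF x, of i] pq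
      by (simp add: dirderiv_mult K_def field_simps)
    moreover have "G x = (q i x)\<^sup>2 * (\<Prod>k\<in>UNIV - {i}. (q k x)\<^sup>2)" for i
      unfolding G_def by (rule prod.remove) auto
    ultimately show ?thesis
      unfolding G_def [abs_def]
      by (subst dirderiv_prod) (auto intro!: polyfun_power pq simp: sum_distrib_right mult.assoc G_def)
  qed
  \<comment> \<open>Component i is q_i^2 times the Hessian of F_i: the term with \<open>K\<close>
    removes the derivative of the factor q_i^2. This is the source of the symmetry in
    \<open>u\<close> and \<open>w\<close>.\<close>
  define T where "T x u w = (\<chi> i. dirderiv u (\<lambda>x. r x w $ i) x - K x u i * r x w $ i)" for x u w
  have dr: "dirderiv u (\<lambda>x. r x w $ i) x = (\<Sum>l\<in>UNIV. w $ l * dirderiv u (R i l) x)" for u w i x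
    unfolding r_def vec_lambda_beta
    by (subst dirderiv_sum) (auto simp: dirderiv_cmult polyR intro!: polyfun_cmult)
  have symT: "T x u w = T x w u" if x: "x \<in> U" for x u w
  proof -
    define t where "t i k l = partial k (R i l) x - 2 * partial k (q i) x / q i x * R i l x" for i k l
    have tsym: "t i k l = t i l k" for i k l
    proof -
      have pR: "partial k (R i l) x = partial k (q i) x * partial l (p i) x + q i x * partial k (partial l (p i)) x
          - (partial k (p i) x * partial l (q i) x + p i x * partial k (partial l (q i)) x)" for k l
        unfolding R_def [abs_def] using pq
        by (subst partial_diff) (auto intro!: polyfun_mult polyfun_partial
            simp: partial_mult polyfun_partial)
      show ?thesis
        using q0 [OF x, of i] partial_commute [OF pq(1), of k l i x] partial_commute [OF pq(2), of k l i x]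
        by (simp add: t_def pR R_def field_simps)
    qed
    have Tt: "T x u w $ i = (\<Sum>k\<in>UNIV. \<Sum>l\<in>UNIV. u $ k * w $ l * t i k l)" for u w i
    proof -
      have "T x u w $ i = (\<Sum>l\<in>UNIV. \<Sum>k\<in>UNIV. w $ l * (u $ k * partial k (R i l) x))
          - (\<Sum>l\<in>UNIV. \<Sum>k\<in>UNIV. 2 * (u $ k * partial k (q i) x) / q i x * (w $ l * R i l x))"
        unfolding T_def vec_lambda_beta dr
        by (simp add: K_def r_def dirderiv_def sum_distrib_left sum_distrib_right sum_divide_distrib)
      also have "\<dots> = (\<Sum>l\<in>UNIV. \<Sum>k\<in>UNIV. u $ k * w $ l * t i k l)"
        unfolding sum_subtractf [symmetric] t_def by (intro sum.cong) (simp_all add: algebra_simps)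
      also have "\<dots> = (\<Sum>k\<in>UNIV. \<Sum>l\<in>UNIV. u $ k * w $ l * t i k l)" by (rule sum.swap)
      finally show ?thesis .
    qed
    have "T x u w $ i = T x w u $ i" for i
    proof -
      have "T x u w $ i = (\<Sum>l\<in>UNIV. \<Sum>k\<in>UNIV. u $ k * w $ l * t i k l)"
        unfolding Tt by (rule sum.swap)
      also have "\<dots> = T x w u $ i"
        unfolding Tt by (intro sum.cong refl) (simp add: tsym mult.commute)
      finally show ?thesis .
    qed
    then show ?thesis by (simp add: vec_eq_iff)
  qed
  define N where "N x u v = (\<Sum>j\<in>UNIV. rdet ((\<lambda>i. r x (v i))(j := T x u (v j))))" for x u v
  \<comment> \<open>The left-hand side is G^2 times the derivative of \<open>Om / G\<close>.\<close>
  have nab: "G x * dirderiv u (Om v) x - Om v x * dirderiv u G x = G x * N x u v" if x: "x \<in> U" for x u v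
  proof -
    have "dirderiv u (Om v) x - (\<Sum>i\<in>UNIV. K x u i) * Om v x = N x u v"
      unfolding Om_def [abs_def] N_def T_def by (rule dirderiv_rdet) (rule polyr)
    then have "N x u v = dirderiv u (Om v) x - (\<Sum>i\<in>UNIV. K x u i) * Om v x" by simp
    then show ?thesis by (simp only: dG [OF x]) (simp add: algebra_simps)
  qed
  have "invariant_form Om G X"
  proof
    show "Om (v(a := u + w)) x = Om (v(a := u)) x + Om (v(a := w)) x" for v a u w x
      unfolding Om_upd r_add by (rule rdet_add)
    show scale: "Om (v(a := c *s u)) x = c * Om (v(a := u)) x" for v a c u x
      unfolding Om_upd r_scale by (rule rdet_scale)
    show "Om v x = 0" if "v a = v b" "a \<noteq> b" for v a b x
      unfolding Om_def by (rule rdet_eq [of _ a b]) (use that in auto)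
    show "\<exists>x. G x \<noteq> 0" using q0 [OF x0] by (auto simp: G_def)
    show "\<exists>v x. Om v x \<noteq> 0"
    proof -
      define A where "A = (\<chi> i k. partial k (F i) x0)"
      have "\<exists>B. A ** B = mat 1"
        unfolding matrix_right_invertible_independent_rows
      proof (intro allI impI)
        fix c i assume c: "(\<Sum>i\<in>UNIV. c i *s row i A) = 0"
        have "(\<Sum>i\<in>UNIV. c i * partial v (F i) x0) = 0" for v
          using arg_cong [OF c, of "\<lambda>u. u $ v"] by (simp add: A_def row_def)
        then show "c i = 0" using ind x0 unfolding functionally_independent_on_def by blast
      qed
      then obtain B where B: "A ** B = mat 1" by blast
      \<comment> \<open>Columns of a right inverse of the Jacobian: on them the differentials form
        the identity matrix, and \<open>Om\<close> reduces to \<open>G\<close>.\<close>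
      define v where "v j = (\<chi> k. B $ k $ j)" for j
      have "r x0 (v j) $ i = (if i = j then (q i x0)\<^sup>2 else 0)" for i j
      proof -
        have "r x0 (v j) $ i = (q i x0)\<^sup>2 * (\<Sum>k\<in>UNIV. A $ i $ k * B $ k $ j)"
          using q0 [OF x0, of i] by (simp add: r_def v_def A_def pF [OF x0] sum_distrib_left mult.commute)
        also have "(\<Sum>k\<in>UNIV. A $ i $ k * B $ k $ j) = (if i = j then 1 else 0)"
          using arg_cong [OF B, of "\<lambda>M. M $ i $ j"] by (simp add: matrix_matrix_mult_def mat_def)
        finally show ?thesis by simp
      qed
      then have "Om v x0 = G x0"
        unfolding Om_def rdet_def G_def by (subst det_diagonal) auto
      then show ?thesis using q0 [OF x0] by (auto simp: G_def intro!: exI [of _ v] exI [of _ x0])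
    qed
    show "G x * dirderiv (\<chi> k. X k x) (Om v) x - Om v x * dirderiv (\<chi> k. X k x) G x
        + G x * (\<Sum>j\<in>UNIV. Om (v(j := linearization X x (v j))) x) = 0" for x v
    proof (rule polyfun_eq_on_dense [OF _ _ U(2)])
      fix x assume x: "x \<in> U"
      let ?X = "\<chi> k. X k x"
      have "T x ?X w = - r x (linearization X x w)" for w
      proof -
        have "r x ?X = 0" by (simp add: r_def vec_eq_iff rX)
        moreover have "dirderiv w (\<lambda>x'. r x' ?X $ i) x = - r x (linearization X x w) $ i" for i
        proof -
          \<comment> \<open>Differentiate dF_i(X) = 0 in direction \<open>w\<close>: the Hessian on
            (w, X) is minus dF_i on the linearized field at \<open>w\<close>. By symmetry this is
            also the derivative of dF_i(w) along X.\<close>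
          have "0 = dirderiv w (\<lambda>x. \<Sum>k\<in>UNIV. X k x * R i k x) x"
            by (simp add: rX dirderiv_def)
          also have "\<dots> = (\<Sum>k\<in>UNIV. dirderiv w (X k) x * R i k x + X k x * dirderiv w (R i k) x)"
            by (subst dirderiv_sum) (auto intro!: polyfun_mult polyX polyR simp: dirderiv_mult polyX polyR)
          finally have "0 = r x (linearization X x w) $ i + dirderiv w (\<lambda>x'. r x' ?X $ i) x"
            unfolding dr by (simp add: r_def linearization_def sum.distrib)
          then show ?thesis by (simp add: eq_neg_iff_add_eq_0 add.commute)
        qed
        ultimately have "T x w ?X = - r x (linearization X x w)"
          by (simp add: T_def vec_eq_iff)
        then show ?thesis using symT [OF x] by simp
      qed
      then have "N x ?X v = - (\<Sum>j\<in>UNIV. Om (v(j := linearization X x (v j))) x)"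
        by (simp add: N_def Om_upd rdet_minus sum_negf del: fun_upd_apply)
      then show "G x * dirderiv ?X (Om v) x - Om v x * dirderiv ?X G x
          + G x * (\<Sum>j\<in>UNIV. Om (v(j := linearization X x (v j))) x) = 0"
        by (simp add: nab [OF x])
    next
      \<comment> \<open>The linearized field varies with the point, so polynomiality of the last
        term requires this slot to be expanded in the standard basis.\<close>
      have Om_exp: "Om (v(j := u)) x = (\<Sum>l\<in>UNIV. u $ l * Om (v(j := axis l 1)) x)" for j u x
      proof -
        have "r x u = (\<Sum>l\<in>UNIV. u $ l *s r x (axis l 1))"
          by (simp add: r_def vec_eq_iff axis_def if_distrib [of "\<lambda>x. x * _"] cong: if_cong)
        then show ?thesis unfolding Om_upd by (simp only: rdet_sum rdet_scale)
      qed
      show "polyfun (\<lambda>x. G x * dirderiv (\<chi> k. X k x) (Om v) x - Om v x * dirderiv (\<chi> k. X k x) G x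
        + G x * (\<Sum>j\<in>UNIV. Om (v(j := linearization X x (v j))) x))"
        unfolding dirderiv_def linearization_def Om_exp [of _ "\<chi> l. _ l"] vec_lambda_beta
        by (intro polyfun_add polyfun_diff polyfun_mult polyfun_sum polyG polyOm polyX
            polyfun_partial polyfun_const)
    qed (rule polyfun_const)
    show "(G x * dirderiv u (Om (v(a := w))) x - Om (v(a := w)) x * dirderiv u G x)
        - (G x * dirderiv w (Om (v(a := u))) x - Om (v(a := u)) x * dirderiv w G x)
        = (\<Sum>b\<in>UNIV - {a}. G x * dirderiv (v b) (Om (v(a := w, b := u))) x
            - Om (v(a := w, b := u)) x * dirderiv (v b) G x)" for x u v a w
    proof (rule polyfun_eq_on_dense [OF _ _ U(2)])
      fix x assume x: "x \<in> U"
      have "N x u (v(a := w)) - N x w (v(a := u)) = (\<Sum>b\<in>UNIV - {a}. N x (v b) (v(a := w, b := u)))"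
        unfolding N_def by (rule rdet_closed) (rule symT [OF x])
      then show "(G x * dirderiv u (Om (v(a := w))) x - Om (v(a := w)) x * dirderiv u G x)
        - (G x * dirderiv w (Om (v(a := u))) x - Om (v(a := u)) x * dirderiv w G x)
        = (\<Sum>b\<in>UNIV - {a}. G x * dirderiv (v b) (Om (v(a := w, b := u))) x
            - Om (v(a := w, b := u)) x * dirderiv (v b) G x)"
        by (simp only: nab [OF x] right_diff_distrib [symmetric] sum_distrib_left [symmetric])
    qed (intro polyfun_add polyfun_diff polyfun_mult polyfun_sum polyG polyOm polyfun_dirderiv)+
    show "(\<Sum>k\<in>UNIV. Om (v(a := axis (Inl k) 1)) x * Om (v'(b := axis (Inr k) 1)) x
        - Om (v(a := axis (Inr k) 1)) x * Om (v'(b := axis (Inl k) 1)) x) = 0" for v v' a b x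
    proof -
      define c where "c i = rdet ((\<lambda>j. r x (v j))(a := axis i 1))" for i
      define c' where "c' i = rdet ((\<lambda>j. r x (v' j))(b := axis i 1))" for i
      have ra: "r x (axis l 1) $ i = R i l x" for i l
        by (simp add: r_def axis_def if_distrib [of "\<lambda>x. x * _"] cong: if_cong)
      \<comment> \<open>Filling all slots but one leaves a covector in the span of the dF_i, and
        these pairwise Poisson commute.\<close>
      have e: "Om (v(a := axis l 1)) x = (\<Sum>i\<in>UNIV. R i l x * c i)"
        and e': "Om (v'(b := axis l 1)) x = (\<Sum>i\<in>UNIV. R i l x * c' i)" for l
        unfolding Om_upd c_def c'_def by (subst rdet_expand, simp add: ra)+
      have "(\<Sum>k\<in>UNIV. (\<Sum>i\<in>UNIV. R i (Inl k) x * c i) * (\<Sum>j\<in>UNIV. R j (Inr k) x * c' j)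
          - (\<Sum>i\<in>UNIV. R i (Inr k) x * c i) * (\<Sum>j\<in>UNIV. R j (Inl k) x * c' j))
        = (\<Sum>k\<in>UNIV. \<Sum>i\<in>UNIV. \<Sum>j\<in>UNIV. c i * c' j * (R i (Inl k) x * R j (Inr k) x - R i (Inr k) x * R j (Inl k) x))"
        unfolding sum_product sum_subtractf [symmetric] by (intro sum.cong) (simp_all add: algebra_simps)
      also have "\<dots> = (\<Sum>i\<in>UNIV. \<Sum>j\<in>UNIV. \<Sum>k\<in>UNIV. c i * c' j * (R i (Inl k) x * R j (Inr k) x - R i (Inr k) x * R j (Inl k) x))"
        by (rule trans [OF sum.swap], rule sum.cong, rule refl, rule sum.swap)
      also have "\<dots> = 0" by (simp add: sum_distrib_left [symmetric] iso)
      finally show ?thesis unfolding e e' .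
    qed
  qed (rule polyOm polyG polyX)+
  then show ?thesis unfolding X_def [abs_def] by blast
qed

section \<open>Linearization along the line through the improper Darboux point\<close>

definition monomial_value :: "('v \<Rightarrow>\<^sub>0 nat) \<Rightarrow> complex ^ 'v::finite \<Rightarrow> complex" where
  "monomial_value m x = (\<Prod>v\<in>UNIV. (x $ v) ^ Poly_Mapping.lookup m v)"

lemma eval_poly_superset:
  assumes "finite S" "Poly_Mapping.keys P \<subseteq> S"
  shows "eval_poly P x = (\<Sum>m\<in>S. Poly_Mapping.lookup P m * monomial_value m x)"
  unfolding eval_poly_def monomial_value_def
  by (rule sum.mono_neutral_left) (use assms in \<open>auto simp: in_keys_iff\<close>)

lemma eval_poly_zero [simp]: "eval_poly 0 x = 0"
  by (simp add: eval_poly_def)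

lemma eval_poly_add: "eval_poly (P + Q) x = eval_poly P x + eval_poly Q x"
proof -
  let ?S = "Poly_Mapping.keys P \<union> Poly_Mapping.keys Q"
  have "eval_poly (P + Q) x = (\<Sum>m\<in>?S. Poly_Mapping.lookup (P + Q) m * monomial_value m x)"
    by (rule eval_poly_superset) (auto simp: in_keys_iff lookup_add)
  also have "\<dots> = eval_poly P x + eval_poly Q x"
    by (simp add: eval_poly_superset [of ?S P] eval_poly_superset [of ?S Q] lookup_add distrib_right sum.distrib)
  finally show ?thesis .
qed

lemma eval_poly_sum: "eval_poly (\<Sum>i\<in>A. P i) x = (\<Sum>i\<in>A. eval_poly (P i) x)"
  by (induction A rule: infinite_finite_induct) (simp_all add: eval_poly_add)

lemma eval_poly_single: "eval_poly (Poly_Mapping.single m c) x = c * monomial_value m x"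
  by (subst eval_poly_superset [of "{m}"]) auto

lemma poly_mapping_sum_single:
  "(\<Sum>m\<in>Poly_Mapping.keys P. Poly_Mapping.single m (Poly_Mapping.lookup P m)) = P"
  by (rule poly_mapping_eqI) (simp add: lookup_sum lookup_single when_def in_keys_iff)

lemma eval_poly_mult: "eval_poly (P * Q) x = eval_poly P x * eval_poly Q x"
proof -
  have mono: "monomial_value (m + m') x = monomial_value m x * monomial_value m' x" for m m'
    by (simp add: monomial_value_def lookup_add power_add prod.distrib)
  have PQ: "P * Q = (\<Sum>m\<in>Poly_Mapping.keys P. \<Sum>m'\<in>Poly_Mapping.keys Q.
      Poly_Mapping.single (m + m') (Poly_Mapping.lookup P m * Poly_Mapping.lookup Q m'))"
  proof -
    have "P * Q = (\<Sum>m\<in>Poly_Mapping.keys P. Poly_Mapping.single m (Poly_Mapping.lookup P m))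
        * (\<Sum>m\<in>Poly_Mapping.keys Q. Poly_Mapping.single m (Poly_Mapping.lookup Q m))"
      by (simp only: poly_mapping_sum_single)
    then show ?thesis by (simp only: sum_product mult_single)
  qed
  have P: "eval_poly P x = (\<Sum>m\<in>Poly_Mapping.keys P. Poly_Mapping.lookup P m * monomial_value m x)"
    and Q: "eval_poly Q x = (\<Sum>m\<in>Poly_Mapping.keys Q. Poly_Mapping.lookup Q m * monomial_value m x)"
    by (rule eval_poly_superset; simp)+
  show ?thesis
    unfolding PQ P Q sum_product eval_poly_sum eval_poly_single mono
    by (intro sum.cong refl) (simp only: mult_ac)
qed

lemma homogeneous_eval_poly:
  assumes "homogeneous_poly k P"
  shows "eval_poly P (s *s x) = s ^ k * eval_poly P x"
proof -
  have "monomial_value m (s *s x) = s ^ k * monomial_value m x" if "m \<in> Poly_Mapping.keys P" for m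
    using assms that
    by (simp add: homogeneous_poly_def monomial_value_def power_mult_distrib prod.distrib flip: power_sum)
  then show ?thesis
    by (simp add: eval_poly_superset [of "Poly_Mapping.keys P" P] sum_distrib_left mult_ac)
qed

lemma coeff_lpoly_0: "polyfun f \<Longrightarrow> coeff (lpoly f X w) 0 = f X"
  using poly_lpoly [of f X w 0] by (simp add: poly_0_coeff_0)

lemma coeff_lpoly_1:
  assumes "polyfun f"
  shows "coeff (lpoly f X w) 1 = (\<Sum>v\<in>UNIV. w $ v * partial v f X)"
proof -
  have "((\<lambda>s. f (X + s *s w)) has_field_derivative (\<Sum>v\<in>UNIV. partial v f (X + 0 *s w) * w $ v)) (at 0)"
    by (rule polyfun_chain [OF assms]) (auto intro!: derivative_eq_intros)
  moreover have "(poly (lpoly f X w) has_field_derivative poly (pderiv (lpoly f X w)) 0) (at 0)"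
    by (rule poly_DERIV)
  moreover have "poly (lpoly f X w) = (\<lambda>s. f (X + s *s w))"
    by (rule ext) (rule poly_lpoly [OF assms])
  ultimately have "poly (pderiv (lpoly f X w)) 0 = (\<Sum>v\<in>UNIV. partial v f (X + 0 *s w) * w $ v)"
    by (simp only: DERIV_unique)
  then show ?thesis by (simp add: poly_0_coeff_0 coeff_pderiv mult.commute)
qed

lemma homogeneous_partial:
  assumes f: "polyfun f" and hom: "\<And>s x. f (s *s x) = s ^ Suc k * f x"
  shows "partial i f (s *s x) = s ^ k * partial i f x"
proof -
  have s: "s * partial i f (s *s x) = s * (s ^ k * partial i f x)" for s
  proof -
    define c where "c z = (\<chi> w. if w = i then z else x $ w)" for z
    have cx: "c (x $ i) = x" by (simp add: c_def vec_eq_iff)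
    have "((\<lambda>z. f (s *s c z)) has_field_derivative
        (\<Sum>v\<in>UNIV. partial v f (s *s c (x $ i)) * (if v = i then s else 0))) (at (x $ i))"
    proof (rule polyfun_chain [OF f])
      show "((\<lambda>z. (s *s c z) $ v) has_field_derivative (if v = i then s else 0)) (at (x $ i))" for v
        by (cases "v = i") (auto simp: c_def intro!: derivative_eq_intros)
    qed
    moreover have "((\<lambda>z. s ^ Suc k * f (c z)) has_field_derivative s ^ Suc k * partial i f x) (at (x $ i))"
      unfolding c_def by (rule DERIV_cmult [OF polyfun_partial_derivative [OF f]])
    ultimately have "(\<Sum>v\<in>UNIV. partial v f (s *s c (x $ i)) * (if v = i then s else 0)) = s ^ Suc k * partial i f x"
      unfolding hom by (rule DERIV_unique)
    then show ?thesis
      by (simp add: cx mult.assoc mult.commute [of s] if_distrib [of "\<lambda>x. _ * x"] cong: if_cong)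
  qed
  \<comment> \<open>Differentiating the homogeneity relation gives the claim up to a factor
    \<open>s\<close>; cancelling it in the polynomial ring covers s = 0 too.\<close>
  define p where "p = lpoly (partial i f) 0 x"
  have p: "poly p s = partial i f (s *s x)" for s
    unfolding p_def using poly_lpoly [OF polyfun_partial [OF f], of i 0 x s] by simp
  have "[:0, 1:] * p = [:0, 1:] * monom (partial i f x) k"
    by (rule poly_eq_poly_eq_iff [THEN iffD1]) (auto simp: p s poly_monom mult.commute)
  then have "p = monom (partial i f x) k" by simp
  then show ?thesis using p [of s] by (simp add: poly_monom mult.commute)
qed

text \<open>The straight line \<open>t \<mapsto> (t d, d)\<close> in phase space is \<open>t \<mapsto> line0 d + t line1 d\<close>.\<close>
definition line0 :: "complex ^ 'n \<Rightarrow> complex ^ ('n::finite + 'n)" where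
  "line0 d = (\<chi> v. case v of Inl i \<Rightarrow> 0 | Inr i \<Rightarrow> d $ i)"

definition line1 :: "complex ^ 'n \<Rightarrow> complex ^ ('n::finite + 'n)" where
  "line1 d = (\<chi> v. case v of Inl i \<Rightarrow> d $ i | Inr i \<Rightarrow> 0)"

definition variational :: "complex \<Rightarrow> nat \<Rightarrow> complex ^ 'n \<Rightarrow> complex \<Rightarrow> complex ^ ('n + 'n) \<Rightarrow> complex ^ ('n::finite + 'n)" where
  "variational a m g t u = (\<chi> v. case v of Inl i \<Rightarrow> u $ Inr i
     | Inr i \<Rightarrow> - (a * t ^ m * (\<Sum>k\<in>UNIV. g $ k * u $ Inl k) * g $ i))"

lemma expansion_position:
  assumes "polyfun f"
  shows "expansion (line0 d) (line1 d) (\<lambda>x. f (position x)) z = lpoly f (z $ None *s d) (position (offset z))"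
  unfolding expansion_def
proof (rule lpoly_eqI)
  have "position (line0 d + z $ None *s line1 d + s *s offset z) = z $ None *s d + s *s position (offset z)" for s
    by (simp add: vec_eq_iff position_def line0_def line1_def)
  then show "poly (lpoly f (z $ None *s d) (position (offset z))) s
      = f (position (line0 d + z $ None *s line1 d + s *s offset z))" for s
    by (simp add: poly_lpoly assms)
qed

text \<open>Because V0(d) = 0, the gradient of V vanishes at d, and of the Hessian only the part in
  which each factor V0 is differentiated once remains. Homogeneity of degrees k - 1 and k - 2
  transports both facts from d to t d.\<close>

lemma expansion_hamiltonian_field:
  fixes V V0 V1 :: "'n::finite cpoly" and d :: "complex ^ 'n"
  assumes hom: "homogeneous_poly k V" and k: "k > 2" and V: "V = V0\<^sup>2 * V1" and d: "eval_poly V0 d = 0"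
  defines "g \<equiv> \<chi> i. partial i (eval_poly V0) d"
  defines "X \<equiv> \<lambda>v x. hamiltonian_field V x $ v"
  defines "ex \<equiv> expansion (line0 d) (line1 d)"
  shows "coeff (ex (X v) z) 0 = line1 d $ v"
    and "coeff (ex (X v) z) 1 = variational (2 * eval_poly V1 d) (k - 2) g (z $ None) (offset z) $ v"
    and "coeff (ex (partial u (X v)) z) 0 = variational (2 * eval_poly V1 d) (k - 2) g (z $ None) (axis u 1) $ v"
proof -
  define f f0 f1 where "f = eval_poly V" and "f0 = eval_poly V0" and "f1 = eval_poly V1"
  have pf: "polyfun f" "polyfun f0" "polyfun f1" by (auto simp: f_def f0_def f1_def)
  have f: "f = (\<lambda>x. f0 x * f0 x * f1 x)"
    by (rule ext) (simp add: f_def f0_def f1_def V power2_eq_square eval_poly_mult)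
  have pdf: "partial i f = (\<lambda>x. (partial i f0 x * f0 x + f0 x * partial i f0 x) * f1 x + f0 x * f0 x * partial i f1 x)" for i
    unfolding f by (rule ext) (simp add: partial_mult pf polyfun_mult)
  have pdf0: "partial i f d = 0" for i
    using d by (simp add: pdf f0_def)
  have hess: "partial j (partial i f) d = 2 * f1 d * g $ j * g $ i" for i j
  proof -
    have "f0 d = 0" using d by (simp add: f0_def)
    then show ?thesis
      unfolding pdf
      by (simp only: partial_add partial_mult pf polyfun_mult polyfun_add polyfun_partial)
        (simp add: g_def f0_def)
  qed
  define m where "m = k - 2"
  have m: "k = Suc (Suc m)" using k by (simp add: m_def)
  have hom0: "f (s *s x) = s ^ Suc (Suc m) * f x" for s x
    using homogeneous_eval_poly [OF hom] by (simp add: f_def m)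
  have hom1: "partial i f (s *s x) = s ^ Suc m * partial i f x" for i s x
    by (rule homogeneous_partial [OF pf(1) hom0])
  have hom2: "partial j (partial i f) (s *s x) = s ^ m * partial j (partial i f) x" for i j s x
    by (rule homogeneous_partial [OF polyfun_partial [OF pf(1)] hom1])
  have X: "X (Inl i) = (\<lambda>x. x $ Inr i)" "X (Inr i) = (\<lambda>x. - partial i f (position x))" for i
    by (simp_all add: X_def hamiltonian_field_def f_def fun_eq_iff)
  have exX: "ex (X (Inr i)) z = - lpoly (partial i f) (z $ None *s d) (position (offset z))" for i
    unfolding X ex_def
    by (subst expansion_uminus) (auto intro!: polyfun_position polyfun_partial pf simp: expansion_position pf polyfun_partial)
  show "coeff (ex (X v) z) 0 = line1 d $ v"
  proof (cases v)
    case (Inl i)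
    then show ?thesis unfolding Inl X ex_def expansion_coord by (simp add: line0_def line1_def)
  next
    case (Inr i)
    then show ?thesis unfolding Inr exX
      by (simp add: coeff_lpoly_0 pf polyfun_partial hom1 pdf0 line1_def)
  qed
  show "coeff (ex (X v) z) 1 = variational (2 * eval_poly V1 d) (k - 2) g (z $ None) (offset z) $ v"
  proof (cases v)
    case (Inl i)
    then show ?thesis unfolding Inl X ex_def expansion_coord by (simp add: variational_def offset_def)
  next
    case (Inr i)
    show ?thesis unfolding Inr exX coeff_minus coeff_lpoly_1 [OF polyfun_partial [OF pf(1)]]
      by (simp add: hom2 hess variational_def m position_def f1_def sum_distrib_left sum_distrib_right mult_ac)
  qed
  show "coeff (ex (partial u (X v)) z) 0 = variational (2 * eval_poly V1 d) (k - 2) g (z $ None) (axis u 1) $ v"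
  proof (cases v)
    case (Inl i)
    have "partial u (X v) = (\<lambda>x. if Inr i = u then 1 else 0)"
      unfolding Inl X by (rule ext) (rule partial_coord)
    then show ?thesis by (simp add: Inl ex_def variational_def axis_def)
  next
    case (Inr i)
    show ?thesis
    proof (cases u)
      case (Inl j)
      have "partial u (X v) x = - partial j (partial i f) (position x)" for x
      proof (rule partial_eqI)
        define c where "c z = (\<chi> w. if w = u then z else x $ w)" for z
        have "((\<lambda>z. partial i f (position (c z))) has_field_derivative
            (\<Sum>w\<in>UNIV. partial w (partial i f) (position (c (x $ u))) * (if w = j then 1 else 0))) (at (x $ u))"
        proof (rule polyfun_chain [OF polyfun_partial [OF pf(1)]])
          show "((\<lambda>z. position (c z) $ w) has_field_derivative (if w = j then 1 else 0)) (at (x $ u))" for w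
            by (cases "w = j") (auto simp: c_def position_def Inl)
        qed
        moreover have "c (x $ u) = x" by (simp add: c_def vec_eq_iff)
        ultimately have "((\<lambda>z. partial i f (position (c z))) has_field_derivative partial j (partial i f) (position x)) (at (x $ u))"
          by (simp add: if_distrib [of "\<lambda>x. _ * x"] cong: if_cong)
        then show "((\<lambda>z. X v (\<chi> w. if w = u then z else x $ w)) has_field_derivative - partial j (partial i f) (position x)) (at (x $ u))"
          unfolding Inr X c_def by (rule DERIV_minus)
      qed
      then have "partial u (X v) = (\<lambda>x. - partial j (partial i f) (position x))" by (rule ext)
      then have "coeff (ex (partial u (X v)) z) 0 = - partial j (partial i f) (z $ None *s d)"
        by (simp add: ex_def expansion_uminus expansion_position polyfun_position polyfun_partial pf coeff_lpoly_0)
      then show ?thesis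
        by (simp add: hom2 hess variational_def m Inl Inr f1_def axis_def if_distrib [of "\<lambda>x. _ * x"] cong: if_cong)
    next
      case (Inr j)
      have "partial u (X v) x = 0" for x
      proof (rule partial_eqI)
        have "position (\<chi> w. if w = u then z else x $ w) = position x" for z
          by (simp add: position_def Inr vec_eq_iff)
        then show "((\<lambda>z. X v (\<chi> w. if w = u then z else x $ w)) has_field_derivative 0) (at (x $ u))"
          unfolding \<open>v = Inr i\<close> X by simp
      qed
      then have "partial u (X v) = (\<lambda>x. 0)" by (rule ext)
      then show ?thesis
        by (simp add: ex_def variational_def Inr \<open>v = Inr i\<close> axis_def)
    qed
  qed
qed

section \<open>Lowest-order part of the form along the line\<close>

lemma (in invariant_form) Om_zero: "Om (v(a := 0)) x = 0"
  using Om_scale [of v a 0 0 x] by simp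

lemma (in invariant_form) Om_expand: "Om (v(a := u)) x = (\<Sum>l\<in>UNIV. u $ l * Om (v(a := axis l 1)) x)"
proof -
  have sum: "Om (v(a := \<Sum>l\<in>S. f l)) x = (\<Sum>l\<in>S. Om (v(a := f l)) x)" for S :: "('n + 'n) set" and f
    by (induction S rule: infinite_finite_induct)
      (simp_all only: sum.infinite sum.empty sum.insert Om_zero Om_add not_False_eq_True)
  have "Om (v(a := u)) x = Om (v(a := \<Sum>l\<in>UNIV. u $ l *s axis l 1)) x"
    by (simp only: basis_expansion)
  then show ?thesis by (simp only: sum Om_scale)
qed

lemma variational_expand:
  "variational a m g t u $ l = (\<Sum>k\<in>UNIV. u $ k * variational a m g t (axis k 1) $ l)"
proof (cases l)
  case (Inl i)
  have "(\<Sum>k\<in>UNIV. u $ k * variational a m g t (axis k 1) $ l) = (\<Sum>k\<in>UNIV. if k = Inr i then u $ k else 0)"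
    by (rule sum.cong) (auto simp: variational_def axis_def Inl)
  then show ?thesis by (simp add: variational_def Inl)
next
  case (Inr i)
  have "(\<Sum>k\<in>UNIV. u $ k * variational a m g t (axis k 1) $ l)
      = (\<Sum>k\<in>UNIV. u $ k * (case k of Inl j \<Rightarrow> - (a * t ^ m * g $ j * g $ i) | Inr j \<Rightarrow> 0))"
  proof (rule sum.cong)
    fix k show "u $ k * variational a m g t (axis k 1) $ l = u $ k * (case k of Inl j \<Rightarrow> - (a * t ^ m * g $ j * g $ i) | Inr j \<Rightarrow> 0)"
      by (cases k) (simp_all add: variational_def axis_def Inr if_distrib [of "\<lambda>x. _ * x"] cong: if_cong)
  qed simp
  also have "\<dots> = (\<Sum>j\<in>UNIV. u $ Inl j * - (a * t ^ m * g $ j * g $ i))"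
    by (subst UNIV_Plus_UNIV [symmetric], subst sum.Plus) simp_all
  also have "\<dots> = variational a m g t u $ l"
    by (simp add: variational_def Inr sum_negf sum_distrib_left sum_distrib_right mult_ac)
  finally show ?thesis by simp
qed

locale linearized_form = invariant_form Om G X
  for Om :: "('n::finite \<Rightarrow> complex ^ ('n + 'n)) \<Rightarrow> complex ^ ('n + 'n) \<Rightarrow> complex"
    and G :: "complex ^ ('n + 'n) \<Rightarrow> complex"
    and X :: "'n + 'n \<Rightarrow> complex ^ ('n + 'n) \<Rightarrow> complex" +
  fixes d g :: "complex ^ 'n" and a :: complex and m :: nat
  assumes X_0: "coeff (expansion (line0 d) (line1 d) (X v) z) 0 = line1 d $ v"
    and X_1: "coeff (expansion (line0 d) (line1 d) (X v) z) 1 = variational a m g (z $ None) (offset z) $ v"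
    and DX_0: "coeff (expansion (line0 d) (line1 d) (partial u (X v)) z) 0 = variational a m g (z $ None) (axis u 1) $ v"
    and a: "a \<noteq> 0" and m: "m \<ge> 1" and gg: "(\<Sum>i\<in>UNIV. (g $ i)\<^sup>2) \<noteq> 0"
begin

abbreviation ex :: "(complex ^ ('n + 'n) \<Rightarrow> complex) \<Rightarrow> complex ^ ('n + 'n) option \<Rightarrow> complex poly" where
  "ex \<equiv> expansion (line0 d) (line1 d)"

text \<open>One order for all slot vectors together; taken separately for each \<open>v\<close>,
  leading coefficients would not be multilinear in \<open>v\<close>.\<close>

definition ord_Om :: nat where "ord_Om = (LEAST j. \<exists>v z. coeff (ex (Om v) z) j \<noteq> 0)"
definition ord_G :: nat where "ord_G = (LEAST j. \<exists>z. coeff (ex G z) j \<noteq> 0)"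
definition Om0 :: "('n \<Rightarrow> complex ^ ('n + 'n)) \<Rightarrow> complex ^ ('n + 'n) option \<Rightarrow> complex" where
  "Om0 v z = coeff (ex (Om v) z) ord_Om"
definition G0 :: "complex ^ ('n + 'n) option \<Rightarrow> complex" where "G0 z = coeff (ex G z) ord_G"

lemma expansion_nonzero:
  assumes "polyfun f" "f x \<noteq> 0"
  shows "\<exists>z j. coeff (ex f z) j \<noteq> 0"
proof -
  define z where "z = (\<chi> w. case w of None \<Rightarrow> 0 | Some k \<Rightarrow> x $ k - line0 d $ k)"
  have "line0 d + z $ None *s line1 d + 1 *s offset z = x"
    by (simp add: vec_eq_iff z_def offset_def)
  then have "poly (ex f z) 1 = f x"
    unfolding expansion_def by (simp only: poly_lpoly [OF assms(1)])
  then have "ex f z \<noteq> 0" using assms(2) by auto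
  then show ?thesis by (auto simp: poly_eq_iff)
qed

lemma Om0_nonzero: "\<exists>v z. Om0 v z \<noteq> 0"
proof -
  have "\<exists>j v z. coeff (ex (Om v) z) j \<noteq> 0"
    using Om_nonzero expansion_nonzero [OF polyfun_Om] by blast
  then show ?thesis unfolding Om0_def ord_Om_def by (rule LeastI_ex)
qed

lemma G0_nonzero: "\<exists>z. G0 z \<noteq> 0"
proof -
  have "\<exists>j z. coeff (ex G z) j \<noteq> 0"
    using G_nonzero expansion_nonzero [OF polyfun_G] by blast
  then show ?thesis unfolding G0_def ord_G_def by (rule LeastI_ex)
qed

lemma Om_low: "i < ord_Om \<Longrightarrow> coeff (ex (Om v) z) i = 0"
  unfolding ord_Om_def using not_less_Least by blast

lemma G_low: "i < ord_G \<Longrightarrow> coeff (ex G z) i = 0"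
  unfolding ord_G_def using not_less_Least by blast

lemma polyfun_Om0 [intro]: "polyfun (Om0 v)"
  unfolding Om0_def [abs_def] by (intro polyfun_coeff_expansion polyfun_Om)

lemma polyfun_G0 [intro]: "polyfun G0"
  unfolding G0_def [abs_def] by (intro polyfun_coeff_expansion polyfun_G)

lemma Om0_add: "Om0 (v(b := u + w)) z = Om0 (v(b := u)) z + Om0 (v(b := w)) z"
  and Om0_scale: "Om0 (v(b := c *s u)) z = c * Om0 (v(b := u)) z"
proof -
  have "Om (v(b := u + w)) = (\<lambda>x. Om (v(b := u)) x + Om (v(b := w)) x)" by (rule ext) (rule Om_add)
  then show "Om0 (v(b := u + w)) z = Om0 (v(b := u)) z + Om0 (v(b := w)) z"
    by (simp add: Om0_def expansion_add polyfun_Om)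
  have "Om (v(b := c *s u)) = (\<lambda>x. c * Om (v(b := u)) x)" by (rule ext) (rule Om_scale)
  then show "Om0 (v(b := c *s u)) z = c * Om0 (v(b := u)) z"
    by (simp add: Om0_def expansion_cmult polyfun_Om)
qed

lemma Om0_alternating: "v b = v c \<Longrightarrow> b \<noteq> c \<Longrightarrow> Om0 v z = 0"
proof -
  assume "v b = v c" "b \<noteq> c"
  then have "Om v = (\<lambda>x. 0)" by (intro ext Om_alternating)
  then show ?thesis by (simp add: Om0_def)
qed

lemma Om0_expand: "Om0 (v(b := u)) z = (\<Sum>l\<in>UNIV. u $ l * Om0 (v(b := axis l 1)) z)"
proof -
  have "Om (v(b := u)) = (\<lambda>x. \<Sum>l\<in>UNIV. u $ l * Om (v(b := axis l 1)) x)" by (rule ext) (rule Om_expand)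
  then show ?thesis
    by (simp add: Om0_def expansion_sum expansion_cmult polyfun_cmult polyfun_Om coeff_sum)
qed

definition flow :: "(complex ^ ('n + 'n) option \<Rightarrow> complex) \<Rightarrow> complex ^ ('n + 'n) option \<Rightarrow> complex" where
  "flow h z = partial None h z + (\<Sum>v\<in>UNIV. variational a m g (z $ None) (offset z) $ v * partial (Some v) h z)"

lemma flow_zero [simp]: "flow (\<lambda>z. 0) z = 0"
  by (simp add: flow_def)

lemma expansion_dirderiv_field:
  assumes f: "polyfun f" and low: "\<And>i z. i < e \<Longrightarrow> coeff (ex f z) i = 0" and "j \<le> e"
  shows "coeff (ex (\<lambda>x. dirderiv (\<chi> k. X k x) f x) z) j = flow (\<lambda>z. coeff (ex f z) j) z"
proof -
  have "(\<lambda>x. dirderiv (\<chi> k. X k x) f x) = (\<lambda>x. \<Sum>v\<in>UNIV. partial v f x * X v x)"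
    by (simp add: dirderiv_def mult.commute fun_eq_iff)
  then show ?thesis
    using coeff_expansion_field [OF f low polyfun_X X_0 \<open>j \<le> e\<close>] by (simp add: flow_def X_1 [unfolded One_nat_def])
qed

lemma polyfun_dirderiv_field: "polyfun f \<Longrightarrow> polyfun (\<lambda>x. dirderiv (\<chi> k. X k x) f x)"
  unfolding dirderiv_def vec_lambda_beta by (intro polyfun_sum polyfun_mult polyfun_X polyfun_partial)

text \<open>A slot filled with a vector that itself varies with the point: to lowest order only its
  value on the line matters.\<close>

lemma expansion_linearization_slot:
  "i < ord_Om \<Longrightarrow> coeff (ex (\<lambda>x. Om (v(j := linearization X x u)) x) z) i = 0"
  "coeff (ex (\<lambda>x. Om (v(j := linearization X x u)) x) z) ord_Om = Om0 (v(j := variational a m g (z $ None) u)) z"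
  "polyfun (\<lambda>x. Om (v(j := linearization X x u)) x)"
proof -
  have f: "(\<lambda>x. Om (v(j := linearization X x u)) x) = (\<lambda>x. \<Sum>l\<in>UNIV. dirderiv u (X l) x * Om (v(j := axis l 1)) x)"
    by (rule ext, subst Om_expand) (simp add: linearization_def)
  show "polyfun (\<lambda>x. Om (v(j := linearization X x u)) x)"
    unfolding f by (intro polyfun_sum polyfun_mult polyfun_dirderiv polyfun_X polyfun_Om)
  have e: "ex (\<lambda>x. Om (v(j := linearization X x u)) x) z = (\<Sum>l\<in>UNIV. ex (dirderiv u (X l)) z * ex (Om (v(j := axis l 1))) z)"
    unfolding f by (simp add: expansion_sum expansion_mult polyfun_mult polyfun_dirderiv polyfun_X polyfun_Om)
  have low: "coeff (ex (dirderiv u (X l)) z * ex (Om (v(j := axis l 1))) z) i = 0" if "i < ord_Om" for i l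
    using coeff_mult_lowest(2) [of 0 "ex (dirderiv u (X l)) z" ord_Om "ex (Om (v(j := axis l 1))) z" i]
      that by (simp add: Om_low)
  show "coeff (ex (\<lambda>x. Om (v(j := linearization X x u)) x) z) i = 0" if "i < ord_Om"
    by (simp add: e coeff_sum low [OF that])
  have d0: "coeff (ex (dirderiv u (X l)) z) 0 = variational a m g (z $ None) u $ l" for l
  proof -
    have "coeff (ex (dirderiv u (X l)) z) 0 = (\<Sum>k\<in>UNIV. u $ k * variational a m g (z $ None) (axis k 1) $ l)"
      unfolding dirderiv_def [abs_def]
      by (simp add: expansion_sum expansion_cmult polyfun_cmult polyfun_partial polyfun_X coeff_sum DX_0)
    then show ?thesis by (simp add: variational_expand [symmetric])
  qed
  have "coeff (ex (dirderiv u (X l)) z * ex (Om (v(j := axis l 1))) z) ord_Om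
      = variational a m g (z $ None) u $ l * Om0 (v(j := axis l 1)) z" for l
    using coeff_mult_lowest(1) [of 0 "ex (dirderiv u (X l)) z" ord_Om "ex (Om (v(j := axis l 1))) z"]
    by (simp add: Om_low d0 Om0_def)
  then show "coeff (ex (\<lambda>x. Om (v(j := linearization X x u)) x) z) ord_Om = Om0 (v(j := variational a m g (z $ None) u)) z"
    by (subst Om0_expand) (simp add: e coeff_sum)
qed

text \<open>Differentiation along the field does not lower the order in \<epsilon>, so each product
  in the invariance identity starts at order \<open>ord_G + ord_Om\<close>; the claim is the
  coefficient there.\<close>

lemma Om0_invariant:
  "G0 z * flow (Om0 v) z - Om0 v z * flow G0 z
    + G0 z * (\<Sum>j\<in>UNIV. Om0 (v(j := variational a m g (z $ None) (v j))) z) = 0"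
proof -
  define A where "A = ex (\<lambda>x. dirderiv (\<chi> k. X k x) (Om v) x) z"
  define B where "B = ex (\<lambda>x. dirderiv (\<chi> k. X k x) G x) z"
  define C where "C j = ex (\<lambda>x. Om (v(j := linearization X x (v j))) x) z" for j
  have A: "coeff A i = flow (\<lambda>z. coeff (ex (Om v) z) i) z" if "i \<le> ord_Om" for i
    unfolding A_def by (rule expansion_dirderiv_field [OF polyfun_Om Om_low that])
  have A0: "coeff A i = 0" if "i < ord_Om" for i
    using A [of i] that by (simp add: Om_low)
  have B: "coeff B i = flow (\<lambda>z. coeff (ex G z) i) z" if "i \<le> ord_G" for i
    unfolding B_def by (rule expansion_dirderiv_field [OF polyfun_G G_low that])
  have B0: "coeff B i = 0" if "i < ord_G" for i
    using B [of i] that by (simp add: G_low)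
  have C0: "coeff (C j) i = 0" if "i < ord_Om" for i j
    unfolding C_def by (rule expansion_linearization_slot(1) [OF that])
  have C1: "coeff (C j) ord_Om = Om0 (v(j := variational a m g (z $ None) (v j))) z" for j
    unfolding C_def by (rule expansion_linearization_slot(2))
  have "(\<lambda>x. G x * dirderiv (\<chi> k. X k x) (Om v) x - Om v x * dirderiv (\<chi> k. X k x) G x
        + G x * (\<Sum>j\<in>UNIV. Om (v(j := linearization X x (v j))) x)) = (\<lambda>x. 0)"
    by (rule ext) (rule Om_invariant)
  then have "ex (\<lambda>x. G x * dirderiv (\<chi> k. X k x) (Om v) x - Om v x * dirderiv (\<chi> k. X k x) G x
        + G x * (\<Sum>j\<in>UNIV. Om (v(j := linearization X x (v j))) x)) z = 0"
    by simp
  then have "ex G z * A - ex (Om v) z * B + ex G z * (\<Sum>j\<in>UNIV. C j) = 0"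
    by (simp add: expansion_add expansion_diff expansion_mult expansion_sum polyfun_mult polyfun_diff polyfun_add
        polyfun_sum polyfun_G polyfun_Om polyfun_dirderiv_field expansion_linearization_slot(3) A_def B_def C_def)
  then have "coeff (ex G z * A) (ord_G + ord_Om) - coeff (ex (Om v) z * B) (ord_Om + ord_G)
      + coeff (ex G z * (\<Sum>j\<in>UNIV. C j)) (ord_G + ord_Om) = 0"
    by (simp add: add.commute flip: coeff_diff coeff_add)
  moreover have "coeff (ex G z * A) (ord_G + ord_Om) = G0 z * flow (Om0 v) z"
    by (subst coeff_mult_lowest(1)) (auto simp: G_low A0 G0_def A Om0_def [abs_def])
  moreover have "coeff (ex (Om v) z * B) (ord_Om + ord_G) = Om0 v z * flow G0 z"
    by (subst coeff_mult_lowest(1)) (auto simp: Om_low B0 Om0_def B G0_def [abs_def])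
  moreover have "coeff (ex G z * (\<Sum>j\<in>UNIV. C j)) (ord_G + ord_Om)
      = G0 z * (\<Sum>j\<in>UNIV. Om0 (v(j := variational a m g (z $ None) (v j))) z)"
    by (subst coeff_mult_lowest(1)) (simp_all add: G_low coeff_sum C0 C1 G0_def)
  ultimately show ?thesis by simp
qed

definition transverse :: "complex ^ ('n + 'n) \<Rightarrow> (complex ^ ('n + 'n) option \<Rightarrow> complex) \<Rightarrow> complex ^ ('n + 'n) option \<Rightarrow> complex" where
  "transverse u h z = (\<Sum>k\<in>UNIV. u $ k * partial (Some k) h z)"

lemma expansion_dirderiv:
  "polyfun f \<Longrightarrow> coeff (pCons 0 (ex (dirderiv u f) z)) j = transverse u (\<lambda>z. coeff (ex f z) j) z"
proof -
  assume f: "polyfun f"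
  have "pCons 0 (ex (dirderiv u f) z) = (\<Sum>k\<in>UNIV. smult (u $ k) (pCons 0 (ex (partial k f) z)))"
    unfolding dirderiv_def [abs_def]
    by (rule poly_eqI)
      (simp add: expansion_sum expansion_cmult polyfun_cmult polyfun_partial f coeff_pCons coeff_sum
        split: nat.split)
  then show ?thesis by (cases j) (simp_all add: transverse_def coeff_sum partial_expansion_Some f)
qed

definition nabla :: "complex ^ ('n + 'n) \<Rightarrow> ('n \<Rightarrow> complex ^ ('n + 'n)) \<Rightarrow> complex ^ ('n + 'n) option \<Rightarrow> complex" where
  "nabla u v z = G0 z * transverse u (Om0 v) z - Om0 v z * transverse u G0 z"

text \<open>A derivative in a fixed direction lowers the order in \<epsilon> by one;
  \<open>pCons 0\<close> restores it and spares a truncated subtraction in the index.\<close>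

lemma expansion_nabla:
  "coeff (pCons 0 (ex (\<lambda>x. G x * dirderiv u (Om v) x - Om v x * dirderiv u G x) z)) (ord_G + ord_Om) = nabla u v z"
proof -
  define A where "A = pCons 0 (ex (dirderiv u (Om v)) z)"
  define B where "B = pCons 0 (ex (dirderiv u G) z)"
  have A: "coeff A i = transverse u (\<lambda>z. coeff (ex (Om v) z) i) z" for i
    unfolding A_def by (rule expansion_dirderiv [OF polyfun_Om])
  have B: "coeff B i = transverse u (\<lambda>z. coeff (ex G z) i) z" for i
    unfolding B_def by (rule expansion_dirderiv [OF polyfun_G])
  have "pCons 0 (ex (\<lambda>x. G x * dirderiv u (Om v) x - Om v x * dirderiv u G x) z) = ex G z * A - ex (Om v) z * B"
    by (simp add: expansion_diff expansion_mult polyfun_mult polyfun_G polyfun_Om polyfun_dirderiv A_def B_def)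
  moreover have "coeff (ex G z * A) (ord_G + ord_Om) = G0 z * transverse u (Om0 v) z"
    by (subst coeff_mult_lowest(1)) (auto simp: G_low G0_def A Om_low Om0_def [abs_def] transverse_def)
  moreover have "coeff (ex (Om v) z * B) (ord_Om + ord_G) = Om0 v z * transverse u G0 z"
    by (subst coeff_mult_lowest(1)) (auto simp: Om_low Om0_def B G_low G0_def [abs_def] transverse_def)
  ultimately show ?thesis by (simp add: nabla_def add.commute)
qed

lemma Om0_closed:
  "nabla u (v(b := w)) z - nabla w (v(b := u)) z = (\<Sum>c\<in>UNIV - {b}. nabla (v c) (v(b := w, c := u)) z)"
proof -
  define N where "N u v x = G x * dirderiv u (Om v) x - Om v x * dirderiv u G x" for u v x
  have pN: "polyfun (N u v)" for u v
    unfolding N_def [abs_def] by (intro polyfun_diff polyfun_mult polyfun_G polyfun_Om polyfun_dirderiv)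
  have "(\<lambda>x. N u (v(b := w)) x - N w (v(b := u)) x) = (\<lambda>x. \<Sum>c\<in>UNIV - {b}. N (v c) (v(b := w, c := u)) x)"
    unfolding N_def by (rule ext) (rule Om_closed)
  then have "ex (\<lambda>x. N u (v(b := w)) x - N w (v(b := u)) x) z = ex (\<lambda>x. \<Sum>c\<in>UNIV - {b}. N (v c) (v(b := w, c := u)) x) z"
    by simp
  then have "ex (N u (v(b := w))) z - ex (N w (v(b := u))) z = (\<Sum>c\<in>UNIV - {b}. ex (N (v c) (v(b := w, c := u))) z)"
    by (simp only: expansion_diff expansion_sum pN)
  then have "pCons 0 (ex (N u (v(b := w))) z) - pCons 0 (ex (N w (v(b := u))) z) = (\<Sum>c\<in>UNIV - {b}. pCons 0 (ex (N (v c) (v(b := w, c := u))) z))"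
  proof -
    have "(\<Sum>c\<in>S. pCons 0 (f c)) = pCons 0 (\<Sum>c\<in>S. f c)" for S and f :: "'n \<Rightarrow> complex poly"
      by (induction S rule: infinite_finite_induct) simp_all
    then show ?thesis using \<open>ex (N u (v(b := w))) z - ex (N w (v(b := u))) z = _\<close> by simp
  qed
  from arg_cong [OF this, of "\<lambda>p. coeff p (ord_G + ord_Om)"] show ?thesis
    by (simp only: coeff_diff coeff_sum N_def [abs_def] expansion_nabla)
qed

lemma Om0_isotropic:
  "(\<Sum>k\<in>UNIV. Om0 (v(b := axis (Inl k) 1)) z * Om0 (v'(c := axis (Inr k) 1)) z
      - Om0 (v(b := axis (Inr k) 1)) z * Om0 (v'(c := axis (Inl k) 1)) z) = 0"
proof -
  have "(\<lambda>x. \<Sum>k\<in>UNIV. Om (v(b := axis (Inl k) 1)) x * Om (v'(c := axis (Inr k) 1)) x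
        - Om (v(b := axis (Inr k) 1)) x * Om (v'(c := axis (Inl k) 1)) x) = (\<lambda>x. 0)"
    by (rule ext) (rule Om_isotropic)
  then have "ex (\<lambda>x. \<Sum>k\<in>UNIV. Om (v(b := axis (Inl k) 1)) x * Om (v'(c := axis (Inr k) 1)) x
        - Om (v(b := axis (Inr k) 1)) x * Om (v'(c := axis (Inl k) 1)) x) z = 0" by simp
  then have "(\<Sum>k\<in>UNIV. ex (Om (v(b := axis (Inl k) 1))) z * ex (Om (v'(c := axis (Inr k) 1))) z
        - ex (Om (v(b := axis (Inr k) 1))) z * ex (Om (v'(c := axis (Inl k) 1))) z) = 0"
    by (simp only: expansion_sum expansion_diff expansion_mult polyfun_mult polyfun_diff polyfun_Om)
  from arg_cong [OF this, of "\<lambda>p. coeff p (ord_Om + ord_Om)"] show ?thesis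
    by (simp only: coeff_sum coeff_diff coeff_mult_lowest(1) [OF Om_low Om_low] Om0_def [symmetric] coeff_0)
qed

end

section \<open>Invariant scalars and covectors of the linearized system\<close>

lemma coeff_euler_riccati_mult_lowest:
  assumes "\<And>j. j < i \<Longrightarrow> coeff A j = 0" "\<And>j. j < n \<Longrightarrow> coeff B j = 0"
  shows "coeff (A * euler_riccati lam m B) (i + n)
    = coeff A i * (riccati lam m (coeff B n) + of_nat n * ([:0, 1:] * coeff B n))"
proof -
  interpret derivation "riccati lam m" by (rule derivation_riccati)
  show ?thesis
    using coeff_mult_lowest(1) [of i A n "euler_riccati lam m B"] assms
    by (simp add: coeff_euler_riccati)
qed

text \<open>The lowest \<delta>-coefficients of \<open>A\<close> and \<open>Gm\<close> satisfy the
  scalar invariance equation with weight e = i - n, and this weight must be 0.\<close>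

lemma euler_riccati_invariant_order:
  assumes eq: "Gm * euler_riccati lam m A - A * euler_riccati lam m Gm = 0"
    and A: "coeff A i \<noteq> 0" "\<And>j. j < i \<Longrightarrow> coeff A j = 0"
    and Gm: "coeff Gm n \<noteq> 0" "\<And>j. j < n \<Longrightarrow> coeff Gm j = 0"
    and lam: "lam \<noteq> 0" and m: "m \<ge> 1"
  shows "i = n"
proof -
  have "coeff (Gm * euler_riccati lam m A) (n + i) - coeff (A * euler_riccati lam m Gm) (i + n) = 0"
    using arg_cong [OF eq, of "\<lambda>p. coeff p (n + i)"] by (simp add: add.commute)
  then have "coeff Gm n * (riccati lam m (coeff A i) + of_nat i * ([:0, 1:] * coeff A i))
      - coeff A i * (riccati lam m (coeff Gm n) + of_nat n * ([:0, 1:] * coeff Gm n)) = 0"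
    by (simp only: coeff_euler_riccati_mult_lowest A(2) Gm(2))
  moreover have "g * (x + of_nat i * (z * b)) - b * (y + of_nat n * (z * g))
      = g * x - b * y + of_int (int i - int n) * (z * b * g)" for g x z b y :: "complex poly poly"
    by (simp add: algebra_simps)
  ultimately have "coeff Gm n * riccati lam m (coeff A i) - coeff A i * riccati lam m (coeff Gm n)
      + of_int (int i - int n) * ([:0, 1:] * coeff A i * coeff Gm n) = 0" by metis
  from riccati_invariant_const [OF this A(1) Gm(1) lam m] show ?thesis by simp
qed

text \<open>Lowest \<delta>-coefficients of the invariant covector (Bx dx + By dy) / Gm: the weight
  i - n is 1 and the leading part is a multiple of x dy - y dx. Such components vanish to one order
  more than invariant scalars.\<close>

lemma euler_riccati_covector_order:
  assumes e1: "Gm * euler_riccati lam m By - By * euler_riccati lam m Gm = - (Bx * Gm)"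
    and e2: "Gm * euler_riccati lam m Bx - Bx * euler_riccati lam m Gm = [:[:monom lam m:]:] * (By * Gm)"
    and B: "coeff Bx i \<noteq> 0 \<or> coeff By i \<noteq> 0" "\<And>j. j < i \<Longrightarrow> coeff Bx j = 0 \<and> coeff By j = 0"
    and Gm: "coeff Gm n \<noteq> 0" "\<And>j. j < n \<Longrightarrow> coeff Gm j = 0"
    and lam: "lam \<noteq> 0" and m: "m \<ge> 1"
  shows "i = Suc n \<and> coeff Bx i = - ([:0, 1:] * coeff By i) \<and> coeff By i \<noteq> 0"
proof -
  define a where "a = coeff Bx i"
  define b where "b = coeff By i"
  define g where "g = coeff Gm n"
  have Bx0: "coeff Bx j = 0" and By0: "coeff By j = 0" if "j < i" for j using B(2) that by auto
  have alg: "g * (x + of_nat i * (z * b)) - b * (y + of_nat n * (z * g))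
      = g * x - b * y + of_int (int i - int n) * (z * b * g)" for g x z b y :: "complex poly poly"
    by (simp add: algebra_simps)
  have "coeff (Gm * euler_riccati lam m By) (n + i) - coeff (By * euler_riccati lam m Gm) (i + n)
      = - coeff (Bx * Gm) (i + n)"
    using arg_cong [OF e1, of "\<lambda>p. coeff p (n + i)"] by (simp add: add.commute)
  then have "g * (riccati lam m b + of_nat i * ([:0, 1:] * b)) - b * (riccati lam m g + of_nat n * ([:0, 1:] * g)) = - (a * g)"
    unfolding a_def b_def g_def
    by (simp only: coeff_euler_riccati_mult_lowest coeff_mult_lowest(1) Bx0 By0 Gm(2))
  then have 1: "g * riccati lam m b - b * riccati lam m g + of_int (int i - int n) * ([:0, 1:] * b * g) = - (a * g)"
    unfolding alg .
  have "coeff (Gm * euler_riccati lam m Bx) (n + i) - coeff (Bx * euler_riccati lam m Gm) (i + n)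
      = [:monom lam m:] * coeff (By * Gm) (i + n)"
    using arg_cong [OF e2, of "\<lambda>p. coeff p (n + i)"] by (simp add: add.commute)
  then have "g * (riccati lam m a + of_nat i * ([:0, 1:] * a)) - a * (riccati lam m g + of_nat n * ([:0, 1:] * g)) = [:monom lam m:] * (b * g)"
    unfolding a_def b_def g_def
    by (simp only: coeff_euler_riccati_mult_lowest coeff_mult_lowest(1) Bx0 By0 Gm(2))
  then have 2: "g * riccati lam m a - a * riccati lam m g + of_int (int i - int n) * ([:0, 1:] * a * g) = [:monom lam m:] * b * g"
    unfolding alg by (simp only: mult.assoc)
  have "a \<noteq> 0 \<or> b \<noteq> 0" using B(1) by (simp add: a_def b_def)
  note r = riccati_invariant_covector [OF 1 2 _ this lam m]
  have g: "g \<noteq> 0" using Gm(1) by (simp add: g_def)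
  from r [OF g] have "int i - int n = 1" "a = - ([:0, 1:] * b)" by blast+
  moreover have "b \<noteq> 0" using r [OF g] g by auto
  ultimately show ?thesis by (simp add: a_def b_def)
qed

lemma polynomial_lowest:
  assumes "p \<noteq> 0 \<or> q \<noteq> (0 :: 'a::zero poly)"
  obtains i where "coeff p i \<noteq> 0 \<or> coeff q i \<noteq> 0" "\<And>j. j < i \<Longrightarrow> coeff p j = 0 \<and> coeff q j = 0"
proof -
  define i where "i = (LEAST i. coeff p i \<noteq> 0 \<or> coeff q i \<noteq> 0)"
  have "\<exists>i. coeff p i \<noteq> 0 \<or> coeff q i \<noteq> 0" using assms by (auto simp: poly_eq_iff)
  then have "coeff p i \<noteq> 0 \<or> coeff q i \<noteq> 0" unfolding i_def by (rule LeastI_ex)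
  moreover have "coeff p j = 0 \<and> coeff q j = 0" if "j < i" for j
    using not_less_Least [OF that [unfolded i_def]] by blast
  ultimately show thesis by (rule that)
qed

text \<open>A curl-free covector cannot be a multiple of \<open>x dy - y dx\<close>.\<close>
lemma euler_riccati_covector_not_closed:
  assumes e1: "Gm * euler_riccati lam m By - By * euler_riccati lam m Gm = - (Bx * Gm)"
    and e2: "Gm * euler_riccati lam m Bx - Bx * euler_riccati lam m Gm = [:[:monom lam m:]:] * (By * Gm)"
    and closed: "Gm * (delta_dx By - map_poly pderiv Bx) - (By * delta_dx Gm - Bx * map_poly pderiv Gm) = 0"
    and Gm: "Gm \<noteq> 0" and lam: "lam \<noteq> 0" and m: "m \<ge> 1"
  shows "Bx = 0 \<and> By = 0"
proof (rule ccontr)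
  assume "\<not> ?thesis"
  then have "Bx \<noteq> 0 \<or> By \<noteq> 0" by blast
  then obtain i where i: "coeff Bx i \<noteq> 0 \<or> coeff By i \<noteq> 0" "\<And>j. j < i \<Longrightarrow> coeff Bx j = 0 \<and> coeff By j = 0"
    using polynomial_lowest [of Bx By] by metis
  obtain n where n: "coeff Gm n \<noteq> 0" "\<And>j. j < n \<Longrightarrow> coeff Gm j = 0"
    using polynomial_lowest [of Gm Gm] Gm by metis
  note ord = euler_riccati_covector_order [OF e1 e2 i n lam m]
  define b where "b = coeff By i"
  define g where "g = coeff Gm n"
  have a: "coeff Bx i = - ([:0, 1:] * b)" and b: "b \<noteq> 0" and iSn: "i = Suc n"
    using ord unfolding b_def by blast+
  have g: "g \<noteq> 0" using n(1) by (simp add: g_def)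
  have Bx0: "coeff Bx j = 0" and By0: "coeff By j = 0" if "j < i" for j using i(2) that by auto
  have d0: "coeff (delta_dx By - map_poly pderiv Bx) j = 0" if "j < i" for j
    using that by (simp add: coeff_delta_dx coeff_map_poly Bx0 By0)
  have d1: "coeff (delta_dx Gm) j = 0" "coeff (map_poly pderiv Gm) j = 0" if "j < n" for j
    using that by (simp_all add: coeff_delta_dx coeff_map_poly n(2))
  have "coeff (Gm * (delta_dx By - map_poly pderiv Bx)) (n + i)
      - (coeff (By * delta_dx Gm) (i + n) - coeff (Bx * map_poly pderiv Gm) (i + n)) = 0"
    using arg_cong [OF closed, of "\<lambda>p. coeff p (n + i)"] by (simp add: add.commute)
  then have "g * coeff (delta_dx By - map_poly pderiv Bx) i
      - (b * coeff (delta_dx Gm) n - coeff Bx i * coeff (map_poly pderiv Gm) n) = 0"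
    unfolding b_def g_def by (simp only: coeff_mult_lowest(1) n(2) d0 d1 Bx0 By0)
  then have "g * (of_nat i * b - [:0, 1:] * pderiv b + pderiv ([:0, 1:] * b))
      - (b * (of_nat n * g - [:0, 1:] * pderiv g) + ([:0, 1:] * b) * pderiv g) = 0"
    by (simp only: coeff_diff coeff_delta_dx coeff_map_poly pderiv_0 a b_def [symmetric] g_def [symmetric]
        pderiv_minus diff_minus_eq_add mult_minus_left)
  moreover have "pderiv ([:0, 1:] * b) = b + [:0, 1:] * pderiv b"
    by (simp add: pderiv_mult pderiv_pCons)
  \<comment> \<open>The 2 is that of d (x dy - y dx) = 2 dx dy: one unit comes from i - n = 1, the
    other from the z-derivative of z b.\<close>
  moreover have "g * (of_nat i * b - z * p + (b + z * p)) - (b * (of_nat n * g - z * q) + (z * b) * q)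
      = 2 * b * g" for z p q
    by (simp add: iSn algebra_simps)
  ultimately have "2 * b * g = 0" by metis
  then show False using b g by simp
qed

section \<open>Splitting of the linearized system\<close>

context linearized_form
begin

text \<open>\<open>ux\<close> and \<open>uy\<close> span the (x, y)-plane, with coordinates
  \<open>px\<close> and \<open>py\<close>; \<open>S\<close> below is its symplectic complement. A
  complex g may be isotropic, so the splitting rests on (g, g) being nonzero.\<close>

definition ux :: "complex ^ ('n + 'n)" where "ux = (\<chi> v. case v of Inl i \<Rightarrow> g $ i | Inr i \<Rightarrow> 0)"
definition uy :: "complex ^ ('n + 'n)" where "uy = (\<chi> v. case v of Inl i \<Rightarrow> 0 | Inr i \<Rightarrow> g $ i)"
definition norm_g :: complex where "norm_g = (\<Sum>i\<in>UNIV. (g $ i)\<^sup>2)"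
definition px :: "complex ^ ('n + 'n) \<Rightarrow> complex" where "px u = (\<Sum>k\<in>UNIV. g $ k * u $ Inl k) / norm_g"
definition py :: "complex ^ ('n + 'n) \<Rightarrow> complex" where "py u = (\<Sum>k\<in>UNIV. g $ k * u $ Inr k) / norm_g"
definition S :: "(complex ^ ('n + 'n)) set" where "S = {u. px u = 0 \<and> py u = 0}"
definition shift :: "complex ^ ('n + 'n) \<Rightarrow> complex ^ ('n + 'n)" where
  "shift u = (\<chi> v. case v of Inl i \<Rightarrow> u $ Inr i | Inr i \<Rightarrow> 0)"
definition proj :: "complex ^ ('n + 'n) \<Rightarrow> complex ^ ('n + 'n)" where
  "proj u = u - px u *s ux - py u *s uy"
definition lam :: complex where "lam = a * norm_g"

text \<open>The solution of the linearized system with initial value \<open>u \<in> S\<close>.\<close>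
definition moving :: "complex \<Rightarrow> complex ^ ('n + 'n) \<Rightarrow> complex ^ ('n + 'n)" where
  "moving t u = u + t *s shift u"

lemma norm_g: "norm_g \<noteq> 0" using gg by (simp add: norm_g_def)

lemma lam: "lam \<noteq> 0" using a norm_g by (simp add: lam_def)

lemma px_add: "px (u + w) = px u + px w" and py_add: "py (u + w) = py u + py w"
  and px_scale: "px (c *s u) = c * px u" and py_scale: "py (c *s u) = c * py u"
  by (simp_all add: px_def py_def distrib_left sum.distrib add_divide_distrib sum_distrib_left mult_ac)

lemma px_diff: "px (u - w) = px u - px w" and py_diff: "py (u - w) = py u - py w"
  by (simp_all add: px_def py_def right_diff_distrib sum_subtractf diff_divide_distrib)

lemma p_simps [simp]: "px ux = 1" "py ux = 0" "px uy = 0" "py uy = 1"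
  using norm_g by (simp_all add: px_def py_def ux_def uy_def norm_g_def power2_eq_square)

lemma proj_S: "proj u \<in> S"
  by (simp add: S_def proj_def px_diff py_diff px_scale py_scale)

lemma decomposition: "u = proj u + px u *s ux + py u *s uy"
  by (simp add: proj_def)

lemma px_shift: "px (shift u) = py u" and py_shift: "py (shift u) = 0"
  by (simp_all add: px_def py_def shift_def)

lemma shift_simps: "shift (u + w) = shift u + shift w" "shift (c *s u) = c *s shift u" "shift (shift u) = 0"
  "shift (u - w) = shift u - shift w"
  by (simp_all add: shift_def vec_eq_iff split: sum.split)

lemma shift_S: "u \<in> S \<Longrightarrow> shift u \<in> S"
  by (simp add: S_def px_shift py_shift)

lemma moving_S: "u \<in> S \<Longrightarrow> moving t u \<in> S"
  using shift_S [of u] by (simp add: S_def moving_def px_add py_add px_scale py_scale)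

lemma moving_inverse: "moving t (moving (- t) u) = u"
  by (simp add: moving_def shift_simps)

lemma variational_add: "variational a m g t (u + w) = variational a m g t u + variational a m g t w"
  by (simp add: vec_eq_iff variational_def distrib_left distrib_right sum.distrib split: sum.split)

lemma variational_scale: "variational a m g t (c *s u) = c *s variational a m g t u"
proof -
  have "(\<Sum>k\<in>UNIV. g $ k * (c * u $ Inl k)) = c * (\<Sum>k\<in>UNIV. g $ k * u $ Inl k)"
    by (simp add: sum_distrib_left mult.left_commute)
  then show ?thesis by (simp add: vec_eq_iff variational_def split: sum.split)
qed

lemma variational_S: "u \<in> S \<Longrightarrow> variational a m g t u = shift u"
  using norm_g by (simp add: vec_eq_iff variational_def shift_def S_def px_def split: sum.split)

lemma variational_ux: "variational a m g t ux = (- (lam * t ^ m)) *s uy"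
  by (simp add: vec_eq_iff variational_def ux_def uy_def lam_def norm_g_def power2_eq_square mult_ac split: sum.split)

lemma variational_uy: "variational a m g t uy = ux"
  by (simp add: vec_eq_iff variational_def ux_def uy_def split: sum.split)

text \<open>Product rule for a multilinear form whose slots move affinely in t: besides the
  derivative at a frozen frame, d/dt replaces each moving vector by its velocity. The induction runs
  over the moving slots because linearity is available one slot at a time.\<close>

lemma moving_frame:
  fixes s s' u :: "'n \<Rightarrow> complex ^ ('n + 'n)"
  assumes "finite J"
  shows "polyfun (\<lambda>z. Om0 (\<lambda>j. if j \<in> J then s j + z $ None *s s' j else u j) z) \<and>
    (\<forall>w z. partial w (\<lambda>z. Om0 (\<lambda>j. if j \<in> J then s j + z $ None *s s' j else u j) z) z
      = partial w (Om0 (\<lambda>j. if j \<in> J then s j + z $ None *s s' j else u j)) z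
        + (if w = None then \<Sum>j\<in>J. Om0 ((\<lambda>j. if j \<in> J then s j + z $ None *s s' j else u j)(j := s' j)) z else 0))"
  using assms
proof (induction J arbitrary: u rule: finite_induct)
  case empty
  show ?case by (simp add: polyfun_Om0)
next
  case (insert i J)
  define F where "F J u z = (\<lambda>j. if j \<in> J then s j + z $ None *s s' j else u j)" for J u and z :: "complex ^ ('n + 'n) option"
  have F: "F (insert i J) u z = (F J (u(i := s i)) z)(i := s i + z $ None *s s' i)" for z
    using insert.hyps by (auto simp: F_def fun_eq_iff)
  have Fi: "(F J (u(i := x)) z)(i := y) = F J (u(i := y)) z" for x y z
    using insert.hyps by (auto simp: F_def fun_eq_iff)
  have split: "Om0 (F (insert i J) u z) z' = Om0 (F J (u(i := s i)) z) z' + z $ None * Om0 (F J (u(i := s' i)) z) z'" for z z'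
  proof -
    have "Om0 (F (insert i J) u z) z' = Om0 ((F J (u(i := s i)) z)(i := s i)) z'
        + z $ None * Om0 ((F J (u(i := s i)) z)(i := s' i)) z'"
      unfolding F Om0_add Om0_scale ..
    then show ?thesis by (simp only: Fi)
  qed
  note IH = insert.IH [folded F_def]
  have p: "polyfun (\<lambda>z. Om0 (F J w z) z)" for w using IH by blast
  have d: "partial w (\<lambda>z. Om0 (F J u z) z) z = partial w (Om0 (F J u z)) z
      + (if w = None then \<Sum>j\<in>J. Om0 ((F J u z)(j := s' j)) z else 0)" for w u z using IH by blast
  have "polyfun (\<lambda>z. Om0 (F (insert i J) u z) z)"
    unfolding split by (intro polyfun_add polyfun_mult polyfun_coord p)
  moreover have "partial w (\<lambda>z. Om0 (F (insert i J) u z) z) z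
      = partial w (Om0 (F (insert i J) u z)) z
        + (if w = None then \<Sum>j\<in>insert i J. Om0 ((F (insert i J) u z)(j := s' j)) z else 0)" for w z
  proof -
    have "partial w (\<lambda>z. Om0 (F (insert i J) u z) z) z
        = partial w (\<lambda>z. Om0 (F J (u(i := s i)) z) z) z
          + ((if w = None then 1 else 0) * Om0 (F J (u(i := s' i)) z) z
            + z $ None * partial w (\<lambda>z. Om0 (F J (u(i := s' i)) z) z) z)"
      unfolding split by (simp add: partial_add partial_mult p polyfun_mult polyfun_coord partial_coord eq_commute)
    moreover have "partial w (Om0 (F (insert i J) u z)) z
        = partial w (Om0 (F J (u(i := s i)) z)) z + z $ None * partial w (Om0 (F J (u(i := s' i)) z)) z"
    proof -
      have "Om0 (F (insert i J) u z) = (\<lambda>z'. Om0 (F J (u(i := s i)) z) z' + z $ None * Om0 (F J (u(i := s' i)) z) z')"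
        by (rule ext) (rule split)
      then show ?thesis by (simp add: partial_add partial_cmult polyfun_cmult polyfun_Om0)
    qed
    moreover have "(\<Sum>j\<in>insert i J. Om0 ((F (insert i J) u z)(j := s' j)) z)
        = Om0 (F J (u(i := s' i)) z) z + ((\<Sum>j\<in>J. Om0 ((F J (u(i := s i)) z)(j := s' j)) z)
          + z $ None * (\<Sum>j\<in>J. Om0 ((F J (u(i := s' i)) z)(j := s' j)) z))"
    proof -
      have "Om0 ((F (insert i J) u z)(j := s' j)) z
          = Om0 ((F J (u(i := s i)) z)(j := s' j)) z + z $ None * Om0 ((F J (u(i := s' i)) z)(j := s' j)) z"
        if "j \<in> J" for j
      proof -
        have "i \<noteq> j" using that insert.hyps by auto
        then have "(F (insert i J) u z)(j := s' j) = ((F J (u(i := s i)) z)(j := s' j))(i := s i + z $ None *s s' i)"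
          unfolding F by (rule fun_upd_twist)
        moreover have "((F J (u(i := s i)) z)(j := s' j))(i := y) = (F J (u(i := y)) z)(j := s' j)" for y
          using \<open>i \<noteq> j\<close> Fi [of "s i" z y] by (simp add: fun_upd_twist)
        moreover have "Om0 (W(i := s i + z $ None *s s' i)) z = Om0 (W(i := s i)) z + z $ None * Om0 (W(i := s' i)) z" for W
          by (simp only: Om0_add Om0_scale)
        ultimately show ?thesis by metis
      qed
      moreover have "(F (insert i J) u z)(i := s' i) = F J (u(i := s' i)) z"
        unfolding F fun_upd_upd Fi ..
      ultimately show ?thesis
        using insert.hyps by (simp add: sum.distrib sum_distrib_left del: fun_upd_apply)
    qed
    ultimately show ?thesis by (cases w) (simp_all add: d algebra_simps del: fun_upd_apply)
  qed
  ultimately show ?case unfolding F_def by blast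
qed

end

lemma euler_riccati_pCons_const: "euler_riccati lam m [:p:] = [:riccati lam m p:]"
  by (simp add: euler_riccati_def map_poly_pCons derivation.zero [OF derivation_riccati])

lemma euler_riccati_const: "euler_riccati lam m [:[:[:k:]:]:] = 0"
  by (simp add: euler_riccati_pCons_const)

section \<open>The form on frames that move with the flow\<close>

context linearized_form
begin

text \<open>The form on a frame depending on time. A slot with \<open>s j\<close> in
  \<open>S\<close> and \<open>s' j = shift (s j)\<close> carries a solution of the linearized
  system; \<open>ux\<close> and \<open>uy\<close> are held constant by
  \<open>s' j = 0\<close>.\<close>

definition psi :: "('n \<Rightarrow> complex ^ ('n + 'n)) \<Rightarrow> ('n \<Rightarrow> complex ^ ('n + 'n)) \<Rightarrow> complex ^ ('n + 'n) option \<Rightarrow> complex" where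
  "psi s s' z = Om0 (\<lambda>j. s j + z $ None *s s' j) z"

lemma polyfun_psi: "polyfun (psi s s')"
  using moving_frame [of UNIV s s'] by (simp add: psi_def [abs_def])

lemma partial_psi:
  "partial w (psi s s') z = partial w (Om0 (\<lambda>j. s j + z $ None *s s' j)) z
    + (if w = None then \<Sum>j\<in>UNIV. Om0 ((\<lambda>j. s j + z $ None *s s' j)(j := s' j)) z else 0)"
  using conjunct2 [OF moving_frame [OF finite [of UNIV], of s s' undefined]]
  unfolding psi_def [abs_def] by (simp only: UNIV_I if_True)

text \<open>In a slot that moves with the linearized flow, the velocity cancels the action of the
  linearization; only the slots in \<open>Q\<close> leave a term.\<close>

lemma psi_invariant:
  fixes s s' z
  defines "V \<equiv> \<lambda>j. s j + z $ None *s s' j"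
  assumes Q: "\<And>j. j \<notin> Q \<Longrightarrow> s j \<in> S \<and> s' j = shift (s j)"
  shows "G0 z * flow (psi s s') z - psi s s' z * flow G0 z
    + G0 z * (\<Sum>j\<in>Q. Om0 (V(j := variational a m g (z $ None) (V j))) z - Om0 (V(j := s' j)) z) = 0"
proof -
  have fl: "flow (psi s s') z = flow (Om0 V) z + (\<Sum>j\<in>UNIV. Om0 (V(j := s' j)) z)"
    by (simp add: flow_def partial_psi V_def del: fun_upd_apply)
  have "(\<Sum>j\<in>Q. Om0 (V(j := variational a m g (z $ None) (V j))) z - Om0 (V(j := s' j)) z)
      = (\<Sum>j\<in>UNIV. Om0 (V(j := variational a m g (z $ None) (V j))) z - Om0 (V(j := s' j)) z)"
  proof (rule sum.mono_neutral_left)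
    show "\<forall>j\<in>UNIV - Q. Om0 (V(j := variational a m g (z $ None) (V j))) z - Om0 (V(j := s' j)) z = 0"
    proof
      fix j assume "j \<in> UNIV - Q"
      then have s: "s j \<in> S" and s': "s' j = shift (s j)" using Q by auto
      have "V j = moving (z $ None) (s j)" by (simp add: V_def s' moving_def)
      then have "variational a m g (z $ None) (V j) = s' j"
        using moving_S [OF s] by (simp add: variational_S s' moving_def shift_simps)
      then show "Om0 (V(j := variational a m g (z $ None) (V j))) z - Om0 (V(j := s' j)) z = 0" by simp
    qed
  qed auto
  then have q: "(\<Sum>j\<in>Q. Om0 (V(j := variational a m g (z $ None) (V j))) z - Om0 (V(j := s' j)) z)
      = (\<Sum>j\<in>UNIV. Om0 (V(j := variational a m g (z $ None) (V j))) z) - (\<Sum>j\<in>UNIV. Om0 (V(j := s' j)) z)"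
    by (simp add: sum_subtractf)
  have p: "psi s s' z = Om0 V z" by (simp add: psi_def V_def)
  show ?thesis
    unfolding q p fl using Om0_invariant [of z V] by (simp add: algebra_simps)
qed

lemma psi_upd: "psi (s(q := u)) (s'(q := 0)) z = Om0 ((\<lambda>j. s j + z $ None *s s' j)(q := u)) z"
  unfolding psi_def by (rule arg_cong [of _ _ "\<lambda>v. Om0 v z"]) auto

lemma Om0_slot_zero: "Om0 (v(b := 0)) z = 0"
  using Om0_scale [of v b 0 0 z] by simp

lemma psi_covector:
  assumes s: "\<And>j. j \<noteq> q \<Longrightarrow> s j \<in> S \<and> s' j = shift (s j)"
  defines "Bx \<equiv> psi (s(q := ux)) (s'(q := 0))" and "By \<equiv> psi (s(q := uy)) (s'(q := 0))"
  shows "G0 z * flow By z - By z * flow G0 z = - (Bx z * G0 z)"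
    and "G0 z * flow Bx z - Bx z * flow G0 z = (lam * (z $ None) ^ m) * (By z * G0 z)"
proof -
  define V where "V u = (\<lambda>j. (s(q := u)) j + z $ None *s (s'(q := 0)) j)" for u
  have V: "V u = (\<lambda>j. s j + z $ None *s s' j)(q := u)" for u by (auto simp: V_def)
  have s1: "(s(q := u)) j \<in> S \<and> (s'(q := 0)) j = shift ((s(q := u)) j)" if "j \<notin> {q}" for j u
    using s that by simp
  have 1: "G0 z * flow (psi (s(q := u)) (s'(q := 0))) z - psi (s(q := u)) (s'(q := 0)) z * flow G0 z
      + G0 z * Om0 ((V u)(q := variational a m g (z $ None) u)) z = 0" for u
  proof -
    have "V u q = u" by (simp add: V)
    then show ?thesis
      using psi_invariant [of "{q}" "s(q := u)" "s'(q := 0)" z, OF s1, folded V_def]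
      by (simp add: Om0_slot_zero)
  qed
  have "Om0 ((V uy)(q := ux)) z = Bx z" unfolding V Bx_def psi_upd by simp
  then show "G0 z * flow By z - By z * flow G0 z = - (Bx z * G0 z)"
    using 1 [of uy] by (simp add: variational_uy By_def eq_neg_iff_add_eq_0 mult.commute)
  have "Om0 ((V ux)(q := (- (lam * (z $ None) ^ m)) *s uy)) z = - (lam * (z $ None) ^ m) * By z"
    unfolding V By_def psi_upd fun_upd_upd by (rule Om0_scale)
  then show "G0 z * flow Bx z - Bx z * flow G0 z = (lam * (z $ None) ^ m) * (By z * G0 z)"
    using 1 [of ux] by (simp add: variational_ux Bx_def algebra_simps)
qed

text \<open>The (x, y)-system has trace zero: it sends \<open>ux\<close> to a multiple of
  \<open>uy\<close> and \<open>uy\<close> to \<open>ux\<close>, and a repeated vector annihilates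
  the form.\<close>

lemma psi_scalar:
  assumes s: "\<And>j. j \<notin> {b, c} \<Longrightarrow> s j \<in> S \<and> s' j = shift (s j)" and "b \<noteq> c"
    and bc: "s b = ux" "s c = uy" "s' b = 0" "s' c = 0"
  shows "G0 z * flow (psi s s') z - psi s s' z * flow G0 z = 0"
proof -
  define V where "V = (\<lambda>j. s j + z $ None *s s' j)"
  have V: "V b = ux" "V c = uy" by (simp_all add: V_def bc)
  have "Om0 (V(b := (- (lam * (z $ None) ^ m)) *s uy)) z = 0"
    unfolding Om0_scale using \<open>b \<noteq> c\<close> Om0_alternating [of "V(b := uy)" b c z] by (simp add: V)
  moreover have "Om0 (V(c := ux)) z = 0"
    using \<open>b \<noteq> c\<close> Om0_alternating [of "V(c := ux)" b c z] by (simp add: V)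
  ultimately show ?thesis
    using psi_invariant [of "{b, c}" s s' z, OF s, folded V_def] \<open>b \<noteq> c\<close>
    by (simp add: V bc variational_ux variational_uy Om0_slot_zero)
qed

text \<open>The three-parameter family \<open>w = u\<^sub>0(t) + \<delta> e\<^sub>x + \<delta> z e\<^sub>y\<close> of offsets, for \<open>u\<^sub>0 \<in> S\<close>.\<close>
definition family :: "complex ^ ('n + 'n) \<Rightarrow> ('n + 'n) option \<Rightarrow> complex poly poly poly" where
  "family u v = (case v of None \<Rightarrow> [:[:[:0, 1:]:]:]
    | Some k \<Rightarrow> [:[:[:u $ k:]:]:] + [:[:[:0, 1:]:]:] * [:[:[:shift u $ k:]:]:]
        + [:0, 1:] * [:[:[:ux $ k:]:]:] + [:0, 1:] * [:[:0, 1:]:] * [:[:[:uy $ k:]:]:])"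

lemma ev3_vars: "ev3 [:[:[:0, 1:]:]:] t y s = t" "ev3 [:[:0, 1:]:] t y s = y" "ev3 [:0, 1:] t y s = s"
  "ev3 (- p) t y s = - ev3 p t y s" "ev3 1 t y s = 1" "ev3 0 t y s = 0" "ev3 [:[:monom c n:]:] t y s = c * t ^ n"
  by (simp_all add: ev3_def poly_monom)

lemma family_point:
  "ev3_point (family u) t y s $ None = t"
  "offset (ev3_point (family u) t y s) = moving t u + s *s ux + (s * y) *s uy"
  by (simp_all add: ev3_point_def offset_def family_def moving_def vec_eq_iff ev3_vars del: mult_pCons_left mult_pCons_right)

lemma UNIV_option_sum: "(\<Sum>v\<in>UNIV. f v) = f None + (\<Sum>k\<in>UNIV. f (Some k))"
  for f :: "'b::finite option \<Rightarrow> 'c::comm_monoid_add"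
  by (simp add: UNIV_option_conv sum.reindex)

lemma polyfun_variational: "polyfun (\<lambda>z. variational a m g (z $ None) (offset z) $ v)"
  by (cases v) (auto simp: variational_def offset_def intro!: polyfun_uminus polyfun_mult polyfun_power polyfun_sum
      polyfun_const polyfun_coord)

lemma polyfun_flow: "polyfun h \<Longrightarrow> polyfun (flow h)"
  unfolding flow_def [abs_def]
  by (intro polyfun_add polyfun_sum polyfun_mult polyfun_variational polyfun_partial)

text \<open>The family is tangent to the linearized flow: its part in \<open>S\<close> solves the
  free motion, and (\<delta>, \<delta> z) follows the (x, y)-system in its chart.\<close>

lemma euler_riccati_family:
  assumes "u \<in> S"
  shows "euler_riccati lam m (family u None) = 1"
    and "euler_riccati lam m (family u (Some k)) = sub3 (family u) (\<lambda>z. variational a m g (z $ None) (offset z) $ k)"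
proof -
  interpret D: derivation "euler_riccati lam m" by (rule derivation_euler_riccati)
  note Dk = euler_riccati_const
  have Dt: "euler_riccati lam m [:[:[:0, 1:]:]:] = 1"
    by (simp add: euler_riccati_pCons_const map_poly_pCons riccati_def pderiv_pCons one_pCons)
  have Dz: "euler_riccati lam m [:[:0, 1:]:] = - ([:[:monom lam m:]:] + [:[:0, 1:]:] * [:[:0, 1:]:])"
    by (simp add: euler_riccati_pCons_const map_poly_pCons riccati_def pderiv_pCons)
  have Dd: "euler_riccati lam m [:0, 1:] = [:[:0, 1:]:] * [:0, 1:]"
  proof -
    have "riccati lam m 1 = 0" using riccati_const [of lam m 1] by (simp add: one_pCons)
    then show ?thesis by (simp add: euler_riccati_def map_poly_pCons pderiv_pCons derivation.zero [OF derivation_riccati])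
  qed
  show "euler_riccati lam m (family u None) = 1" by (simp add: family_def Dt)
  have eq: "euler_riccati lam m (family u (Some k)) = [:[:[:shift u $ k:]:]:]
      + ([:[:0, 1:]:] * [:0, 1:]) * [:[:[:ux $ k:]:]:]
      + ([:[:0, 1:]:] * [:0, 1:] * [:[:0, 1:]:]
          + [:0, 1:] * - ([:[:monom lam m:]:] + [:[:0, 1:]:] * [:[:0, 1:]:])) * [:[:[:uy $ k:]:]:]"
    unfolding family_def option.case
    by (simp only: D.add D.mult Dk Dt Dz Dd mult_zero_right mult_zero_left add_0_left add_0_right mult_1_left)
  show "euler_riccati lam m (family u (Some k)) = sub3 (family u) (\<lambda>z. variational a m g (z $ None) (offset z) $ k)"
  proof (rule sub3_eqI [symmetric])
    fix t y s
    have "variational a m g t (moving t u + s *s ux + (s * y) *s uy)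
        = shift u + (s * - (lam * t ^ m)) *s uy + (s * y) *s ux"
      using moving_S [OF assms]
      by (simp add: variational_add variational_scale variational_ux variational_uy variational_S)
        (simp add: moving_def shift_simps)
    then show "ev3 (euler_riccati lam m (family u (Some k))) t y s
        = variational a m g (ev3_point (family u) t y s $ None) (offset (ev3_point (family u) t y s)) $ k"
      unfolding eq family_point
      by (simp only: ev3_add ev3_mult ev3_const ev3_vars) (simp add: algebra_simps)
  qed
qed

lemma sub3_flow:
  assumes "polyfun h" "u \<in> S"
  shows "sub3 (family u) (flow h) = euler_riccati lam m (sub3 (family u) h)"
proof -
  have "euler_riccati lam m (sub3 (family u) h)
      = (\<Sum>v\<in>UNIV. sub3 (family u) (partial v h) * euler_riccati lam m (family u v))"
    by (rule chain_sub3 [OF derivation_euler_riccati euler_riccati_const assms(1)])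
  also have "\<dots> = sub3 (family u) (flow h)"
    unfolding flow_def [abs_def] UNIV_option_sum euler_riccati_family [OF assms(2)]
    by (simp add: sub3_add sub3_sum sub3_mult polyfun_sum polyfun_mult polyfun_partial assms(1)
        polyfun_variational mult.commute)
  finally show ?thesis ..
qed

lemma sub3_transverse_aux:
  assumes D: "derivation D" "\<And>k. D [:[:[:k:]:]:] = 0" and h: "polyfun h"
    and None: "D (family u None) = 0" and Some: "\<And>k. D (family u (Some k)) = [:0, 1:] * [:[:[:w $ k:]:]:]"
  shows "D (sub3 (family u) h) = [:0, 1:] * sub3 (family u) (transverse w h)"
proof -
  have "D (sub3 (family u) h) = (\<Sum>v\<in>UNIV. sub3 (family u) (partial v h) * D (family u v))"
    by (rule chain_sub3 [OF D h])
  also have "\<dots> = (\<Sum>k\<in>UNIV. [:0, 1:] * (sub3 (family u) (\<lambda>z. w $ k) * sub3 (family u) (partial (Some k) h)))"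
    unfolding UNIV_option_sum None Some sub3_const by (simp only: mult_zero_right mult_zero_left add_0_left mult_ac)
  also have "\<dots> = [:0, 1:] * sub3 (family u) (transverse w h)"
    unfolding transverse_def [abs_def] sum_distrib_left [symmetric]
    by (subst sub3_sum) (auto intro!: polyfun_cmult polyfun_partial h sum.cong
        simp: sub3_mult polyfun_partial h polyfun_const simp del: sub3_const)
  finally show ?thesis .
qed

lemma sub3_transverse_ux:
  assumes "polyfun h" shows "delta_dx (sub3 (family u) h) = [:0, 1:] * sub3 (family u) (transverse ux h)"
proof -
  interpret D: derivation delta_dx by (rule derivation_delta_dx)
  have Dk: "delta_dx [:[:p:]:] = 0" for p
    by (simp add: delta_dx_def map_poly_pCons pderiv_pCons)
  have Dz: "delta_dx [:[:0, 1:]:] = - [:[:0, 1:]:]"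
    by (simp add: delta_dx_def map_poly_pCons pderiv_pCons)
  have Dd: "delta_dx [:0, 1:] = [:0, 1:]"
    by (simp add: delta_dx_def map_poly_pCons pderiv_pCons)
  show ?thesis
  proof (rule sub3_transverse_aux [OF derivation_delta_dx Dk assms])
    show "delta_dx (family u None) = 0" by (simp add: family_def Dk)
    show "delta_dx (family u (Some k)) = [:0, 1:] * [:[:[:ux $ k:]:]:]" for k
      unfolding family_def option.case
      by (simp only: D.add D.mult Dk Dz Dd mult_zero_right mult_zero_left add_0_left add_0_right
          mult_minus_right add.right_inverse)
  qed
qed

lemma sub3_transverse_uy:
  assumes "polyfun h" shows "map_poly pderiv (sub3 (family u) h) = [:0, 1:] * sub3 (family u) (transverse uy h)"
proof -
  interpret D: derivation "map_poly pderiv :: complex poly poly poly \<Rightarrow> _" by (rule derivation_dz)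
  have Dk: "map_poly pderiv [:[:p:]:] = 0" for p :: "complex poly"
    by (simp add: map_poly_pCons pderiv_pCons)
  have Dz: "map_poly pderiv [:[:0, 1::complex poly:]:] = 1"
    by (simp add: map_poly_pCons pderiv_pCons one_pCons)
  have Dd: "map_poly pderiv [:0, 1 :: complex poly poly:] = 0"
    by (simp add: map_poly_pCons pderiv_pCons)
  show ?thesis
  proof (rule sub3_transverse_aux [OF derivation_dz Dk assms])
    show "map_poly pderiv (family u None) = 0" by (simp add: family_def Dk)
    show "map_poly pderiv (family u (Some k)) = [:0, 1:] * [:[:[:uy $ k:]:]:]" for k
      unfolding family_def option.case
      by (simp only: D.add D.mult Dk Dz Dd mult_zero_right mult_zero_left add_0_left add_0_right mult_1_right)
  qed
qed

lemma sub3_power_time: "sub3 (family u) (\<lambda>z. lam * (z $ None) ^ m) = [:[:monom lam m:]:]"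
  by (rule sub3_eqI) (simp add: family_point ev3_vars)

lemma sub3_covector:
  assumes u: "u \<in> S" and s: "\<And>j. j \<noteq> q \<Longrightarrow> s j \<in> S \<and> s' j = shift (s j)"
  defines "Gm \<equiv> sub3 (family u) G0"
    and "Bx \<equiv> sub3 (family u) (psi (s(q := ux)) (s'(q := 0)))"
    and "By \<equiv> sub3 (family u) (psi (s(q := uy)) (s'(q := 0)))"
  shows "Gm * euler_riccati lam m By - By * euler_riccati lam m Gm = - (Bx * Gm)"
    and "Gm * euler_riccati lam m Bx - Bx * euler_riccati lam m Gm = [:[:monom lam m:]:] * (By * Gm)"
proof -
  have "(\<lambda>z. G0 z * flow (psi (s(q := uy)) (s'(q := 0))) z - psi (s(q := uy)) (s'(q := 0)) z * flow G0 z)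
      = (\<lambda>z. - (psi (s(q := ux)) (s'(q := 0)) z * G0 z))"
    by (rule ext) (rule psi_covector(1) [OF s])
  then show "Gm * euler_riccati lam m By - By * euler_riccati lam m Gm = - (Bx * Gm)"
    unfolding Gm_def Bx_def By_def
    by (simp only: sub3_flow [OF _ u, symmetric] polyfun_psi polyfun_G0 sub3_mult [symmetric] sub3_diff [symmetric]
        sub3_uminus [symmetric] polyfun_flow polyfun_mult)
  have "(\<lambda>z. G0 z * flow (psi (s(q := ux)) (s'(q := 0))) z - psi (s(q := ux)) (s'(q := 0)) z * flow G0 z)
      = (\<lambda>z. (lam * (z $ None) ^ m) * (psi (s(q := uy)) (s'(q := 0)) z * G0 z))"
    by (rule ext) (rule psi_covector(2) [OF s])
  then show "Gm * euler_riccati lam m Bx - Bx * euler_riccati lam m Gm = [:[:monom lam m:]:] * (By * Gm)"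
    unfolding Gm_def Bx_def By_def sub3_power_time [of u, symmetric]
    by (simp only: sub3_flow [OF _ u, symmetric] polyfun_psi polyfun_G0 sub3_mult [symmetric] sub3_diff [symmetric]
        polyfun_flow polyfun_mult polyfun_cmult polyfun_power polyfun_coord)
qed


section \<open>Vanishing of the components on dx and dy\<close>

text \<open>The Poisson structure is the sum of its parts on the (x, y)-plane and on
  \<open>S\<close>, so for covectors with zero bracket the two parts are opposite. The projected
  basis may be moved to time t because the free motion is symplectic: the terms with t
  cancel.\<close>

lemma isotropic_split:
  fixes v v' z t b c
  defines "f1 \<equiv> \<lambda>u. Om0 (v(b := u)) z" and "f2 \<equiv> \<lambda>u. Om0 (v'(c := u)) z"
  defines "P \<equiv> \<lambda>k. moving t (proj (axis (Inl k) 1))" and "R \<equiv> \<lambda>k. moving t (proj (axis (Inr k) 1))"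
  shows "f1 ux * f2 uy - f1 uy * f2 ux = - norm_g * (\<Sum>k\<in>UNIV. f1 (P k) * f2 (R k) - f1 (R k) * f2 (P k))"
proof -
  define \<gamma> where "\<gamma> k = g $ k / norm_g" for k
  have lin: "f (u - w) = f u - f w" "f (u + w) = f u + f w" "f (k *s u) = k * f u"
    if "f = f1 \<or> f = f2" for f u w k
  proof -
    show add: "f (u + w) = f u + f w" for u w using that by (auto simp: f1_def f2_def Om0_add simp del: fun_upd_apply)
    show sc: "f (k *s u) = k * f u" for k u using that by (auto simp: f1_def f2_def Om0_scale simp del: fun_upd_apply)
    have "f (u - w) = f (u + (- 1) *s w)" by simp
    then show "f (u - w) = f u - f w" unfolding add sc by simp
  qed
  have pq: "px (axis (Inl k) 1) = \<gamma> k" "py (axis (Inl k) 1) = 0" "px (axis (Inr k) 1) = 0" "py (axis (Inr k) 1) = \<gamma> k" for k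
    by (simp_all add: px_def py_def \<gamma>_def axis_def if_distrib [of "\<lambda>x. _ * x"] cong: if_cong)
  have prP: "proj (axis (Inl k) 1) = axis (Inl k) 1 - \<gamma> k *s ux"
    and prR: "proj (axis (Inr k) 1) = axis (Inr k) 1 - \<gamma> k *s uy" for k
    by (simp_all add: proj_def pq)
  have sP: "shift (axis (Inl k) 1) = 0" "shift (axis (Inr k) 1) = axis (Inl k) 1" "shift ux = 0" "shift uy = ux" for k
    by (simp_all add: shift_def vec_eq_iff axis_def ux_def uy_def split: sum.split)
  have P: "P k = axis (Inl k) 1 - \<gamma> k *s ux" for k
    by (simp add: P_def prP moving_def shift_simps sP)
  have R: "R k = (axis (Inr k) 1 - \<gamma> k *s uy) + t *s (axis (Inl k) 1 - \<gamma> k *s ux)" for k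
    by (simp add: R_def prR moving_def shift_simps sP)
  have ex: "(\<Sum>k\<in>UNIV. \<gamma> k * f (axis (Inl k) 1)) = f ux / norm_g"
    "(\<Sum>k\<in>UNIV. \<gamma> k * f (axis (Inr k) 1)) = f uy / norm_g" if "f = f1 \<or> f = f2" for f
  proof -
    have e: "f u = (\<Sum>l\<in>UNIV. u $ l * f (axis l 1))" for u
      using that Om0_expand [of v b u z] Om0_expand [of v' c u z] by (auto simp: f1_def f2_def)
    have s: "(\<Sum>l\<in>UNIV. h l) = (\<Sum>k\<in>UNIV. h (Inl k)) + (\<Sum>k\<in>UNIV. h (Inr k))" for h :: "'n + 'n \<Rightarrow> complex"
      by (subst UNIV_Plus_UNIV [symmetric], subst sum.Plus) simp_all
    have "f ux = (\<Sum>k\<in>UNIV. g $ k * f (axis (Inl k) 1))"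
      by (subst e, subst s) (simp add: ux_def)
    then show "(\<Sum>k\<in>UNIV. \<gamma> k * f (axis (Inl k) 1)) = f ux / norm_g"
      by (simp add: \<gamma>_def sum_divide_distrib)
    have "f uy = (\<Sum>k\<in>UNIV. g $ k * f (axis (Inr k) 1))"
      by (subst e, subst s) (simp add: uy_def)
    then show "(\<Sum>k\<in>UNIV. \<gamma> k * f (axis (Inr k) 1)) = f uy / norm_g"
      by (simp add: \<gamma>_def sum_divide_distrib)
  qed
  have g2: "(\<Sum>k\<in>UNIV. \<gamma> k * \<gamma> k) = 1 / norm_g"
  proof -
    have "(\<Sum>k\<in>UNIV. \<gamma> k * \<gamma> k) = norm_g / (norm_g * norm_g)"
      unfolding \<gamma>_def norm_g_def [of, unfolded power2_eq_square] by (simp add: sum_divide_distrib)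
    then show ?thesis using norm_g by simp
  qed
  have iso: "(\<Sum>k\<in>UNIV. f1 (axis (Inl k) 1) * f2 (axis (Inr k) 1) - f1 (axis (Inr k) 1) * f2 (axis (Inl k) 1)) = 0"
    unfolding f1_def f2_def by (rule Om0_isotropic)
  have "f1 (P k) * f2 (R k) - f1 (R k) * f2 (P k)
      = (f1 (axis (Inl k) 1) * f2 (axis (Inr k) 1) - f1 (axis (Inr k) 1) * f2 (axis (Inl k) 1))
        - \<gamma> k * f1 (axis (Inl k) 1) * f2 uy - f1 ux * (\<gamma> k * f2 (axis (Inr k) 1)) + \<gamma> k * \<gamma> k * (f1 ux * f2 uy - f1 uy * f2 ux)
        + \<gamma> k * f1 (axis (Inr k) 1) * f2 ux + f1 uy * (\<gamma> k * f2 (axis (Inl k) 1))" for k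
    unfolding P R by (simp add: lin algebra_simps)
  then have "(\<Sum>k\<in>UNIV. f1 (P k) * f2 (R k) - f1 (R k) * f2 (P k))
      = (\<Sum>k\<in>UNIV. f1 (axis (Inl k) 1) * f2 (axis (Inr k) 1) - f1 (axis (Inr k) 1) * f2 (axis (Inl k) 1))
        - (\<Sum>k\<in>UNIV. \<gamma> k * f1 (axis (Inl k) 1)) * f2 uy - f1 ux * (\<Sum>k\<in>UNIV. \<gamma> k * f2 (axis (Inr k) 1))
        + (\<Sum>k\<in>UNIV. \<gamma> k * \<gamma> k) * (f1 ux * f2 uy - f1 uy * f2 ux)
        + (\<Sum>k\<in>UNIV. \<gamma> k * f1 (axis (Inr k) 1)) * f2 ux + f1 uy * (\<Sum>k\<in>UNIV. \<gamma> k * f2 (axis (Inl k) 1))"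
    by (simp only: sum.distrib sum_subtractf sum_distrib_left sum_distrib_right)
  also have "\<dots> = - (f1 ux * f2 uy - f1 uy * f2 ux) / norm_g"
    using norm_g by (simp add: iso ex g2 field_simps)
  finally show ?thesis using norm_g by simp
qed

text \<open>Either both components vanish on the family, or they start exactly at order n + 1; in
  both cases nothing occurs up to the order n of \<open>G0\<close>.\<close>

lemma covector_order:
  assumes u: "u \<in> S" and \<sigma>: "\<And>j. j \<noteq> q \<Longrightarrow> \<sigma> j \<in> S"
    and n: "coeff (sub3 (family u) G0) n \<noteq> 0" "\<And>j. j < n \<Longrightarrow> coeff (sub3 (family u) G0) j = 0" and "j < Suc n"
  shows "coeff (sub3 (family u) (psi (\<sigma>(q := ux)) ((\<lambda>j. shift (\<sigma> j))(q := 0)))) j = 0"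
    and "coeff (sub3 (family u) (psi (\<sigma>(q := uy)) ((\<lambda>j. shift (\<sigma> j))(q := 0)))) j = 0"
proof -
  define Bx where "Bx = sub3 (family u) (psi (\<sigma>(q := ux)) ((\<lambda>j. shift (\<sigma> j))(q := 0)))"
  define By where "By = sub3 (family u) (psi (\<sigma>(q := uy)) ((\<lambda>j. shift (\<sigma> j))(q := 0)))"
  have "coeff Bx j = 0 \<and> coeff By j = 0"
  proof (cases "Bx = 0 \<and> By = 0")
    case False
    then obtain i where i: "coeff Bx i \<noteq> 0 \<or> coeff By i \<noteq> 0" "\<And>j. j < i \<Longrightarrow> coeff Bx j = 0 \<and> coeff By j = 0"
      using polynomial_lowest [of Bx By] by metis
    have "i = Suc n"
      using euler_riccati_covector_order [OF sub3_covector [OF u, of q \<sigma> "\<lambda>j. shift (\<sigma> j)", folded Bx_def By_def] i n lam m] \<sigma>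
      by blast
    then show ?thesis using i(2) \<open>j < Suc n\<close> by blast
  qed simp
  then show "coeff (sub3 (family u) (psi (\<sigma>(q := ux)) ((\<lambda>j. shift (\<sigma> j))(q := 0)))) j = 0"
    and "coeff (sub3 (family u) (psi (\<sigma>(q := uy)) ((\<lambda>j. shift (\<sigma> j))(q := 0)))) j = 0"
    by (simp_all add: Bx_def By_def)
qed

text \<open>A nonzero component C on dx dy would have the order n of \<open>G0\<close> in \<delta>,
  as an invariant scalar. Isotropy writes C^2 as a sum of products of two components with a single
  normal vector, each of order at least n + 1. Orders 2 n and 2 n + 2 are incompatible.\<close>

lemma scalar_vanishes_on_family:
  assumes u: "u \<in> S" and \<sigma>: "\<And>j. \<sigma> j \<in> S" and bc: "b \<noteq> c" and Gm: "sub3 (family u) G0 \<noteq> 0"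
  shows "sub3 (family u) (psi (\<sigma>(b := ux, c := uy)) ((\<lambda>j. shift (\<sigma> j))(b := 0, c := 0))) = 0"
proof (rule ccontr)
  define s where "s = \<sigma>(b := ux, c := uy)"
  define s' where "s' = (\<lambda>j. shift (\<sigma> j))(b := 0, c := 0)"
  define C where "C = sub3 (family u) (psi s s')"
  assume "sub3 (family u) (psi (\<sigma>(b := ux, c := uy)) ((\<lambda>j. shift (\<sigma> j))(b := 0, c := 0))) \<noteq> 0"
  then have "C \<noteq> 0" by (simp add: C_def s_def s'_def)
  then obtain i where i: "coeff C i \<noteq> 0" "\<And>j. j < i \<Longrightarrow> coeff C j = 0"
    using polynomial_lowest [of C C] by metis
  obtain n where n: "coeff (sub3 (family u) G0) n \<noteq> 0" "\<And>j. j < n \<Longrightarrow> coeff (sub3 (family u) G0) j = 0"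
    using polynomial_lowest [of "sub3 (family u) G0" "sub3 (family u) G0"] Gm by metis
  have "(\<lambda>z. G0 z * flow (psi s s') z - psi s s' z * flow G0 z) = (\<lambda>z. 0)"
    by (rule ext, rule psi_scalar [of b c]) (use \<sigma> bc in \<open>auto simp: s_def s'_def\<close>)
  then have "sub3 (family u) (\<lambda>z. G0 z * flow (psi s s') z - psi s s' z * flow G0 z) = 0" by simp
  then have "sub3 (family u) G0 * euler_riccati lam m C - C * euler_riccati lam m (sub3 (family u) G0) = 0"
    unfolding C_def
    by (simp only: sub3_flow [OF _ u, symmetric] polyfun_psi polyfun_G0 sub3_mult sub3_diff polyfun_flow polyfun_mult)
  then have "i = n" using i n lam m by (rule euler_riccati_invariant_order)
  define e where "e k = proj (axis (Inl k) 1)" for k :: 'n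
  define e' where "e' k = proj (axis (Inr k) 1)" for k :: 'n
  define F1 where "F1 w = psi ((\<sigma>(b := w))(c := uy)) ((\<lambda>j. shift ((\<sigma>(b := w)) j))(c := 0))" for w
  define F2 where "F2 w = psi ((\<sigma>(c := w))(b := ux)) ((\<lambda>j. shift ((\<sigma>(c := w)) j))(b := 0))" for w
  have "psi s s' z * psi s s' z = - norm_g * (\<Sum>k\<in>UNIV. F1 (e k) z * F2 (e' k) z - F1 (e' k) z * F2 (e k) z)" for z
  proof -
    define V where "V = (\<lambda>j. s j + z $ None *s s' j)"
    have Vb: "V(b := ux) = V" and Vc: "V(c := uy) = V"
      using bc by (auto simp: V_def s_def s'_def fun_eq_iff)
    \<comment> \<open>The second half of the plane bracket contains \<open>uy\<close> twice and
      drops out; the first half is the square of \<open>Om0 V z\<close>.\<close>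
    have 0: "Om0 (V(b := uy)) z = 0"
      using bc by (intro Om0_alternating [of _ b c]) (auto simp: V_def s_def s'_def)
    have 1: "Om0 (V(b := moving (z $ None) w)) z = F1 w z" for w
      unfolding F1_def psi_def using bc
      by (intro arg_cong [of _ _ "\<lambda>v. Om0 v z"]) (auto simp: V_def s_def s'_def moving_def fun_eq_iff)
    have 2: "Om0 (V(c := moving (z $ None) w)) z = F2 w z" for w
      unfolding F2_def psi_def using bc
      by (intro arg_cong [of _ _ "\<lambda>v. Om0 v z"]) (auto simp: V_def s_def s'_def moving_def fun_eq_iff)
    have "psi s s' z = Om0 V z" by (simp add: psi_def V_def)
    then show ?thesis
      using isotropic_split [of V b z V c "z $ None"] unfolding 1 2 0 Vb Vc by (simp add: e_def e'_def)
  qed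
  then have "(\<lambda>z. psi s s' z * psi s s' z)
      = (\<lambda>z. - norm_g * (\<Sum>k\<in>UNIV. F1 (e k) z * F2 (e' k) z - F1 (e' k) z * F2 (e k) z))" by (rule ext)
  moreover have pF: "polyfun (F1 w)" "polyfun (F2 w)" for w by (simp_all add: F1_def F2_def polyfun_psi)
  ultimately have "C * C = [:[:[:- norm_g:]:]:] * (\<Sum>k\<in>UNIV. sub3 (family u) (F1 (e k)) * sub3 (family u) (F2 (e' k))
      - sub3 (family u) (F1 (e' k)) * sub3 (family u) (F2 (e k)))"
    unfolding C_def
    by (simp only: sub3_mult [symmetric] sub3_diff [symmetric] sub3_sum [symmetric] sub3_const [of "family u", symmetric]
        polyfun_psi polyfun_mult polyfun_diff polyfun_sum polyfun_const)
  moreover have "coeff (C * C) (n + n) \<noteq> 0"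
    using coeff_mult_lowest(1) [of n C n C] i \<open>i = n\<close> by simp
  moreover have "coeff (sub3 (family u) (F1 w) * sub3 (family u) (F2 w')) (n + n) = 0" if "w \<in> S" "w' \<in> S" for w w'
  proof (rule coeff_mult_lowest(2) [of "Suc n" _ "Suc n"])
    show "coeff (sub3 (family u) (F1 w)) j = 0" if "j < Suc n" for j
      unfolding F1_def using \<sigma> \<open>w \<in> S\<close> by (intro covector_order(2) [OF u _ n that]) auto
    show "coeff (sub3 (family u) (F2 w')) j = 0" if "j < Suc n" for j
      unfolding F2_def using \<sigma> \<open>w' \<in> S\<close> by (intro covector_order(1) [OF u _ n that]) auto
  qed simp
  then have "coeff (\<Sum>k\<in>UNIV. sub3 (family u) (F1 (e k)) * sub3 (family u) (F2 (e' k))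
      - sub3 (family u) (F1 (e' k)) * sub3 (family u) (F2 (e k))) (n + n) = 0"
    by (simp add: coeff_sum e_def e'_def proj_S)
  ultimately show False by simp
qed

lemma family_reaches:
  assumes "px (offset z) \<noteq> 0"
  shows "\<exists>u\<in>S. \<exists>t y s. ev3_point (family u) t y s = z"
proof (intro bexI exI)
  let ?t = "z $ None" and ?w = "offset z"
  \<comment> \<open>The part in \<open>S\<close> is carried back to time 0, and then \<delta> = px
    and z = py / px; the chart misses exactly the points with px = 0.\<close>
  let ?u = "moving (- ?t) (proj ?w)"
  have "offset (ev3_point (family ?u) ?t (py ?w / px ?w) (px ?w)) = ?w"
    unfolding family_point moving_inverse using assms decomposition [of ?w] by simp
  moreover have "ev3_point (family ?u) ?t (py ?w / px ?w) (px ?w) $ None = ?t" by (rule family_point)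
  ultimately show "ev3_point (family ?u) ?t (py ?w / px ?w) (px ?w) = z"
  proof -
    let ?P = "ev3_point (family ?u) ?t (py ?w / px ?w) (px ?w)"
    assume o: "offset ?P = ?w" and N: "?P $ None = ?t"
    have "?P $ k = z $ k" for k
    proof (cases k)
      case (Some j)
      have "offset ?P $ j = ?w $ j" by (simp only: o)
      then show ?thesis by (simp add: Some offset_def)
    qed (simp only: N)
    then show "?P = z" by (simp add: vec_eq_iff)
  qed
  show "?u \<in> S" by (intro moving_S proj_S)
qed

lemma polyfun_px_offset: "polyfun (\<lambda>z. px (offset z))"
proof -
  have "(\<lambda>z. px (offset z)) = (\<lambda>z. \<Sum>k\<in>UNIV. (g $ k / norm_g) * z $ Some (Inl k))"
    by (rule ext) (simp add: px_def offset_def sum_divide_distrib)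
  moreover have "polyfun (\<lambda>z. \<Sum>k\<in>UNIV. (g $ k / norm_g) * z $ Some (Inl k))"
    by (intro polyfun_sum polyfun_cmult polyfun_coord)
  ultimately show ?thesis by simp
qed

lemma px_offset_nonzero: "\<exists>z. px (offset z) \<noteq> 0"
proof
  have "offset (\<chi> k. case k of None \<Rightarrow> 0 | Some k \<Rightarrow> ux $ k) = ux" by (simp add: offset_def vec_eq_iff)
  then show "px (offset (\<chi> k. case k of None \<Rightarrow> 0 | Some k \<Rightarrow> ux $ k)) \<noteq> 0" by simp
qed

text \<open>The family argument works only inside the chart and where \<open>G0\<close> does not
  vanish; a polynomial function is determined by its values there.\<close>

lemma polyfun_generic:
  assumes "polyfun h" "\<And>z. G0 z \<noteq> 0 \<Longrightarrow> px (offset z) \<noteq> 0 \<Longrightarrow> h z = 0"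
  shows "h z = 0"
proof -
  obtain z1 z2 where "G0 z1 \<noteq> 0" "px (offset z2) \<noteq> 0" using G0_nonzero px_offset_nonzero by blast
  have "h z * G0 z = 0" for z
    by (rule polyfun_mult_eq_0 [OF _ polyfun_px_offset _ \<open>px (offset z2) \<noteq> 0\<close>])
      (use assms in \<open>auto intro!: polyfun_mult polyfun_G0\<close>)
  then show ?thesis by (rule polyfun_mult_eq_0 [OF assms(1) polyfun_G0 _ \<open>G0 z1 \<noteq> 0\<close>])
qed

lemma Om0_two_normal:
  assumes "v b = ux" "v c = uy" "b \<noteq> c" "\<And>j. j \<notin> {b, c} \<Longrightarrow> v j \<in> S"
  shows "Om0 v z = 0"
proof -
  \<comment> \<open>Carried back to time 0, so that the moving frame passes through \<open>v\<close>
    at the time of \<open>z\<close>. The value 0 at \<open>b\<close> and \<open>c\<close> is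
    overwritten later and keeps \<open>\<sigma> j\<close> in \<open>S\<close> for every
    \<open>j\<close>.\<close>
  define \<sigma> where "\<sigma> j = (if j \<in> {b, c} then 0 else moving (- z $ None) (v j))" for j
  have \<sigma>: "\<sigma> j \<in> S" for j
    using assms(4) moving_S by (auto simp: \<sigma>_def S_def px_def py_def)
  define h where "h = psi (\<sigma>(b := ux, c := uy)) ((\<lambda>j. shift (\<sigma> j))(b := 0, c := 0))"
  have "h z = 0"
  proof (rule polyfun_generic)
    show "polyfun h" unfolding h_def by (rule polyfun_psi)
    fix z assume z: "G0 z \<noteq> 0" "px (offset z) \<noteq> 0"
    obtain u t y s where u: "u \<in> S" and p: "ev3_point (family u) t y s = z" using family_reaches [OF z(2)] by blast
    have "ev3 (sub3 (family u) G0) t y s \<noteq> 0" using z(1) by (simp add: ev3_sub3 polyfun_G0 p)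
    then have "sub3 (family u) G0 \<noteq> 0" by (auto simp: ev3_vars)
    then have "sub3 (family u) h = 0" unfolding h_def by (rule scalar_vanishes_on_family [OF u \<sigma> \<open>b \<noteq> c\<close>])
    then show "h z = 0" using ev3_sub3 [of h "family u" t y s] by (simp add: h_def polyfun_psi p ev3_vars)
  qed
  moreover have "h z = Om0 v z"
    unfolding h_def psi_def
  proof (rule arg_cong [of _ _ "\<lambda>v. Om0 v z"], rule ext)
    fix j
    have "moving (- z $ None) (v j) + z $ None *s shift (moving (- z $ None) (v j)) = v j"
      using moving_inverse [of "z $ None" "v j"] by (simp add: moving_def [of "z $ None"])
    then show "(\<sigma>(b := ux, c := uy)) j + z $ None *s ((\<lambda>j. shift (\<sigma> j))(b := 0, c := 0)) j = v j"
      using assms by (auto simp: \<sigma>_def)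
  qed
  ultimately show ?thesis by simp
qed

text \<open>Once the components on dx dy are gone, closedness of the form says that the covector
  (hx, hy) is closed in (x, y) up to the denominator. Its leading part would be a multiple of x dy -
  y dx, which is not closed.\<close>

lemma Om0_one_normal:
  assumes vq: "v q = ux \<or> v q = uy" and v: "\<And>j. j \<noteq> q \<Longrightarrow> v j \<in> S"
    and z: "G0 z \<noteq> 0" "px (offset z) \<noteq> 0"
  shows "Om0 v z = 0"
proof -
  define \<sigma> where "\<sigma> j = moving (- z $ None) (v j)" for j
  define s' where "s' = (\<lambda>j. shift (\<sigma> j))(q := 0)"
  have \<sigma>: "\<sigma> j \<in> S" if "j \<noteq> q" for j
    using v [OF that] moving_S by (auto simp: \<sigma>_def)
  define hx where "hx = psi (\<sigma>(q := ux)) s'"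
  define hy where "hy = psi (\<sigma>(q := uy)) s'"
  have ph: "polyfun hx" "polyfun hy" by (simp_all add: hx_def hy_def polyfun_psi)
  have closed: "G0 z * (transverse ux hy z - transverse uy hx z) - (hy z * transverse ux G0 z - hx z * transverse uy G0 z) = 0" for z
  proof -
    \<comment> \<open>Transverse derivatives do not touch the time, so the frame may be frozen at
      its value at \<open>z\<close>.\<close>
    define V where "V = (\<lambda>j. \<sigma> j + z $ None *s shift (\<sigma> j))"
    have V: "(\<lambda>j. (\<sigma>(q := u)) j + z $ None *s s' j) = V(q := u)" for u
      by (auto simp: V_def s'_def)
    have VS: "V j \<in> S" if "j \<noteq> q" for j
      using moving_S [OF \<sigma> [OF that], of "z $ None"] by (simp add: V_def moving_def)
    have tr: "transverse w hx z = transverse w (Om0 (V(q := ux))) z" "transverse w hy z = transverse w (Om0 (V(q := uy))) z" for w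
      by (simp_all add: transverse_def hx_def hy_def partial_psi V del: fun_upd_apply)
    have val: "hx z = Om0 (V(q := ux)) z" "hy z = Om0 (V(q := uy)) z"
      by (simp_all add: hx_def hy_def psi_def V del: fun_upd_apply)
    \<comment> \<open>The other terms of the exterior derivative have both \<open>ux\<close> and
      \<open>uy\<close> in their slots; these components vanish identically, hence so do their
      derivatives.\<close>
    have "nabla (V c) (V(q := uy, c := ux)) z = 0" if "c \<noteq> q" for c
    proof -
      have "Om0 (V(q := uy, c := ux)) = (\<lambda>z. 0)"
        by (rule ext, rule Om0_two_normal [of _ c q]) (use that VS in auto)
      then show ?thesis by (simp add: nabla_def transverse_def)
    qed
    then have "nabla ux (V(q := uy)) z - nabla uy (V(q := ux)) z = 0"
      unfolding Om0_closed by (intro sum.neutral) auto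
    then show ?thesis unfolding tr val nabla_def by (simp add: algebra_simps)
  qed
  obtain u t y s where u: "u \<in> S" and p: "ev3_point (family u) t y s = z" using family_reaches [OF z(2)] by blast
  define Gm where "Gm = sub3 (family u) G0"
  define Bx where "Bx = sub3 (family u) hx"
  define By where "By = sub3 (family u) hy"
  have "ev3 Gm t y s \<noteq> 0" using z(1) by (simp add: Gm_def ev3_sub3 polyfun_G0 p)
  then have Gm: "Gm \<noteq> 0" by (auto simp: ev3_vars)
  have pt: "polyfun (transverse w h)" if "polyfun h" for w h
    unfolding transverse_def [abs_def] by (intro polyfun_sum polyfun_cmult polyfun_partial that)
  have "(\<lambda>z. G0 z * (transverse ux hy z - transverse uy hx z) - (hy z * transverse ux G0 z - hx z * transverse uy G0 z)) = (\<lambda>z. 0)"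
    by (rule ext) (rule closed)
  then have "sub3 (family u) (\<lambda>z. G0 z * (transverse ux hy z - transverse uy hx z) - (hy z * transverse ux G0 z - hx z * transverse uy G0 z)) = 0"
    by simp
  then have "Gm * (sub3 (family u) (transverse ux hy) - sub3 (family u) (transverse uy hx))
      - (By * sub3 (family u) (transverse ux G0) - Bx * sub3 (family u) (transverse uy G0)) = 0"
    unfolding Gm_def Bx_def By_def
    by (simp only: sub3_mult sub3_diff ph polyfun_G0 pt polyfun_mult polyfun_diff)
  \<comment> \<open>Multiplication by \<delta> turns the derivatives along \<open>ux\<close> and
    \<open>uy\<close> into the polynomial derivations \<open>delta_dx\<close> and
    \<open>map_poly pderiv\<close>.\<close>
  then have "[:0, 1:] * (Gm * (sub3 (family u) (transverse ux hy) - sub3 (family u) (transverse uy hx))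
      - (By * sub3 (family u) (transverse ux G0) - Bx * sub3 (family u) (transverse uy G0))) = 0"
    by (simp only: mult_zero_right)
  moreover have "x * (e * (k - l) - (n * o' - r * w)) = e * (x * k - x * l) - (n * (x * o') - r * (x * w))"
    for x e k l n o' r w :: "complex poly poly poly" by (simp add: algebra_simps)
  ultimately have "Gm * (delta_dx By - map_poly pderiv Bx) - (By * delta_dx Gm - Bx * map_poly pderiv Gm) = 0"
    unfolding Gm_def Bx_def By_def sub3_transverse_ux [OF ph(2)] sub3_transverse_uy [OF ph(1)]
      sub3_transverse_ux [OF polyfun_G0] sub3_transverse_uy [OF polyfun_G0] by metis
  moreover note sub3_covector [OF u, of q \<sigma> "\<lambda>j. shift (\<sigma> j)", folded s'_def hx_def hy_def Gm_def Bx_def By_def]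
  ultimately have "Bx = 0 \<and> By = 0"
    using \<sigma> Gm lam m euler_riccati_covector_not_closed [of Gm lam m By Bx] by blast
  then have "hx z = 0" "hy z = 0"
    using ev3_sub3 [OF ph(1), of "family u" t y s] ev3_sub3 [OF ph(2), of "family u" t y s]
    by (simp_all add: Bx_def By_def p ev3_vars)
  moreover have "Om0 v z = (if v q = ux then hx z else hy z)"
  proof -
    have "moving (- z $ None) (v j) + z $ None *s shift (moving (- z $ None) (v j)) = v j" for j
      using moving_inverse [of "z $ None" "v j"] by (simp add: moving_def [of "z $ None"])
    then have "(\<lambda>j. (\<sigma>(q := v q)) j + z $ None *s s' j) = v"
      by (auto simp: \<sigma>_def s'_def)
    then have "psi (\<sigma>(q := v q)) s' z = Om0 v z" unfolding psi_def by simp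
    then show ?thesis using vq unfolding hx_def hy_def by auto
  qed
  ultimately show ?thesis by simp
qed


section \<open>Adapted frames and the Lagrangian subspace\<close>

lemma adapted_frame:
  assumes "Om0 v z \<noteq> 0"
  shows "\<exists>v'. (\<forall>j. v' j \<in> S \<or> v' j = ux \<or> v' j = uy) \<and> Om0 v' z \<noteq> 0"
proof -
  have "\<exists>v'. (\<forall>j\<in>J. v' j \<in> S \<or> v' j = ux \<or> v' j = uy) \<and> Om0 v' z \<noteq> 0" if "finite J" for J
    using that
  proof (induction J rule: finite_induct)
    case empty
    then show ?case using assms by blast
  next
    case (insert i J)
    then obtain v' where v': "\<And>j. j \<in> J \<Longrightarrow> v' j \<in> S \<or> v' j = ux \<or> v' j = uy" "Om0 v' z \<noteq> 0" by blast
    define w where "w = v' i"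
    have "Om0 v' z = Om0 (v'(i := proj w + px w *s ux + py w *s uy)) z"
      by (simp only: decomposition [symmetric] w_def fun_upd_triv)
    also have "\<dots> = Om0 (v'(i := proj w)) z + px w * Om0 (v'(i := ux)) z + py w * Om0 (v'(i := uy)) z"
      by (simp only: Om0_add Om0_scale)
    finally have "Om0 (v'(i := proj w)) z \<noteq> 0 \<or> Om0 (v'(i := ux)) z \<noteq> 0 \<or> Om0 (v'(i := uy)) z \<noteq> 0"
      using v'(2) by auto
    then obtain x where x: "x \<in> S \<or> x = ux \<or> x = uy" "Om0 (v'(i := x)) z \<noteq> 0" using proj_S by blast
    show ?case
    proof (intro exI conjI)
      show "\<forall>j\<in>insert i J. (v'(i := x)) j \<in> S \<or> (v'(i := x)) j = ux \<or> (v'(i := x)) j = uy"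
        using v'(1) x(1) by auto
    qed (rule x(2))
  qed
  from this [OF finite [of UNIV]] show ?thesis by simp
qed

text \<open>An alternating form admits \<open>ux\<close> and \<open>uy\<close> at most once each, so
  a frame not inside \<open>S\<close> has one or two normal vectors, and both cases are
  excluded.\<close>

lemma adapted_frame_in_S:
  assumes v: "\<And>j. v j \<in> S \<or> v j = ux \<or> v j = uy" and nz: "Om0 v z \<noteq> 0" and z: "G0 z \<noteq> 0" "px (offset z) \<noteq> 0"
  shows "v j \<in> S"
proof (rule ccontr)
  assume j: "v j \<notin> S"
  have alt: "b = c" if "v b = v c" for b c using Om0_alternating [of v b c z] nz that by blast
  have "\<not> (\<forall>i. i \<noteq> j \<longrightarrow> v i \<in> S)"
    using Om0_one_normal [of v j z] z nz v [of j] j by blast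
  then obtain i where i: "i \<noteq> j" "v i \<notin> S" by blast
  have others: "v k \<in> S" if "k \<notin> {i, j}" for k
    using v [of k] v [of i] v [of j] i j alt [of k i] alt [of k j] alt [of i j] that by auto
  have "v i \<noteq> v j" using alt i(1) by blast
  then consider "v i = ux" "v j = uy" | "v i = uy" "v j = ux" using v [of i] v [of j] i j by auto
  then show False
  proof cases
    case 1
    then show False using Om0_two_normal [of v i j z] i(1) others nz by blast
  next
    case 2
    then show False using Om0_two_normal [of v j i z] i(1) others nz by blast
  qed
qed

lemma generic_nonzero: "\<exists>v z. Om0 v z \<noteq> 0 \<and> G0 z \<noteq> 0 \<and> px (offset z) \<noteq> 0"
proof (rule ccontr)
  assume "\<not> ?thesis"
  then have "Om0 v z = 0" if "G0 z \<noteq> 0" "px (offset z) \<noteq> 0" for v z using that by blast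
  then have "Om0 v z = 0" for v z by (rule polyfun_generic [OF polyfun_Om0])
  then show False using Om0_nonzero by blast
qed

text \<open>The span of the covectors \<open>f b\<close> is Lagrangian and is annihilated by \<open>e\<^sub>x\<close> and \<open>e\<^sub>y\<close>.\<close>
lemma contradiction: False
proof -
  obtain v0 z where v0: "Om0 v0 z \<noteq> 0" and z: "G0 z \<noteq> 0" "px (offset z) \<noteq> 0" using generic_nonzero by blast
  obtain v where v': "\<And>j. v j \<in> S \<or> v j = ux \<or> v j = uy" and nz: "Om0 v z \<noteq> 0" using adapted_frame [OF v0] by blast
  have v: "v j \<in> S" for j by (rule adapted_frame_in_S [OF v' nz z])
  define f where "f b u = Om0 (v(b := u)) z" for b u
  have f_expand: "f b u = (\<Sum>l\<in>UNIV. u $ l * f b (axis l 1))" for b u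
    unfolding f_def by (rule Om0_expand)
  have f_add: "f b (u + w) = f b u + f b w" and f_scale: "f b (c *s u) = c * f b u" for b u w c
    unfolding f_def by (rule Om0_add, rule Om0_scale)
  have f_sum: "f b (\<Sum>i\<in>I. u i) = (\<Sum>i\<in>I. f b (u i))" for b I and u :: "'n \<Rightarrow> complex ^ ('n + 'n)"
    by (induction I rule: infinite_finite_induct) (use f_scale [of b 0 0] in \<open>auto simp: f_add\<close>)
  have f_u: "f b ux = 0" "f b uy = 0" for b
    unfolding f_def by (rule Om0_one_normal [of _ b]; use v z in auto)+
  have f_v: "f b (v c) = (if b = c then Om0 v z else 0)" for b c
    unfolding f_def by (auto intro: Om0_alternating [of _ b c])
  have split: "(\<Sum>l\<in>UNIV. h l) = (\<Sum>k\<in>UNIV. h (Inl k)) + (\<Sum>k\<in>UNIV. h (Inr k))" for h :: "'n + 'n \<Rightarrow> complex"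
    by (subst UNIV_Plus_UNIV [symmetric], subst sum.Plus) simp_all
  \<comment> \<open>\<open>K b\<close> is the symplectic gradient of the covector
    \<open>f b\<close>; isotropy then reads \<open>f c (K b) = 0\<close>.\<close>
  define K where "K b = (\<chi> l. case l of Inl k \<Rightarrow> f b (axis (Inr k) 1) | Inr k \<Rightarrow> - f b (axis (Inl k) 1))" for b
  have f_K: "f c (K b) = 0" for b c
  proof -
    have "f c (K b) = - (\<Sum>k\<in>UNIV. f b (axis (Inl k) 1) * f c (axis (Inr k) 1) - f b (axis (Inr k) 1) * f c (axis (Inl k) 1))"
      by (subst f_expand, subst split) (simp add: K_def sum_negf sum_subtractf)
    then show ?thesis unfolding f_def Om0_isotropic by simp
  qed
  \<comment> \<open>The \<open>K b\<close> span a Lagrangian subspace, and the \<open>v b\<close>,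
    on which the \<open>f c\<close> are diagonal, span a complement. These 2 n columns are
    independent, so \<open>A\<close> is invertible.\<close>
  define A :: "complex ^ ('n + 'n) ^ ('n + 'n)" where
    "A = (\<chi> l c. case c of Inl b \<Rightarrow> K b $ l | Inr b \<Rightarrow> v b $ l)"
  have A: "A *v x = (\<Sum>b\<in>UNIV. x $ Inl b *s K b) + (\<Sum>b\<in>UNIV. x $ Inr b *s v b)" for x
    by (simp add: vec_eq_iff matrix_vector_mult_def split A_def mult.commute)
  have f_A: "f c (A *v x) = x $ Inr c * Om0 v z" for c x
  proof -
    have "f c (A *v x) = (\<Sum>b\<in>UNIV. x $ Inr b * f c (v b))"
      by (simp add: A f_add f_sum f_scale f_K)
    also have "\<dots> = (\<Sum>b\<in>UNIV. if b = c then x $ Inr c * Om0 v z else 0)"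
      by (rule sum.cong) (auto simp: f_v)
    finally show ?thesis by simp
  qed
  have "x = 0" if "A *v x = 0" for x
  proof -
    have r: "x $ Inr c = 0" for c using f_A [of c x] that nz f_scale [of c 0 0] by simp
    then have "(\<Sum>b\<in>UNIV. x $ Inl b *s K b) = 0" using that by (simp add: A)
    then have k: "(\<Sum>b\<in>UNIV. x $ Inl b * K b $ l) = 0" for l
      by (metis (no_types, lifting) sum_component sum.cong vector_smult_component zero_index)
    have "(\<Sum>b\<in>UNIV. x $ Inl b * f b (axis l 1)) = 0" for l
    proof (cases l)
      case (Inl i)
      then show ?thesis using k [of "Inr i"] by (simp add: K_def sum_negf)
    next
      case (Inr i)
      then show ?thesis using k [of "Inl i"] by (simp add: K_def)
    qed
    then have s: "(\<Sum>b\<in>UNIV. x $ Inl b * f b u) = 0" for u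
    proof -
      assume *: "\<And>l. (\<Sum>b\<in>UNIV. x $ Inl b * f b (axis l 1)) = 0"
      have "(\<Sum>b\<in>UNIV. x $ Inl b * f b u) = (\<Sum>b\<in>UNIV. \<Sum>l\<in>UNIV. u $ l * (x $ Inl b * f b (axis l 1)))"
        by (subst f_expand) (simp add: sum_distrib_left mult_ac)
      also have "\<dots> = (\<Sum>l\<in>UNIV. u $ l * (\<Sum>b\<in>UNIV. x $ Inl b * f b (axis l 1)))"
        by (subst sum.swap) (simp add: sum_distrib_left)
      finally show ?thesis by (simp add: *)
    qed
    have "x $ Inl c = 0" for c
    proof -
      have "(\<Sum>b\<in>UNIV. x $ Inl b * f b (v c)) = (\<Sum>b\<in>UNIV. if b = c then x $ Inl c * Om0 v z else 0)"
        by (rule sum.cong) (auto simp: f_v)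
      then show ?thesis using s [of "v c"] nz by simp
    qed
    with r show "x = 0" by (auto simp: vec_eq_iff split_sum_all)
  qed
  then have "\<exists>B. B ** A = mat 1" unfolding matrix_left_invertible_ker by blast
  then obtain B where "A ** B = mat 1" using matrix_left_right_inverse by blast
  \<comment> \<open>Every \<open>f c\<close> kills \<open>ux\<close>, so \<open>ux\<close> has no
    part along the \<open>v b\<close> and lies in the span of the \<open>K b\<close>. All of these
    are symplectically orthogonal to \<open>uy\<close>, because \<open>f b uy = 0\<close>, whereas
    \<open>ux\<close> and \<open>uy\<close> have symplectic product \<open>norm_g\<close> up to
    sign.\<close>
  then have x: "A *v (B *v ux) = ux" by (simp add: matrix_vector_mul_assoc)
  define x where "x = B *v ux"
  have "x $ Inr c = 0" for c using f_A [of c x] f_u(1) [of c] nz x by (simp add: x_def)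
  then have "ux = (\<Sum>b\<in>UNIV. x $ Inl b *s K b)" using x A [of x] by (simp add: x_def)
  then have "ux $ Inl k = (\<Sum>b\<in>UNIV. x $ Inl b * f b (axis (Inr k) 1))" for k
    by (simp add: K_def)
  then have g: "g $ k = (\<Sum>b\<in>UNIV. x $ Inl b * f b (axis (Inr k) 1))" for k
    by (simp add: ux_def)
  have "norm_g = (\<Sum>k\<in>UNIV. \<Sum>b\<in>UNIV. x $ Inl b * (g $ k * f b (axis (Inr k) 1)))"
    unfolding norm_g_def power2_eq_square by (subst (2) g) (simp add: sum_distrib_left mult_ac)
  also have "\<dots> = (\<Sum>b\<in>UNIV. x $ Inl b * (\<Sum>k\<in>UNIV. g $ k * f b (axis (Inr k) 1)))"
    by (subst sum.swap) (simp add: sum_distrib_left)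
  also have "\<dots> = 0"
  proof -
    have "f b uy = (\<Sum>k\<in>UNIV. g $ k * f b (axis (Inr k) 1))" for b
      by (subst f_expand, subst split) (simp add: uy_def)
    then show ?thesis by (simp add: f_u)
  qed
  finally show False using norm_g by simp
qed

end

theorem theorem3p1:
  fixes V V0 V1 :: "'n::finite cpoly"
    and k :: nat
    and d :: "complex ^ 'n"
  assumes "homogeneous_poly k V"
    and "k > 2"
    and "V = V0\<^sup>2 * V1"
    and "\<not> constant_poly V0"
    and "eval_poly V0 d = 0"
    and "eval_poly V1 d \<noteq> 0"
    and "(\<Sum>i\<in>UNIV. (partial i (eval_poly V0) d)\<^sup>2) \<noteq> 0"
  shows "\<not> integrable_with_rational_first_integrals V"
proof
  assume "integrable_with_rational_first_integrals V"
  then obtain Om G where "invariant_form Om G (\<lambda>k x. hamiltonian_field V x $ k)"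
    using integrable_imp_invariant_form by blast
  then interpret invariant_form Om G "\<lambda>k x. hamiltonian_field V x $ k" .
  interpret linearized_form Om G "\<lambda>k x. hamiltonian_field V x $ k" d "\<chi> i. partial i (eval_poly V0) d"
    "2 * eval_poly V1 d" "k - 2"
    by unfold_locales
      (rule expansion_hamiltonian_field [OF assms(1-3) assms(5)] | use assms(2,6,7) in simp)+
  show False by (rule contradiction)
qed

end
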